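(* Let $n\ge1$ be an integer, let $M>2$ be a prime, and let $q$ range over prime powers with $(M,q)=1$. Then, as $q\to\infty$ through such prime powers, the proportion $|\mathrm{U}(n,q)^M|/|\mathrm{U}(n,q)|$ has asymptotic value $$\sum_{\substack{\lambda\vdash n\\ \lambda=1^{m_1}2^{m_2}\cdots i^{m_i}\cdots}}\frac{1}{M^{\pi'_{o(q)}(\lambda)}}\prod_i\frac{1}{m_i!\,i^{m_i}}=\sum_{\lambda\vdash n}\frac{1}{M^{\pi'_{o(q)}(\lambda)}\,|\mathcal Z_{S_n}(\sigma_\lambda)|},$$ i.e. the difference between the proportion and this sum (which depends on $q$ only through $o(q)$) tends to $0$.
   Context: $\mathrm{U}(n,q)\subset \mathrm{GL}(n,q^2)$ is the finite unitary group, the group of fixed points of $F\colon (a_{ij})\mapsto {}^t(a_{ij}^q)^{-1}$ on $\mathrm{GL}(n,\overline{\mathbb F_q})$, and $\mathrm{U}(n,q)^M=\{x^M:x\in\mathrm{U}(n,q)\}$. $o(q)$ is the multiplicative order of $q$ in $(\mathbb Z/M\mathbb Z)^\times$. For a partition $\lambda=(n_1,\dots,n_s)$ of $n$, $\pi'_{o(q)}(\lambda)$ is the number of indices $j$ such that either $n_j$ is even and $o(q)\mid n_j$, or $n_j$ is odd, $o(q)$ is even and $o(q)\mid 2n_j$. In power notation, $m_i\ge0$ is the number of parts of $\lambda$ equal to $i$. $\sigma_\lambda\in S_n$ is a permutation of cycle type $\lambda$ and $\mathcal Z_{S_n}(\sigma_\lambda)$ is its centralizer in $S_n$. *)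

theory Defs
  imports
    Complex_Main
    "HOL-Number_Theory.Number_Theory"
    "HOL-Algebra.Algebraic_Closure"
    "HOL-Algebra.Sym_Groups"
    "HOL-Combinatorics.Orbits"
    "Jordan_Normal_Form.Matrix"
begin

section \<open>Matrices over a ring with explicit carrier\<close>

text \<open>The prime power \<open>q\<close>, and with it the characteristic, varies inside the statement, so the
  ground field cannot be a type. We use the type \<^typ>\<open>'a mat\<close> of Jordan normal forms together with
  its class-free operations, but take the arithmetic of the entries from a HOL-Algebra ring.\<close>

definition matrix_monoid :: "nat \<Rightarrow> ('a, 'b) ring_scheme \<Rightarrow> 'a mat monoid" where
  "matrix_monoid n K =
     \<lparr> carrier = {A \<in> carrier_mat n n. elements_mat A \<subseteq> carrier K},
       mult = (\<lambda>A B. mat n n (\<lambda>(i, j). \<Oplus>\<^bsub>K\<^esub>k\<in>{..<n}. A $$ (i, k) \<otimes>\<^bsub>K\<^esub> B $$ (k, j))),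
       one = mat n n (\<lambda>(i, j). if i = j then \<one>\<^bsub>K\<^esub> else \<zero>\<^bsub>K\<^esub>) \<rparr>"

definition general_linear_group :: "nat \<Rightarrow> ('a, 'b) ring_scheme \<Rightarrow> 'a mat monoid" where
  "general_linear_group n K = units_of (matrix_monoid n K)"

section \<open>The finite unitary groups\<close>

type_synonym fpbar = "(int list \<times> nat) multiset \<Rightarrow> int"

text \<open>The algebraic closure of the prime field of residues modulo \<open>p\<close>, where \<open>p\<close> is the prime
  dividing the prime power \<open>q\<close>.\<close>

definition fq_closure :: "nat \<Rightarrow> fpbar ring" where
  "fq_closure q = field.alg_closure (residue_ring (int (aprimedivisor q)))"

definition unitary_frobenius :: "nat \<Rightarrow> nat \<Rightarrow> fpbar mat \<Rightarrow> fpbar mat" where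
  "unitary_frobenius n q A =
     inv\<^bsub>general_linear_group n (fq_closure q)\<^esub>
       (transpose_mat (map_mat (\<lambda>a. a [^]\<^bsub>fq_closure q\<^esub> q) A))"

definition unitary_group :: "nat \<Rightarrow> nat \<Rightarrow> fpbar mat monoid" where
  "unitary_group n q =
     (general_linear_group n (fq_closure q))
       \<lparr> carrier := {A \<in> carrier (general_linear_group n (fq_closure q)).
                      unitary_frobenius n q A = A} \<rparr>"

definition power_image :: "('a, 'b) monoid_scheme \<Rightarrow> nat \<Rightarrow> 'a set" where
  "power_image G M = (\<lambda>x. x [^]\<^bsub>G\<^esub> M) ` carrier G"

section \<open>Partitions, cycle types and centralizers\<close>

text \<open>A partition is the multiset of its parts, so that \<^term>\<open>count \<mu> i\<close> is the number of parts
  equal to \<open>i\<close>.\<close>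

definition partitions :: "nat \<Rightarrow> nat multiset set" where
  "partitions n = {\<mu>. 0 \<notin># \<mu> \<and> sum_mset \<mu> = n}"

definition pi' :: "nat \<Rightarrow> nat multiset \<Rightarrow> nat" where
  "pi' d \<mu> = size {#k \<in># \<mu>. (even k \<and> d dvd k) \<or> (odd k \<and> even d \<and> d dvd 2 * k)#}"

text \<open>Fixed points give orbits of size 1, hence parts equal to 1.\<close>

definition cycle_type :: "nat \<Rightarrow> (nat \<Rightarrow> nat) \<Rightarrow> nat multiset" where
  "cycle_type n s = image_mset card (mset_set (Orbits.orbit s ` {1..n}))"

definition centralizer :: "('a, 'b) monoid_scheme \<Rightarrow> 'a \<Rightarrow> 'a set" where
  "centralizer G x = {g \<in> carrier G. g \<otimes>\<^bsub>G\<^esub> x = x \<otimes>\<^bsub>G\<^esub> g}"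

end

theory Submission
  imports Defs
    "Jordan_Normal_Form.Char_Poly"
begin

text \<open>Let \<open>\<phi> x = x\<^sup>-\<^sup>q\<close>. The eigenvalues of a unitary matrix are permuted by \<open>\<phi>\<close>; if they are distinct
  and listed as \<open>t\<close>, this gives a permutation \<open>s\<close> with \<open>t (s i) = \<phi> (t i)\<close>, that is, a point of the finite torus
  \<open>T\<^sub>s\<close> of order \<open>\<Prod>(q\<^sup>k - (-1)\<^sup>k)\<close>, the product over the cycle lengths \<open>k\<close> of \<open>s\<close>. Conversely, every injective
  \<open>t \<in> T\<^sub>s\<close> is the list of eigenvalues of a unitary matrix, whose centralizer is isomorphic to \<open>T\<^sub>s\<close>, so that
  it is an \<open>M\<close>-th power iff \<open>t\<close> is one in \<open>T\<^sub>s\<close>. Each conjugacy class found this way has at least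
  \<open>|U| / |T\<^sub>s|\<close> elements and arises from at most \<open>n!\<close> pairs \<open>(s, t)\<close>. Since only a fraction \<open>O(1/q)\<close> of \<open>T\<^sub>s\<close> is not
  injective, both the proportion of \<open>M\<close>-th powers and that of the other elements are bounded below, up to
  \<open>O(1/q)\<close>, by the average over \<open>s\<close> of the corresponding proportions in \<open>T\<^sub>s\<close>. These lower bounds add up to 1,
  so both are sharp; neither the order of the unitary group nor Lang's theorem is needed.\<close>

subsection \<open>Equivariant maps between finite permuted sets\<close>

text \<open>The exponent \<open>pi'\<close> comes from the tori. Read off at one point of each
  cycle, T_s is a product of groups of roots of unity of order q^k - (-1)^k. The index of the M-th
  powers is the number of M-torsion points, to which a cycle contributes M or 1 according to whether
  the prime M divides q^k - (-1)^k; for M > 2 that is the condition counted by \<open>pi'\<close>.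
  The average over s becomes the sum over partitions because a cycle type occurs n!/|Z| times in
  S_n. The obstacle is to realize a given t by a unitary matrix. In the eigenbasis the invariant
  form pairs coordinate i with s i, and this form has to be made isometric to the standard one. The
  Vandermonde matrix of the distinct t i achieves it: taking q^2-th powers permutes its rows, which
  makes the form Hermitian over the field of q^2 elements in the new basis, and there a
  nondegenerate Hermitian form has an orthonormal basis. The error bound 4 n^2 / q is explicit, so
  that one characteristic can be treated at a time, although the limit mixes all of them.\<close>

definition equivariant :: "'a set \<Rightarrow> ('a \<Rightarrow> 'a) \<Rightarrow> 'b set \<Rightarrow> ('b \<Rightarrow> 'b) \<Rightarrow> ('a \<Rightarrow> 'b) set" where
  "equivariant S s Y t = {f \<in> PiE S (\<lambda>_. Y). \<forall>x\<in>S. f (s x) = t (f x)}"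

text \<open>\<open>cycle_type n\<close> is the case S = {1..n}. An arbitrary set S is allowed so
  that inductions can remove one orbit at a time.\<close>

definition orbit_type :: "'a set \<Rightarrow> ('a \<Rightarrow> 'a) \<Rightarrow> nat multiset" where
  "orbit_type S s = image_mset card (mset_set (orbit s ` S))"

lemma orbit_subset_carrier:
  assumes "bij_betw s S S" "x \<in> S"
  shows "orbit s x \<subseteq> S"
proof
  fix y assume "y \<in> orbit s x"
  then show "y \<in> S"
    by induct (use assms in \<open>auto simp: bij_betw_def\<close>)
qed

text \<open>\<open>orbit s x\<close> starts at s x, so x returns to itself only because S is finite:
  two iterates coincide, and the smaller power of s can be cancelled since it is injective.\<close>

lemma self_in_orbit:
  assumes S: "finite S" "bij_betw s S S" "x \<in> S"
  shows "x \<in> orbit s x"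
proof -
  have in_X: "(s ^^ n) x \<in> S" for n
    using bij_betw_funpow[OF S(2), of n] S(3) by (auto simp: bij_betw_def)
  have "\<not> inj_on (\<lambda>n. (s ^^ n) x) UNIV"
  proof
    assume "inj_on (\<lambda>n. (s ^^ n) x) UNIV"
    moreover have "range (\<lambda>n. (s ^^ n) x) \<subseteq> S" using in_X by auto
    ultimately have "finite (UNIV :: nat set)"
      using S(1) by (metis finite_imageD finite_subset)
    then show False by simp
  qed
  then obtain i j where "(s ^^ i) x = (s ^^ j) x" "i \<noteq> j"
    by (auto simp: inj_on_def)
  then obtain i j where ij: "(s ^^ i) x = (s ^^ j) x" "i < j"
    by (metis linorder_neqE_nat)
  have "(s ^^ i) x = (s ^^ i) ((s ^^ (j - i)) x)"
    using ij by (metis add_diff_inverse_nat comp_apply funpow_add less_imp_not_less)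
  moreover have "inj_on (s ^^ i) S"
    using bij_betw_funpow[OF S(2), of i] by (simp add: bij_betw_def)
  ultimately have "(s ^^ (j - i)) x = x"
    using S(3) in_X by (metis inj_on_eq_iff)
  then show ?thesis
    using ij(2) by (auto simp: orbit_altdef intro!: exI[of _ "j - i"])
qed

lemma orbit_eq_or_disjoint:
  assumes "finite S" "bij_betw s S S" "x \<in> S" "y \<in> S"
  shows "orbit s x = orbit s y \<or> orbit s x \<inter> orbit s y = {}"
proof (rule disjCI)
  assume "orbit s x \<inter> orbit s y \<noteq> {}"
  then obtain u where u: "u \<in> orbit s x" "u \<in> orbit s y" by auto
  have "x \<in> orbit s u" "y \<in> orbit s u"
    using u self_in_orbit[OF assms(1,2)] assms(3,4) orbit_swap by metis+
  then have "orbit s x = orbit s u" "orbit s y = orbit s u"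
    using u orbit_trans[where f = s] by blast+
  then show "orbit s x = orbit s y" by simp
qed

lemma
  assumes "x \<in> orbit s x"
  shows funpow_card_orbit: "(s ^^ card (orbit s x)) x = x"
    and orbit_eq_image: "orbit s x = (\<lambda>m. (s ^^ m) x) ` {..<card (orbit s x)}"
    and inj_on_orbit: "inj_on (\<lambda>m. (s ^^ m) x) {..<card (orbit s x)}"
    and card_orbit_pos: "card (orbit s x) > 0"
proof -
  let ?d = "funpow_dist1 s x x"
  have orb: "orbit s x = (\<lambda>m. (s ^^ m) x) ` {..<?d}"
    using orbit_conv_funpow_dist1[OF assms] by (simp add: lessThan_atLeast0)
  have inj: "inj_on (\<lambda>m. (s ^^ m) x) {..<?d}"
    using inj_on_funpow_dist1[OF assms] by (simp add: lessThan_atLeast0)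
  have "card (orbit s x) = ?d"
    by (subst orb, subst card_image[OF inj]) simp
  then show "(s ^^ card (orbit s x)) x = x"
    and "orbit s x = (\<lambda>m. (s ^^ m) x) ` {..<card (orbit s x)}"
    and "inj_on (\<lambda>m. (s ^^ m) x) {..<card (orbit s x)}"
    and "card (orbit s x) > 0"
    using funpow_dist1_prop[OF assms] orb inj by auto
qed

lemma bij_betw_Diff_orbit:
  assumes "finite S" "bij_betw s S S" "x \<in> S"
  shows "bij_betw s (orbit s x) (orbit s x)" "bij_betw s (S - orbit s x) (S - orbit s x)"
proof -
  have sub: "orbit s x \<subseteq> S" by (rule orbit_subset_carrier[OF assms(2,3)])
  have "inj_on s (orbit s x)"
    using assms(2) sub by (meson bij_betw_def inj_on_subset)
  moreover have "s ` orbit s x \<subseteq> orbit s x" by (auto intro: orbit.step)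
  ultimately show "bij_betw s (orbit s x) (orbit s x)"
    using sub assms(1) by (simp add: bij_betw_def endo_inj_surj finite_subset)
  then show "bij_betw s (S - orbit s x) (S - orbit s x)"
    by (rule bij_betw_DiffI[OF assms(2)]) (use sub in auto)
qed

lemma equivariant_funpow:
  assumes "f \<in> equivariant S s Y t" "bij_betw s S S" "x \<in> S"
  shows "f ((s ^^ m) x) = (t ^^ m) (f x)"
proof (induction m)
  case (Suc m)
  have "(s ^^ m) x \<in> S"
    using bij_betw_funpow[OF assms(2), of m] assms(3) by (auto simp: bij_betw_def)
  then show ?case using Suc assms(1) by (auto simp: equivariant_def)
qed auto

text \<open>The value at x determines an equivariant map on the whole orbit, and closing up after k
  steps is the only constraint on that value. This turns every count of equivariant maps into a
  product over cycles.\<close>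

lemma bij_betw_equivariant_split:
  assumes S: "finite S" "bij_betw s S S" "x \<in> S" and Y: "t \<in> Y \<rightarrow> Y"
  shows "bij_betw (\<lambda>f. (restrict f (S - orbit s x), f x)) (equivariant S s Y t)
           (equivariant (S - orbit s x) s Y t \<times> {y \<in> Y. (t ^^ card (orbit s x)) y = y})"
    (is "bij_betw ?F ?A (?B \<times> ?C)")
proof (rule bij_betw_imageI)
  define k where "k = card (orbit s x)"
  have self: "x \<in> orbit s x" by (rule self_in_orbit[OF S])
  have sub: "orbit s x \<subseteq> S" by (rule orbit_subset_carrier[OF S(2,3)])
  note orb = orbit_eq_image[OF self, folded k_def] and inj = inj_on_orbit[OF self, folded k_def]
    and pow_k = funpow_card_orbit[OF self, folded k_def]
  have k: "k > 0" using card_orbit_pos[OF self] by (simp add: k_def)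
  have s_in: "s u \<in> S" if "u \<in> S" for u using S(2) that by (auto simp: bij_betw_def)
  have s_out: "s u \<in> S - orbit s x" if "u \<in> S - orbit s x" for u
    using bij_betw_Diff_orbit(2)[OF S] that by (auto simp: bij_betw_def)
  show "inj_on ?F ?A"
  proof (rule inj_onI)
    fix f g assume fg: "f \<in> ?A" "g \<in> ?A" "?F f = ?F g"
    have "f u = g u" if "u \<in> S" for u
    proof (cases "u \<in> orbit s x")
      case True
      then obtain m where "u = (s ^^ m) x" using orb by auto
      then show ?thesis
        using fg equivariant_funpow[OF fg(1) S(2,3)] equivariant_funpow[OF fg(2) S(2,3)] by simp
    next
      case False
      have "restrict f (S - orbit s x) u = restrict g (S - orbit s x) u" using fg(3) by simp
      then show ?thesis using False that by simp
    qed
    then show "f = g"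
      using fg(1,2) by (auto simp: equivariant_def intro: PiE_ext)
  qed
  show "?F ` ?A = ?B \<times> ?C"
  proof (intro equalityI subsetI)
    fix p assume "p \<in> ?F ` ?A"
    then obtain f where f: "f \<in> ?A" "p = ?F f" by auto
    have "(t ^^ k) (f x) = f x"
      using equivariant_funpow[OF f(1) S(2,3), of k] pow_k by simp
    then show "p \<in> ?B \<times> ?C"
      using f S(3) s_out by (auto simp: equivariant_def k_def)
  next
    fix p assume "p \<in> ?B \<times> ?C"
    then obtain g y where p: "p = (g, y)" and g: "g \<in> ?B" and y: "y \<in> Y" "(t ^^ k) y = y"
      by (auto simp: k_def)
    \<comment> \<open>\<open>idx u\<close> is the exponent m < k with u = s^m x.\<close>
    define idx where "idx = inv_into {..<k} (\<lambda>m. (s ^^ m) x)"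
    define f where "f = (\<lambda>u. if u \<in> orbit s x then (t ^^ idx u) y else g u)"
    have in_orb: "(s ^^ m) x \<in> orbit s x" for m by (rule funpow_in_orbit[OF self])
    \<comment> \<open>Valid for all m, not only m < k, as both sides are k-periodic; hence the step
      from the last point of the cycle back to x needs no separate case.\<close>
    have f_orb: "f ((s ^^ m) x) = (t ^^ m) y" for m
    proof -
      have "idx ((s ^^ m) x) = idx ((s ^^ (m mod k)) x)"
        using funpow_mod_eq[OF pow_k] by simp
      also have "\<dots> = m mod k"
        unfolding idx_def by (rule inv_into_f_f[OF inj]) (use k in auto)
      finally show ?thesis
        using in_orb funpow_mod_eq[OF y(2)] by (simp add: f_def)
    qed
    have tY: "(t ^^ m) y \<in> Y" for m
      by (induction m) (use y Y in auto)
    have f_mem: "f \<in> ?A"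
      unfolding equivariant_def
    proof (intro CollectI conjI PiE_I ballI)
      fix u assume u: "u \<in> S"
      show "f u \<in> Y"
        using u g tY by (auto simp: f_def equivariant_def)
      show "f (s u) = t (f u)"
      proof (cases "u \<in> orbit s x")
        case True
        then obtain m where "u = (s ^^ m) x" using orb by auto
        then show ?thesis using f_orb[of m] f_orb[of "Suc m"] by simp
      next
        case False
        then show ?thesis using u s_out[of u] g by (auto simp: f_def equivariant_def)
      qed
    next
      fix u assume "u \<notin> S"
      then show "f u = undefined" using sub g by (auto simp: f_def equivariant_def)
    qed
    have f_eq: "?F f = p"
    proof -
      have "restrict f (S - orbit s x) = g"
        using g by (auto simp: f_def equivariant_def restrict_def PiE_def extensional_def)
      moreover have "f x = y" using f_orb[of 0] by simp
      ultimately show ?thesis by (simp add: p)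
    qed
    show "p \<in> ?F ` ?A" by (rule image_eqI[where f = ?F, OF f_eq[symmetric] f_mem])
  qed
qed

lemma card_equivariant_split:
  assumes "finite S" "bij_betw s S S" "x \<in> S" and "t \<in> Y \<rightarrow> Y"
  shows "card (equivariant S s Y t) =
           card (equivariant (S - orbit s x) s Y t) * card {y \<in> Y. (t ^^ card (orbit s x)) y = y}"
  using bij_betw_same_card[OF bij_betw_equivariant_split[OF assms]]
  by (simp add: card_cartesian_product)

lemma orbit_type_split:
  assumes S: "finite S" "bij_betw s S S" "x \<in> S"
  shows "orbit_type S s = add_mset (card (orbit s x)) (orbit_type (S - orbit s x) s)"
proof -
  have sub: "orbit s x \<subseteq> S" by (rule orbit_subset_carrier[OF S(2,3)])
  have "orbit s u = orbit s x" if "u \<in> orbit s x" for u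
    using orbit_eq_or_disjoint[OF S(1,2), of u x] that sub S(3) self_in_orbit[OF S(1,2), of u] by blast
  then have "orbit s ` S = insert (orbit s x) (orbit s ` (S - orbit s x))"
    using sub S(3) by blast
  moreover have "orbit s x \<notin> orbit s ` (S - orbit s x)"
    using self_in_orbit[OF S(1,2)] by auto
  ultimately show ?thesis
    using S(1) by (simp add: orbit_type_def)
qed

lemma orbit_type_empty [simp]: "orbit_type {} s = {#}"
  by (simp add: orbit_type_def)

text \<open>Used with \<open>twist\<close> for t, once on the nonzero elements (order of the torus)
  and once on the M-th roots of unity (its M-torsion).\<close>

lemma card_equivariant:
  assumes "finite S" "bij_betw s S S" "t \<in> Y \<rightarrow> Y"
  shows "card (equivariant S s Y t) = (\<Prod>k\<in>#orbit_type S s. card {y \<in> Y. (t ^^ k) y = y})"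
  using assms(1,2)
proof (induction S rule: finite_psubset_induct)
  case (psubset S)
  show ?case
  proof (cases "S = {}")
    case True
    then show ?thesis by (simp add: equivariant_def)
  next
    case False
    then obtain x where x: "x \<in> S" by blast
    note S = psubset.hyps psubset.prems x
    have "S - orbit s x \<subset> S" using x self_in_orbit[OF S] by blast
    then show ?thesis
      using psubset.IH[of "S - orbit s x"] bij_betw_Diff_orbit(2)[OF S]
      by (simp add: card_equivariant_split[OF S assms(3)] orbit_type_split[OF S])
  qed
qed

lemma orbit_type_in_partitions:
  assumes "finite S" "bij_betw s S S"
  shows "orbit_type S s \<in> partitions (card S)"
  using assms
proof (induction S rule: finite_psubset_induct)
  case (psubset S)
  show ?case
  proof (cases "S = {}")
    case True
    then show ?thesis by (simp add: partitions_def)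
  next
    case False
    then obtain x where x: "x \<in> S" by blast
    note S = psubset.hyps psubset.prems x
    have self: "x \<in> orbit s x" by (rule self_in_orbit[OF S])
    have sub: "orbit s x \<subseteq> S" by (rule orbit_subset_carrier[OF S(2,3)])
    have "S - orbit s x \<subset> S" using x self by blast
    moreover have "card S = card (orbit s x) + card (S - orbit s x)"
      using card_Diff_subset[OF finite_subset[OF sub S(1)] sub] card_mono[OF S(1) sub] by simp
    ultimately show ?thesis
      using psubset.IH[of "S - orbit s x"] bij_betw_Diff_orbit(2)[OF S] card_orbit_pos[OF self]
      by (auto simp: orbit_type_split[OF S] partitions_def)
  qed
qed

subsection \<open>Orbit types and centralizers of permutations\<close>

definition centralizer_order :: "nat multiset \<Rightarrow> nat" where
  "centralizer_order \<mu> = (\<Prod>i\<in>set_mset \<mu>. fact (count \<mu> i) * i ^ count \<mu> i)"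

text \<open>Only the multiplicity of k changes. The factor is the number of points on k-cycles after
  the part k has been added, which is the number of possible images of a point of such a cycle in
  \<open>card_equivariant_bij\<close>.\<close>

lemma centralizer_order_add:
  "centralizer_order (add_mset k \<mu>) = k * Suc (count \<mu> k) * centralizer_order \<mu>"
proof -
  let ?g = "\<lambda>\<nu> i. fact (count \<nu> i) * i ^ count \<nu> i :: nat"
  let ?T = "insert k (set_mset \<mu>)"
  have "centralizer_order \<mu> = (\<Prod>i\<in>?T. ?g \<mu> i)"
    unfolding centralizer_order_def
    by (rule prod.mono_neutral_left) (auto simp: not_in_iff)
  also have "\<dots> = ?g \<mu> k * (\<Prod>i\<in>?T - {k}. ?g \<mu> i)"
    by (subst prod.remove[of ?T k]) auto
  finally have 1: "centralizer_order \<mu> = ?g \<mu> k * (\<Prod>i\<in>?T - {k}. ?g \<mu> i)" .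
  have "centralizer_order (add_mset k \<mu>) =
      ?g (add_mset k \<mu>) k * (\<Prod>i\<in>?T - {k}. ?g (add_mset k \<mu>) i)"
    unfolding centralizer_order_def by (subst prod.remove[of _ k]) auto
  also have "(\<Prod>i\<in>?T - {k}. ?g (add_mset k \<mu>) i) = (\<Prod>i\<in>?T - {k}. ?g \<mu> i)"
    by (rule prod.cong) auto
  finally show ?thesis using 1 by (simp add: algebra_simps)
qed

lemma prod_inverse_eq_centralizer_order:
  assumes "\<mu> \<in> partitions n"
  shows "(\<Prod>i=1..n. 1 / (fact (count \<mu> i) * real i ^ count \<mu> i)) = 1 / real (centralizer_order \<mu>)"
proof -
  have le: "i \<le> sum_mset \<mu>" if "i \<in># \<mu>" for i
    using multi_member_split[OF that] by auto
  have "set_mset \<mu> \<subseteq> {1..n}"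
    using le assms by (auto simp: partitions_def Suc_le_eq intro: gr0I)
  then have "(\<Prod>i=1..n. fact (count \<mu> i) * real i ^ count \<mu> i) =
      (\<Prod>i\<in>set_mset \<mu>. fact (count \<mu> i) * real i ^ count \<mu> i)"
    by (intro prod.mono_neutral_right) (auto simp: not_in_iff)
  then show ?thesis
    by (simp add: centralizer_order_def prod_dividef)
qed

section \<open>Equivariant bijections: centralizers and conjugators\<close>

definition equivariant_bij :: "'a set \<Rightarrow> ('a \<Rightarrow> 'a) \<Rightarrow> 'b set \<Rightarrow> ('b \<Rightarrow> 'b) \<Rightarrow> ('a \<Rightarrow> 'b) set" where
  "equivariant_bij S s Y t = {f \<in> equivariant S s Y t. bij_betw f S Y}"

lemma equivariant_image_orbit:
  assumes "f \<in> equivariant S s Y t" "bij_betw s S S" "x \<in> S"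
  shows "orbit t (f x) = f ` orbit s x"
proof -
  have "(t ^^ n) (f x) = f ((s ^^ n) x)" for n
    using equivariant_funpow[OF assms] by simp
  then show ?thesis by (auto simp: orbit_altdef)
qed

lemma orbit_type_equivariant_bij:
  assumes "f \<in> equivariant_bij S s Y t" "bij_betw s S S"
  shows "orbit_type S s = orbit_type Y t"
proof -
  have f: "f \<in> equivariant S s Y t" "inj_on f S" "f ` S = Y"
    using assms(1) by (auto simp: equivariant_bij_def bij_betw_def)
  have sub: "orbit s ` S \<subseteq> Pow S"
    using orbit_subset_carrier[OF assms(2)] by auto
  have inj: "inj_on ((`) f) (orbit s ` S)"
    using inj_on_image_Pow[OF f(2)] sub by (rule inj_on_subset)
  have "orbit t ` Y = (`) f ` (orbit s ` S)"
    using equivariant_image_orbit[OF f(1) assms(2)] by (auto simp: image_image f(3)[symmetric])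
  then have "mset_set (orbit t ` Y) = image_mset ((`) f) (mset_set (orbit s ` S))"
    using image_mset_mset_set[OF inj] by simp
  then have "orbit_type Y t = image_mset (\<lambda>C. card (f ` C)) (mset_set (orbit s ` S))"
    by (simp add: orbit_type_def image_mset.compositionality comp_def)
  also have "\<dots> = orbit_type S s"
    unfolding orbit_type_def
  proof (rule image_mset_cong)
    fix C assume "C \<in># mset_set (orbit s ` S)"
    then have "C \<subseteq> S" using sub by (cases "finite (orbit s ` S)") auto
    then show "card (f ` C) = card C"
      using f(2) by (meson card_image inj_on_subset)
  qed
  finally show ?thesis ..
qed

text \<open>The identity is an equivariant bijection between the two actions, which spares a
  comparison of orbits.\<close>

lemma orbit_type_cong:
  assumes "bij_betw s S S" "\<And>x. x \<in> S \<Longrightarrow> t x = s x"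
  shows "orbit_type S t = orbit_type S s"
proof (rule orbit_type_equivariant_bij[symmetric])
  show "restrict id S \<in> equivariant_bij S s S t"
    using assms by (auto simp: equivariant_bij_def equivariant_def bij_betw_def)
qed (rule assms(1))

lemma card_orbits_of_size:
  assumes "finite Y" "bij_betw t Y Y"
  shows "card {y \<in> Y. card (orbit t y) = k} = k * count (orbit_type Y t) k"
proof -
  let ?C = "{C \<in> orbit t ` Y. card C = k}"
  have "orbit t y = orbit t z" if "y \<in> orbit t z" "z \<in> Y" for y z
    using orbit_eq_or_disjoint[OF assms] self_in_orbit[OF assms] orbit_subset_carrier[OF assms(2)] that
    by (metis disjoint_iff subsetD)
  then have eq: "{y \<in> Y. card (orbit t y) = k} = \<Union>?C"
    using self_in_orbit[OF assms] orbit_subset_carrier[OF assms(2)] by fastforce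
  have fin: "finite C" if "C \<in> ?C" for C
    using that orbit_subset_carrier[OF assms(2)] assms(1) by (auto intro: finite_subset)
  have "card (\<Union>?C) = (\<Sum>C\<in>?C. card C)"
  proof (rule card_Union_disjoint[OF _ fin])
    show "disjoint ?C"
      using orbit_eq_or_disjoint[OF assms] by (auto simp: disjoint_def pairwise_def disjnt_def)
  qed
  also have "\<dots> = k * card ?C" by simp
  also have "card ?C = count (orbit_type Y t) k"
  proof -
    have "card -` {k} \<inter> orbit t ` Y = ?C" by auto
    then show ?thesis using assms(1) by (simp add: orbit_type_def count_image_mset)
  qed
  finally show ?thesis using eq by simp
qed

text \<open>Once the image y of x is fixed, f is known on the orbit of x and the rest is an
  equivariant bijection of the complements. The orbits removed on the two sides are unrelated, which
  is why \<open>equivariant_bij\<close> has separate source and target actions even though only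
  centralizers and conjugators in one symmetric group are wanted.\<close>

lemma bij_betw_equivariant_bij_fiber:
  assumes S: "finite S" "bij_betw s S S" "x \<in> S" and Y: "finite Y" "bij_betw t Y Y" "y \<in> Y"
    and card: "card (orbit t y) = card (orbit s x)"
  shows "bij_betw (\<lambda>f. restrict f (S - orbit s x)) {f \<in> equivariant_bij S s Y t. f x = y}
           (equivariant_bij (S - orbit s x) s (Y - orbit t y) t)"
    (is "bij_betw ?R ?A ?B")
proof (rule bij_betw_imageI)
  let ?O = "orbit s x" and ?P = "orbit t y"
  have tY: "t \<in> Y \<rightarrow> Y" using Y(2) by (auto simp: bij_betw_def)
  have split: "bij_betw (\<lambda>f. (restrict f (S - ?O), f x)) (equivariant S s Y t)
           (equivariant (S - ?O) s Y t \<times> {y \<in> Y. (t ^^ card ?O) y = y})"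
    by (rule bij_betw_equivariant_split[OF S tY])
  have subO: "?O \<subseteq> S" and subP: "?P \<subseteq> Y"
    by (rule orbit_subset_carrier[OF S(2,3)], rule orbit_subset_carrier[OF Y(2,3)])
  have img: "f ` ?O = ?P" if "f \<in> equivariant S s Y t" "f x = y" for f
    using equivariant_image_orbit[OF that(1) S(2,3)] that(2) by simp
  show "inj_on ?R ?A"
  proof (rule inj_onI)
    fix f g assume fg: "f \<in> ?A" "g \<in> ?A" "?R f = ?R g"
    show "f = g"
      by (rule inj_onD[OF bij_betw_imp_inj_on[OF split]])
        (use fg in \<open>auto simp: equivariant_bij_def\<close>)
  qed
  show "?R ` ?A = ?B"
  proof (intro equalityI subsetI)
    fix h assume "h \<in> ?R ` ?A"
    then obtain f where f: "f \<in> equivariant S s Y t" "bij_betw f S Y" "f x = y" "h = ?R f"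
      by (auto simp: equivariant_bij_def)
    have "bij_betw f ?O ?P"
      using f(2) subO img[OF f(1,3)] by (auto simp: bij_betw_def intro: inj_on_subset)
    then have "bij_betw f (S - ?O) (Y - ?P)"
      by (rule bij_betw_DiffI[OF f(2)]) (use subO subP in auto)
    then have h: "bij_betw h (S - ?O) (Y - ?P)"
      unfolding f(4) by (subst bij_betw_cong[where g = f]) auto
    have "h \<in> equivariant (S - ?O) s Y t"
      using bij_betwE[OF split] f(1,4) by auto
    then show "h \<in> ?B"
      using h by (auto simp: equivariant_bij_def equivariant_def bij_betw_def PiE_iff)
  next
    fix h assume h: "h \<in> ?B"
    have "h \<in> equivariant (S - ?O) s Y t"
      using h by (auto simp: equivariant_bij_def equivariant_def)
    moreover have "(t ^^ card ?O) y = y"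
      using funpow_card_orbit[OF self_in_orbit[OF Y]] card by simp
    ultimately have "(h, y) \<in> (\<lambda>f. (restrict f (S - ?O), f x)) ` equivariant S s Y t"
      using bij_betw_imp_surj_on[OF split] Y(3) by auto
    then obtain f where f: "f \<in> equivariant S s Y t" "h = ?R f" "y = f x" by auto
    \<comment> \<open>The splitting only yields an equivariant extension f of h. On the orbit it is
      onto ?P, and equal cardinalities make it injective there.\<close>
    have "f ` ?O = ?P" using img f by simp
    then have "bij_betw f ?O ?P"
      using card finite_subset[OF subO S(1)] by (simp add: bij_betw_def eq_card_imp_inj_on)
    moreover have "bij_betw f (S - ?O) (Y - ?P)"
      using h bij_betw_cong[of "S - ?O" h f] f(2) by (auto simp: equivariant_bij_def)
    ultimately have "bij_betw f (?O \<union> (S - ?O)) (?P \<union> (Y - ?P))"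
      by (rule bij_betw_combine) auto
    then have "f \<in> ?A"
      using f subO subP by (simp add: equivariant_bij_def Un_absorb1)
    then show "h \<in> ?R ` ?A" using f(2) by auto
  qed
qed

text \<open>The image of a point x on a k-cycle can be any point on a k-cycle of Y, and each choice
  leaves the same problem with one part k fewer; \<open>centralizer_order_add\<close> is the
  matching recursion.\<close>

lemma card_equivariant_bij:
  assumes "finite S" "bij_betw s S S" "finite Y" "bij_betw t Y Y" "orbit_type S s = orbit_type Y t"
  shows "card (equivariant_bij S s Y t) = centralizer_order (orbit_type S s)"
  using assms
proof (induction S arbitrary: Y rule: finite_psubset_induct)
  case (psubset S)
  show ?case
  proof (cases "S = {}")
    case True
    then have "orbit_type Y t = {#}" using psubset.prems by simp
    then have "Y = {}"
      using psubset.prems(2) by (auto simp: orbit_type_def mset_set_empty_iff)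
    then show ?thesis
      using True by (simp add: equivariant_bij_def equivariant_def centralizer_order_def bij_betw_def)
  next
    case False
    then obtain x where x: "x \<in> S" by blast
    note S = psubset.hyps psubset.prems(1) x
    note Y = psubset.prems(2,3)
    define k \<mu> where "k = card (orbit s x)" and "\<mu> = orbit_type (S - orbit s x) s"
    define B where "B = {y \<in> Y. card (orbit t y) = k}"
    have type: "orbit_type S s = add_mset k \<mu>"
      using orbit_type_split[OF S] by (simp add: k_def \<mu>_def)
    let ?E = "\<lambda>y. {f \<in> equivariant_bij S s Y t. f x = y}"
    have Ey: "card (?E y) = centralizer_order \<mu>" if "y \<in> B" for y
    proof -
      have y: "y \<in> Y" "card (orbit t y) = card (orbit s x)" using that by (auto simp: B_def k_def)
      have "card (?E y) = card (equivariant_bij (S - orbit s x) s (Y - orbit t y) t)"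
        by (rule bij_betw_same_card[OF bij_betw_equivariant_bij_fiber[OF S Y y]])
      also have "\<dots> = centralizer_order \<mu>"
        unfolding \<mu>_def
      proof (rule psubset.IH)
        show "S - orbit s x \<subset> S" using x self_in_orbit[OF S] by blast
        show "orbit_type (S - orbit s x) s = orbit_type (Y - orbit t y) t"
          using orbit_type_split[OF Y y(1)] orbit_type_split[OF S] psubset.prems(4) y(2) by simp
      qed (use bij_betw_Diff_orbit(2)[OF S] bij_betw_Diff_orbit(2)[OF Y y(1)] Y(1) in auto)
      finally show ?thesis .
    qed
    have fin: "finite (equivariant_bij S s Y t)"
    proof (rule finite_subset)
      show "equivariant_bij S s Y t \<subseteq> PiE S (\<lambda>_. Y)" by (auto simp: equivariant_bij_def equivariant_def)
    qed (use S(1) Y(1) in \<open>auto intro: finite_PiE\<close>)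
    have "f x \<in> B" if "f \<in> equivariant_bij S s Y t" for f
    proof -
      have f: "f \<in> equivariant S s Y t" "inj_on f S" "f ` S = Y"
        using that by (auto simp: equivariant_bij_def bij_betw_def)
      have "card (f ` orbit s x) = k"
        unfolding k_def using f(2) orbit_subset_carrier[OF S(2,3)] by (meson card_image inj_on_subset)
      then show ?thesis
        using equivariant_image_orbit[OF f(1) S(2,3)] f(3) x by (auto simp: B_def)
    qed
    then have "equivariant_bij S s Y t = (\<Union>y\<in>B. ?E y)" by auto
    also have "card \<dots> = (\<Sum>y\<in>B. card (?E y))"
      by (rule card_UN_disjoint) (use fin Y(1) in \<open>auto simp: B_def\<close>)
    also have "\<dots> = card B * centralizer_order \<mu>" using Ey by simp
    also have "card B = k * count (orbit_type Y t) k"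
      unfolding B_def by (rule card_orbits_of_size[OF Y])
    also have "orbit_type Y t = add_mset k \<mu>" using psubset.prems(4) type by simp
    finally show ?thesis by (simp add: type centralizer_order_add)
  qed
qed

text \<open>For each part k, a subset A of k points is labelled by residues modulo k and rotated,
  next to a permutation of S - A for the remaining parts.\<close>

lemma ex_permutes_orbit_type:
  assumes "finite S" "\<mu> \<in> partitions (card S)"
  shows "\<exists>s. s permutes S \<and> orbit_type S s = \<mu>"
  using assms
proof (induction \<mu> arbitrary: S)
  case empty
  then show ?case by (auto simp: partitions_def intro: exI[of _ id] permutes_id)
next
  case (add k \<mu>)
  have k: "k > 0" "k \<le> card S" using add.prems by (auto simp: partitions_def)
  obtain A where A: "A \<subseteq> S" "card A = k"
    using obtain_subset_with_card_n[OF k(2)] by auto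
  have finA: "finite A" using A(1) add.prems(1) finite_subset by blast
  have "\<mu> \<in> partitions (card (S - A))"
    using add.prems A finA by (auto simp: partitions_def card_Diff_subset)
  then obtain s where s: "s permutes (S - A)" "orbit_type (S - A) s = \<mu>"
    using add.IH[of "S - A"] add.prems(1) by auto
  obtain h where h: "bij_betw h {..<k} A"
    using A(2) finA by (metis bij_betw_iff_card finite_lessThan card_lessThan)
  define idx where "idx = inv_into {..<k} h"
  define u where "u x = (if x \<in> A then h (Suc (idx x) mod k) else s x)" for x
  have idx: "idx (h m) = m" if "m < k" for m
    using h that by (simp add: idx_def bij_betw_inv_into_left)
  have hA: "h m \<in> A" if "m < k" for m using h that by (auto simp: bij_betw_def)
  have uh: "u (h m) = h (Suc m mod k)" if "m < k" for m
    using that idx hA by (simp add: u_def)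
  have pow: "(u ^^ m) (h 0) = h (m mod k)" for m
    by (induction m) (use k uh in \<open>auto simp: mod_Suc_eq\<close>)
  have "A \<subseteq> orbit u (h 0)"
  proof
    fix a assume "a \<in> A"
    then obtain m where m: "m < k" "a = h m" using h by (auto simp: bij_betw_def)
    \<comment> \<open>Orbits consist of iterates with positive exponent, hence the shift of m by the
      period k.\<close>
    then show "a \<in> orbit u (h 0)"
      using k pow[of "m + k"] by (auto simp: orbit_altdef intro!: exI[of _ "m + k"])
  qed
  moreover have "orbit u (h 0) \<subseteq> A"
    using pow hA k by (auto simp: orbit_altdef)
  ultimately have orb: "orbit u (h 0) = A" by blast
  have "A \<subseteq> u ` A"
  proof
    fix a assume "a \<in> A"
    then obtain m where m: "m < k" "a = h m" using h by (auto simp: bij_betw_def)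
    define l where "l = (if m = 0 then k - 1 else m - 1)"
    have "l < k" "Suc l mod k = m" using m k by (auto simp: l_def)
    then show "a \<in> u ` A" using uh[of l] hA[of l] m by force
  qed
  moreover have "u ` A \<subseteq> A" using hA k by (auto simp: u_def)
  ultimately have uA: "bij_betw u A A"
    using finA by (simp add: bij_betw_def finite_surj_inj)
  have s': "bij_betw s (S - A) (S - A)" by (rule permutes_imp_bij[OF s(1)])
  then have uSA: "bij_betw u (S - A) (S - A)"
    by (subst bij_betw_cong[where g = s]) (auto simp: u_def)
  have "bij_betw u (A \<union> (S - A)) (A \<union> (S - A))"
    by (rule bij_betw_combine[OF uA uSA]) auto
  then have bij: "bij_betw u S S" using A(1) by (simp add: Un_absorb1)
  moreover have "u x = x" if "x \<notin> S" for x
    using that A(1) permutes_not_in[OF s(1)] by (auto simp: u_def)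
  ultimately have "u permutes S" by (rule bij_imp_permutes)
  moreover have "orbit_type S u = add_mset k \<mu>"
  proof -
    have "orbit_type (S - A) u = \<mu>"
      using orbit_type_cong[OF s', of u] s(2) by (simp add: u_def)
    moreover have "h 0 \<in> S" using hA k A(1) by auto
    ultimately show ?thesis
      using orbit_type_split[OF add.prems(1) bij] orb A(2) by metis
  qed
  ultimately show ?case by blast
qed

lemma partitions_eq_image:
  assumes "finite S"
  shows "partitions (card S) = orbit_type S ` {s. s permutes S}"
  using ex_permutes_orbit_type[OF assms] orbit_type_in_partitions[OF assms permutes_imp_bij] by fastforce

text \<open>A permutation is the identity off S, an extensional map is undefined there; restriction
  translates between the two conventions.\<close>

lemma bij_betw_commuting_permutations:
  assumes "s permutes S" "t permutes S"
  shows "bij_betw (\<lambda>g. restrict g S) {g. g permutes S \<and> g \<circ> s = t \<circ> g} (equivariant_bij S s S t)"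
    (is "bij_betw ?R ?A ?B")
proof (rule bij_betw_imageI)
  show "inj_on ?R ?A"
  proof (rule inj_onI)
    fix g h assume gh: "g \<in> ?A" "h \<in> ?A" "restrict g S = restrict h S"
    show "g = h"
    proof
      fix u show "g u = h u"
        using gh by (cases "u \<in> S") (auto simp: permutes_not_in dest: fun_cong[of _ _ u])
    qed
  qed
  show "?R ` ?A = ?B"
  proof (intro equalityI subsetI)
    fix f assume "f \<in> ?R ` ?A"
    then obtain g where g: "g permutes S" "g \<circ> s = t \<circ> g" "f = restrict g S" by auto
    have "bij_betw f S S"
      unfolding g(3) using permutes_imp_bij[OF g(1)] by (subst bij_betw_cong[where g = g]) auto
    moreover have "g (s x) = t (g x)" for x using g(2) by (metis comp_apply)
    ultimately show "f \<in> ?B"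
      using g permutes_in_image[OF g(1)] permutes_in_image[OF assms(1)]
      by (auto simp: equivariant_bij_def equivariant_def)
  next
    fix f assume f: "f \<in> ?B"
    define g where "g x = (if x \<in> S then f x else x)" for x
    have "bij_betw g S S"
      using f by (subst bij_betw_cong[where g = f]) (auto simp: g_def equivariant_bij_def)
    then have "g permutes S" by (rule bij_imp_permutes) (simp add: g_def)
    moreover have "g \<circ> s = t \<circ> g"
    proof
      fix x show "(g \<circ> s) x = (t \<circ> g) x"
        using f permutes_in_image[OF assms(1)] permutes_not_in[OF assms(1)] permutes_not_in[OF assms(2)]
        by (cases "x \<in> S") (auto simp: g_def equivariant_bij_def equivariant_def)
    qed
    moreover have "f = ?R g"
      using f by (auto simp: g_def equivariant_bij_def equivariant_def PiE_def extensional_def fun_eq_iff)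
    ultimately show "f \<in> ?R ` ?A" by auto
  qed
qed

lemma card_commuting_permutations:
  assumes "finite S" "s permutes S" "t permutes S" "orbit_type S s = orbit_type S t"
  shows "card {g. g permutes S \<and> g \<circ> s = t \<circ> g} = centralizer_order (orbit_type S s)"
  using bij_betw_same_card[OF bij_betw_commuting_permutations[OF assms(2,3)]]
    card_equivariant_bij[OF assms(1) permutes_imp_bij[OF assms(2)] assms(1) permutes_imp_bij[OF assms(3)] assms(4)]
  by simp

text \<open>Orbit-stabilizer for conjugation, by counting fibres: g -> g s g^-1 sends the n!
  permutations into the class of s, and the fibre over t consists of the g with g s = t g, whose
  number is the same for all t of the given type.\<close>

lemma card_permutations_orbit_type:
  assumes "finite S" "\<mu> \<in> partitions (card S)"
  shows "card {s. s permutes S \<and> orbit_type S s = \<mu>} * centralizer_order \<mu> = fact (card S)"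
proof -
  obtain s where s: "s permutes S" "orbit_type S s = \<mu>"
    using ex_permutes_orbit_type[OF assms] by blast
  let ?P = "{g. g permutes S}" and ?Q = "{t. t permutes S \<and> orbit_type S t = \<mu>}"
  let ?c = "\<lambda>g. g \<circ> s \<circ> inv_into UNIV g"
  have finP: "finite ?P" by (rule finite_permutations[OF assms(1)])
  have conj: "?c g = t \<longleftrightarrow> g \<circ> s = t \<circ> g" if "g permutes S" for g t
  proof
    assume "?c g = t"
    then have "t \<circ> g = g \<circ> s \<circ> (inv_into UNIV g \<circ> g)" by (auto simp: comp_assoc)
    then show "g \<circ> s = t \<circ> g" using permutes_inv_o(2)[OF that] by simp
  next
    assume "g \<circ> s = t \<circ> g"
    then have "?c g = t \<circ> (g \<circ> inv_into UNIV g)" by (simp add: comp_assoc)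
    then show "?c g = t" using permutes_inv_o(1)[OF that] by simp
  qed
  have "?c ` ?P \<subseteq> ?Q"
  proof
    fix t assume "t \<in> ?c ` ?P"
    then obtain g where g: "g permutes S" "?c g = t" by auto
    have t: "t permutes S"
      unfolding g(2)[symmetric] by (intro permutes_compose permutes_inv g(1) s(1))
    have "g \<circ> s = t \<circ> g" using conj[OF g(1)] g(2) by blast
    then have "restrict g S \<in> equivariant_bij S s S t"
      using bij_betwE[OF bij_betw_commuting_permutations[OF s(1) t]] g(1) by blast
    from orbit_type_equivariant_bij[OF this permutes_imp_bij[OF s(1)]] show "t \<in> ?Q"
      using t s(2) by simp
  qed
  then have "(\<Sum>t\<in>?Q. card {g \<in> ?P. ?c g = t}) = card ?P"
    using sum.group[of ?P ?Q ?c "\<lambda>_. 1::nat"] finP by (simp add: finite_subset[OF _ finP])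
  moreover have "card {g \<in> ?P. ?c g = t} = centralizer_order \<mu>" if "t \<in> ?Q" for t
  proof -
    have "{g \<in> ?P. ?c g = t} = {g. g permutes S \<and> g \<circ> s = t \<circ> g}" using conj by auto
    then show ?thesis using card_commuting_permutations[OF assms(1) s(1), of t] that s(2) by simp
  qed
  ultimately show ?thesis using card_permutations[OF refl assms(1)] by simp
qed

lemma sum_permutations_orbit_type:
  fixes F :: "nat multiset \<Rightarrow> real"
  assumes "finite S"
  shows "(\<Sum>s | s permutes S. F (orbit_type S s)) / fact (card S) =
           (\<Sum>\<mu>\<in>partitions (card S). F \<mu> / real (centralizer_order \<mu>))"
proof -
  let ?P = "{g. g permutes S}" and ?n = "card S"
  have finP: "finite ?P" by (rule finite_permutations[OF assms])
  have "(\<Sum>s\<in>?P. F (orbit_type S s)) =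
      (\<Sum>\<mu>\<in>partitions ?n. \<Sum>s\<in>{s\<in>?P. orbit_type S s = \<mu>}. F (orbit_type S s))"
    by (rule sum.group[symmetric]) (use finP partitions_eq_image[OF assms] in auto)
  also have "\<dots> = (\<Sum>\<mu>\<in>partitions ?n. fact ?n * (F \<mu> / real (centralizer_order \<mu>)))"
  proof (rule sum.cong[OF refl])
    fix \<mu> assume "\<mu> \<in> partitions ?n"
    from card_permutations_orbit_type[OF assms this]
    have card: "real (card {s\<in>?P. orbit_type S s = \<mu>}) * real (centralizer_order \<mu>) = fact ?n"
      by (metis (mono_tags, lifting) mem_Collect_eq Collect_cong of_nat_fact of_nat_mult)
    have nz: "real (centralizer_order \<mu>) \<noteq> 0"
    proof
      assume "real (centralizer_order \<mu>) = 0"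
      with card have "(0::real) = fact ?n" by simp
      then show False by simp
    qed
    from card nz show "(\<Sum>s\<in>{s\<in>?P. orbit_type S s = \<mu>}. F (orbit_type S s)) =
        fact ?n * (F \<mu> / real (centralizer_order \<mu>))"
      by (simp add: field_simps)
  qed
  also have "\<dots> = fact ?n * (\<Sum>\<mu>\<in>partitions ?n. F \<mu> / real (centralizer_order \<mu>))"
    by (simp only: sum_distrib_left)
  finally show ?thesis by simp
qed

lemma card_centralizer_sym_group:
  assumes "s \<in> carrier (sym_group n)"
  shows "card (centralizer (sym_group n) s) = centralizer_order (cycle_type n s)"
proof -
  have "s permutes {1..n}" using assms by (simp add: sym_group_def)
  from card_commuting_permutations[OF _ this this] show ?thesis
    by (simp add: centralizer_def sym_group_def cycle_type_def orbit_type_def)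
qed

subsection \<open>Roots of unity\<close>

lemma degree_monom_minus_1:
  assumes "m > 0"
  shows "Polynomial.degree (Polynomial.monom 1 m - 1 :: 'a::field poly) = m"
proof -
  have "Polynomial.degree (Polynomial.monom 1 m + (- 1) :: 'a poly) = Polynomial.degree (Polynomial.monom (1::'a) m)"
    by (rule degree_add_eq_left) (use assms in \<open>simp add: Polynomial.degree_monom_eq\<close>)
  then show ?thesis by (simp add: Polynomial.degree_monom_eq)
qed

lemma
  fixes m :: nat
  assumes "m > 0"
  shows finite_roots_unity: "finite {y::'a::field. y ^ m = 1}"
    and card_roots_unity_le: "card {y::'a::field. y ^ m = 1} \<le> m"
proof -
  let ?p = "Polynomial.monom 1 m - 1 :: 'a poly"
  have deg: "Polynomial.degree ?p = m" by (rule degree_monom_minus_1[OF assms])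
  then have nz: "?p \<noteq> 0" using assms by (metis Polynomial.degree_0 less_irrefl)
  have eq: "{y. y ^ m = 1} = {y. poly ?p y = 0}" by (auto simp: poly_monom)
  show "finite {y::'a. y ^ m = 1}" unfolding eq by (rule poly_roots_finite[OF nz])
  show "card {y::'a. y ^ m = 1} \<le> m"
    unfolding eq using card_poly_roots_bound[OF nz] deg by simp
qed

text \<open>The polynomial X^m - 1 splits, and a repeated root x would give m x^(m-1) = 0,
  impossible since x^m = 1 and m is nonzero in the field.\<close>

lemma card_roots_unity_alg_closed:
  fixes m :: nat
  assumes "of_nat m \<noteq> (0::'a::alg_closed_field)"
  shows "card {y::'a. y ^ m = 1} = m"
proof -
  let ?p = "Polynomial.monom 1 m - 1 :: 'a poly"
  have m: "m > 0" using assms by (cases m) auto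
  have deg: "Polynomial.degree ?p = m" by (rule degree_monom_minus_1[OF m])
  then have nz: "?p \<noteq> 0" using m by (metis Polynomial.degree_0 less_irrefl)
  have lead: "Polynomial.coeff ?p m = 1" using m by simp
  obtain A where A: "size A = m" "?p = (\<Prod>x\<in>#A. [:-x, 1:])"
    using alg_closed_imp_factorization[OF nz] unfolding deg lead by auto
  have roots: "set_mset A = {y. y ^ m = 1}"
  proof -
    have "y \<in># A \<longleftrightarrow> poly (\<Prod>x\<in>#A. [:-x, 1:]) y = 0" for y
      by (auto simp: poly_prod_mset image_iff prod_mset_zero_iff)
    then show ?thesis unfolding A(2)[symmetric] by (auto simp: poly_monom)
  qed
  have "count A x \<le> 1" for x
  proof (rule ccontr)
    assume "\<not> count A x \<le> 1"
    then have "{#x, x#} \<subseteq># A" by (simp add: subseteq_mset_def)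
    then obtain B where "A = {#x, x#} + B" by (metis mset_subset_eq_exists_conv)
    then have p: "?p = [:-x, 1:] * ([:-x, 1:] * (\<Prod>x\<in>#B. [:-x, 1:]))"
      using A(2) by (simp add: mult.assoc)
    have double: "poly (pderiv (a * (a * b))) x = 0" if "poly a x = 0" for a b :: "'a poly"
      using that by (simp add: pderiv_mult)
    have "poly (pderiv ?p) x = 0"
      unfolding p by (rule double) simp
    then have "of_nat m * x ^ (m - 1) = 0"
      by (simp add: pderiv_diff pderiv_monom poly_monom)
    moreover have "x ^ m = 1"
    proof -
      have "poly ?p x = 0" unfolding p by simp
      then show ?thesis by (simp add: poly_monom)
    qed
    ultimately show False using assms m by (auto simp: power_0_left)
  qed
  then have "count A x = (if x \<in># A then 1 else 0)" for x
    by (metis One_nat_def count_eq_zero_iff le_Suc_eq le_zero_eq)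
  then have "A = mset_set (set_mset A)"
    by (intro multiset_eqI) (simp add: count_mset_set')
  then show ?thesis using A(1) roots by (metis size_mset_set)
qed

lemma coprime_powers_eq_1:
  fixes y :: "'a::field"
  assumes "y ^ a = 1" "y ^ b = 1" "coprime a b"
  shows "y = 1"
proof (cases "a = 0")
  case True
  then show ?thesis using assms by simp
next
  case False
  then obtain u v where "a * u = b * v + 1" using bezout_nat[of a b] assms(3) by auto
  moreover have "y ^ (a * u) = 1" "y ^ (b * v) = 1" using assms by (simp_all add: power_mult)
  ultimately show ?thesis by simp
qed

subsection \<open>The twisted Frobenius map and tori\<close>

text \<open>This is q^k - (-1)^k, split by parity to stay within the natural numbers.\<close>

definition torus_order :: "nat \<Rightarrow> nat \<Rightarrow> nat" where
  "torus_order q k = (if even k then q ^ k - 1 else q ^ k + 1)"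

definition twist :: "nat \<Rightarrow> 'a::field \<Rightarrow> 'a" where
  "twist q x = inverse (x ^ q)"

lemma twist_funpow: "(twist q ^^ k) x = (if even k then x ^ q ^ k else inverse (x ^ q ^ k))"
  by (induction k) (auto simp: twist_def power_inverse simp flip: power_mult, auto simp: mult.commute)

lemma twist_funpow_fixed_iff:
  assumes "x \<noteq> 0" "q > 0"
  shows "(twist q ^^ k) x = x \<longleftrightarrow> x ^ torus_order q k = 1"
proof (cases "even k")
  case True
  have "q ^ k = Suc (q ^ k - 1)" using assms(2) by simp
  then have "x ^ q ^ k = x * x ^ (q ^ k - 1)" by (metis power_Suc)
  then show ?thesis using True assms(1) by (auto simp: twist_funpow torus_order_def)
next
  case False
  have "inverse (x ^ q ^ k) = x \<longleftrightarrow> x * x ^ q ^ k = 1"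
    using assms(1) by (auto simp: field_simps)
  then show ?thesis using False by (simp add: twist_funpow torus_order_def)
qed

text \<open>For odd k the factorization q^(2k) - 1 = (q^k - 1)(q^k + 1) is used. The factors differ
  by 2, so M > 2 cannot divide both, and M divides the second one iff the order d of q divides 2k
  but not k. For odd k and d dividing 2k, failing to divide k is the same as being even.\<close>

lemma dvd_torus_order_iff:
  assumes M: "Factorial_Ring.prime (M::nat)" "M > 2" "coprime M q"
  shows "M dvd torus_order q k \<longleftrightarrow>
    (even k \<and> Pocklington.ord M q dvd k) \<or> (odd k \<and> even (Pocklington.ord M q) \<and> Pocklington.ord M q dvd 2 * k)"
proof -
  define d where "d = Pocklington.ord M q"
  have q: "q > 0" using M by (cases q) auto
  have dvd1: "d dvd l \<longleftrightarrow> M dvd q ^ l - 1" for l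
  proof -
    have "d dvd l \<longleftrightarrow> [q ^ l = 1] (mod M)" unfolding d_def by (rule ord_divides[symmetric])
    also have "\<dots> \<longleftrightarrow> M dvd q ^ l - 1"
      using q by (metis One_nat_def Suc_leI cong_altdef_nat zero_less_power)
    finally show ?thesis .
  qed
  show ?thesis
  proof (cases "even k")
    case True
    then show ?thesis using dvd1[of k] by (simp add: torus_order_def d_def)
  next
    case False
    have fac: "q ^ (2 * k) - 1 = (q ^ k - 1) * (q ^ k + 1)"
    proof -
      obtain a where "q ^ k = Suc a" using q by (metis gr0_conv_Suc zero_less_power)
      then show ?thesis by (simp add: power_mult power2_eq_square mult.commute[of 2 k])
    qed
    have 2: "d dvd 2 * k \<longleftrightarrow> M dvd q ^ k - 1 \<or> M dvd q ^ k + 1"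
      unfolding dvd1 fac by (rule prime_dvd_mult_iff[OF M(1)])
    have notboth: "\<not> (M dvd q ^ k - 1 \<and> M dvd q ^ k + 1)"
    proof
      assume "M dvd q ^ k - 1 \<and> M dvd q ^ k + 1"
      then have "M dvd (q ^ k + 1) - (q ^ k - 1)" using dvd_diff_nat by blast
      moreover have "(q ^ k + 1) - (q ^ k - 1) = 2" using q by (simp add: Suc_diff_le)
      ultimately show False using M(2) by (auto dest: dvd_imp_le)
    qed
    have "M dvd q ^ k + 1 \<longleftrightarrow> even d \<and> d dvd 2 * k"
    proof
      assume h: "M dvd q ^ k + 1"
      then have "\<not> d dvd k" using notboth dvd1 by blast
      then have "even d" using h 2 by (metis coprime_dvd_mult_right_iff coprime_commute coprime_left_2_iff_odd)
      then show "even d \<and> d dvd 2 * k" using h 2 by blast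
    next
      assume "even d \<and> d dvd 2 * k"
      moreover from this False have "\<not> d dvd k" by (meson dvd_trans)
      ultimately show "M dvd q ^ k + 1" using 2 dvd1 by blast
    qed
    then show ?thesis using False by (simp add: torus_order_def d_def)
  qed
qed

lemma prod_mset_pi':
  assumes M: "Factorial_Ring.prime (M::nat)" "M > 2" "coprime M q"
  shows "(\<Prod>k\<in>#\<mu>. if M dvd torus_order q k then M else 1) = M ^ pi' (Pocklington.ord M q) \<mu>"
  unfolding pi'_def dvd_torus_order_iff[OF M, symmetric] by (induction \<mu>) auto

definition torus :: "nat \<Rightarrow> 'i set \<Rightarrow> ('i \<Rightarrow> 'i) \<Rightarrow> ('i \<Rightarrow> 'a::field) set" where
  "torus q S s = equivariant S s (- {0}) (twist q)"

definition torus_powers :: "nat \<Rightarrow> nat \<Rightarrow> 'i set \<Rightarrow> ('i \<Rightarrow> 'i) \<Rightarrow> ('i \<Rightarrow> 'a::field) set" where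
  "torus_powers M q S s = (\<lambda>f. restrict (\<lambda>i. f i ^ M) S) ` torus q S s"

lemma torus_iff:
  "f \<in> torus q S s \<longleftrightarrow>
     f \<in> extensional S \<and> (\<forall>i\<in>S. f i \<noteq> 0 \<and> f (s i) = inverse (f i ^ q))"
  by (auto simp: torus_def equivariant_def PiE_iff twist_def)

text \<open>The linear algebra and polynomial root counts live in a field type. The
  \<open>itself\<close> parameter fixes this type, and q is a positive power of its characteristic
  so that a -> a^q is additive.\<close>

locale frobenius_field =
  fixes q :: nat and K :: "'a::alg_closed_field itself"
  assumes prime_CHAR: "Factorial_Ring.prime CHAR('a)"
    and q_CHAR_power: "\<exists>e>0. q = CHAR('a) ^ e"
begin

lemma q_ge_2: "q \<ge> 2"
proof -
  obtain e where e: "e > 0" "q = CHAR('a) ^ e" using q_CHAR_power by blast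
  have "2 ^ 1 \<le> CHAR('a) ^ 1" using prime_ge_2_nat[OF prime_CHAR] by simp
  also have "\<dots> \<le> CHAR('a) ^ e"
    using e(1) prime_ge_2_nat[OF prime_CHAR] by (intro power_increasing) auto
  finally show ?thesis using e(2) by simp
qed

lemma of_nat_q [simp]: "of_nat q = (0::'a)"
  using q_CHAR_power by auto

lemma frob_add: "(x + y :: 'a) ^ q = x ^ q + y ^ q"
  using q_CHAR_power freshmans_dream'[OF prime_CHAR] by blast

lemma frob_sum: "(sum f A :: 'a) ^ q = (\<Sum>i\<in>A. f i ^ q)"
  using q_CHAR_power freshmans_dream_sum'[OF prime_CHAR] by blast

lemma frob_uminus: "(- x :: 'a) ^ q = - (x ^ q)"
  using frob_add[of x "-x"] q_ge_2 by (simp add: power_0_left eq_neg_iff_add_eq_0 add.commute)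

lemma frob_diff: "(x - y :: 'a) ^ q = x ^ q - y ^ q"
  using frob_add[of x "- y"] by (simp add: frob_uminus)

lemma frob_inj: "(x :: 'a) ^ q = y ^ q \<longleftrightarrow> x = y"
  using frob_diff[of x y] q_ge_2 by auto

lemma twist_Pi: "twist q \<in> - {0 :: 'a} \<rightarrow> - {0}"
  by (auto simp: twist_def)

text \<open>As q vanishes in the field, the torus order becomes -1 or 1 there; so the roots of unity
  of this order are simple and can be counted.\<close>

lemma of_nat_torus_order: "k > 0 \<Longrightarrow> of_nat (torus_order q k) \<noteq> (0::'a)"
  using q_ge_2 by (auto simp: torus_order_def of_nat_diff power_0_left)

lemma torus_order_ge: "k > 0 \<Longrightarrow> torus_order q k \<ge> q ^ k - 1"
  by (auto simp: torus_order_def)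

lemma torus_order_le: "torus_order q k \<le> q ^ k + 1"
  by (auto simp: torus_order_def)

lemma torus_order_pos: "k > 0 \<Longrightarrow> torus_order q k > 0"
  using of_nat_torus_order[of k] by (cases "torus_order q k") auto

lemma twist_fixed_eq: "{y \<in> - {0::'a}. (twist q ^^ k) y = y} = {y. y ^ torus_order q k = 1}" if "k > 0"
proof (rule Set.set_eqI)
  fix y :: 'a
  show "y \<in> {y \<in> - {0}. (twist q ^^ k) y = y} \<longleftrightarrow> y \<in> {y. y ^ torus_order q k = 1}"
    using twist_funpow_fixed_iff[of y q k] q_ge_2 torus_order_pos[OF that]
    by (cases "y = 0") (auto simp: power_0_left)
qed

lemma card_twist_fixed: "k > 0 \<Longrightarrow> card {y \<in> - {0::'a}. (twist q ^^ k) y = y} = torus_order q k"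
  by (simp add: twist_fixed_eq card_roots_unity_alg_closed of_nat_torus_order del: ComplD Compl_iff)

lemma orbit_type_pos:
  assumes "finite S" "bij_betw s S S" "k \<in># orbit_type S s"
  shows "k > 0"
  using orbit_type_in_partitions[OF assms(1,2)] assms(3) by (auto simp: partitions_def intro: gr0I)

lemma card_torus:
  assumes "finite S" "bij_betw s S S"
  shows "card (torus q S s :: ('i \<Rightarrow> 'a) set) = (\<Prod>k\<in>#orbit_type S s. torus_order q k)"
  unfolding torus_def card_equivariant[OF assms twist_Pi]
  by (intro arg_cong[of _ _ prod_mset] image_mset_cong card_twist_fixed orbit_type_pos[OF assms])

lemma card_torus_pos:
  assumes "finite S" "bij_betw s S S"
  shows "card (torus q S s :: ('i \<Rightarrow> 'a) set) > 0"
proof -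
  have "(\<Prod>k\<in>#orbit_type S s. torus_order q k) \<noteq> 0"
  proof
    assume "(\<Prod>k\<in>#orbit_type S s. torus_order q k) = 0"
    then have "0 \<in># image_mset (torus_order q) (orbit_type S s)" by (simp only: prod_mset_zero_iff)
    then show False using torus_order_pos[OF orbit_type_pos[OF assms]] by force
  qed
  then show ?thesis unfolding card_torus[OF assms] by (rule neq0_conv[THEN iffD1])
qed

lemma finite_torus:
  assumes "finite S" "bij_betw s S S"
  shows "finite (torus q S s :: ('i \<Rightarrow> 'a) set)"
  using card_torus_pos[OF assms] by (rule card_ge_0_finite)

section \<open>Torsion and M-th powers in the tori\<close>

lemma card_torus_torsion:
  assumes S: "finite S" "bij_betw s S S" and M: "Factorial_Ring.prime M" "M > 2" "coprime M q"
  shows "card (equivariant S s {y::'a. y ^ M = 1} (twist q)) = M ^ pi' (Pocklington.ord M q) (orbit_type S s)"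
proof -
  have M0: "of_nat M \<noteq> (0::'a)"
  proof
    assume "of_nat M = (0::'a)"
    then have "CHAR('a) dvd M" by (simp add: of_nat_eq_0_iff_char_dvd)
    then have "CHAR('a) = M" using M(1) prime_CHAR by (simp add: primes_dvd_imp_eq)
    then have "M dvd q" using q_CHAR_power by auto
    then show False using M(2,3) by (simp add: coprime_absorb_left)
  qed
  have Pi: "twist q \<in> {y::'a. y ^ M = 1} \<rightarrow> {y. y ^ M = 1}"
  proof
    fix y :: 'a assume "y \<in> {y. y ^ M = 1}"
    then have "(y ^ q) ^ M = 1" by (simp add: power_mult[symmetric] mult.commute[of q]) (simp add: power_mult)
    then show "twist q y \<in> {y. y ^ M = 1}" by (simp add: twist_def power_inverse)
  qed
  \<comment> \<open>Along a cycle of length k the value is a root of unity of order dividing both M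
    and the torus order. Since M is prime, either it divides the torus order and all M roots occur,
    or the two are coprime and only 1 is left.\<close>
  have card_fixed: "card {y \<in> {y::'a. y ^ M = 1}. (twist q ^^ k) y = y} = (if M dvd torus_order q k then M else 1)"
    if k: "k > 0" for k
  proof -
    have nz: "y \<noteq> 0" if "y ^ M = 1" for y :: 'a using that M(2) by (auto simp: power_0_left)
    have eq: "{y \<in> {y::'a. y ^ M = 1}. (twist q ^^ k) y = y} = {y. y ^ M = 1 \<and> y ^ torus_order q k = 1}"
      using twist_funpow_fixed_iff[OF nz] q_ge_2 by auto
    show ?thesis
    proof (cases "M dvd torus_order q k")
      case True
      then have "{y. y ^ M = 1 \<and> y ^ torus_order q k = 1} = {y::'a. y ^ M = 1}"
        by (auto simp: dvd_def power_mult)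
      then show ?thesis unfolding eq using True card_roots_unity_alg_closed[OF M0] by simp
    next
      case False
      then have "coprime M (torus_order q k)" by (rule prime_imp_coprime[OF M(1)])
      then have "{y. y ^ M = 1 \<and> y ^ torus_order q k = 1} = {1::'a}"
        using coprime_powers_eq_1[of _ M "torus_order q k"] by auto
      then show ?thesis unfolding eq using False by simp
    qed
  qed
  have "card (equivariant S s {y::'a. y ^ M = 1} (twist q)) =
      (\<Prod>k\<in>#orbit_type S s. if M dvd torus_order q k then M else 1)"
    unfolding card_equivariant[OF S Pi]
    by (intro arg_cong[of _ _ prod_mset] image_mset_cong card_fixed orbit_type_pos[OF S])
  then show ?thesis by (simp add: prod_mset_pi'[OF M])
qed

lemma torus_mult: "f \<in> torus q S s \<Longrightarrow> g \<in> torus q S s \<Longrightarrow> s ` S \<subseteq> S \<Longrightarrow>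
    restrict (\<lambda>i. f i * g i) S \<in> (torus q S s :: ('i \<Rightarrow> 'a) set)"
  by (auto simp: torus_iff power_mult_distrib image_subset_iff)

lemma torus_divide: "f \<in> torus q S s \<Longrightarrow> g \<in> torus q S s \<Longrightarrow> s ` S \<subseteq> S \<Longrightarrow>
    restrict (\<lambda>i. f i / g i) S \<in> (torus q S s :: ('i \<Rightarrow> 'a) set)"
  by (auto simp: torus_iff power_divide image_subset_iff divide_inverse power_mult_distrib power_inverse)

text \<open>The fibres of the M-th power map are cosets of its kernel, the M-torsion; dividing by a
  fixed element f0 of a fibre identifies that fibre with the kernel.\<close>

lemma card_torus_powers:
  assumes S: "finite S" "bij_betw s S S" and M: "Factorial_Ring.prime M" "M > 2" "coprime M q"
  shows "card (torus q S s :: ('i \<Rightarrow> 'a) set) =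
    card (torus_powers M q S s :: ('i \<Rightarrow> 'a) set) * M ^ pi' (Pocklington.ord M q) (orbit_type S s)"
proof -
  let ?T = "torus q S s :: ('i \<Rightarrow> 'a) set"
  let ?P = "\<lambda>f. restrict (\<lambda>i. f i ^ M) S :: 'i \<Rightarrow> 'a"
  let ?K = "equivariant S s {y::'a. y ^ M = 1} (twist q)"
  have sS: "s ` S \<subseteq> S" using S(2) by (auto simp: bij_betw_def)
  have K: "h \<in> ?K \<longleftrightarrow> h \<in> ?T \<and> (\<forall>i\<in>S. h i ^ M = 1)" for h
    using M(2) by (auto simp: torus_def equivariant_def PiE_iff power_0_left)
  have fiber: "card {f \<in> ?T. ?P f = g} = card ?K" if g: "g \<in> torus_powers M q S s" for g :: "'i \<Rightarrow> 'a"
  proof -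
    obtain f0 where f0: "f0 \<in> ?T" "g = ?P f0" using g by (auto simp: torus_powers_def)
    have nz: "f0 i \<noteq> 0" if "i \<in> S" for i using f0(1) that by (simp add: torus_iff)
    have pw: "?P f = g \<longleftrightarrow> (\<forall>i\<in>S. f i ^ M = f0 i ^ M)" for f
      unfolding f0(2) by (auto simp: fun_eq_iff restrict_def)
    have "bij_betw (\<lambda>f. restrict (\<lambda>i. f i / f0 i) S) {f \<in> ?T. ?P f = g} ?K"
    proof (rule bij_betw_byWitness[where f' = "\<lambda>h. restrict (\<lambda>i. h i * f0 i) S"])
      show "(\<lambda>f. restrict (\<lambda>i. f i / f0 i) S) ` {f \<in> ?T. ?P f = g} \<subseteq> ?K"
        using torus_divide[OF _ f0(1) sS] pw nz by (auto simp: K power_divide)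
      show "(\<lambda>h. restrict (\<lambda>i. h i * f0 i) S) ` ?K \<subseteq> {f \<in> ?T. ?P f = g}"
        using torus_mult[OF _ f0(1) sS] pw nz by (auto simp: K power_mult_distrib)
      show "\<forall>f\<in>{f \<in> ?T. ?P f = g}. restrict (\<lambda>i. restrict (\<lambda>i. f i / f0 i) S i * f0 i) S = f"
        using nz by (auto simp: torus_iff extensional_def fun_eq_iff)
      show "\<forall>h\<in>?K. restrict (\<lambda>i. restrict (\<lambda>i. h i * f0 i) S i / f0 i) S = h"
        using nz by (auto simp: K torus_iff extensional_def fun_eq_iff)
    qed
    then show ?thesis by (rule bij_betw_same_card)
  qed
  have "card ?T = (\<Sum>g\<in>torus_powers M q S s. card {f \<in> ?T. ?P f = g})"
    using sum.group[of ?T "torus_powers M q S s" ?P "\<lambda>_. 1::nat"] finite_torus[OF S]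
    by (simp add: torus_powers_def)
  also have "\<dots> = card (torus_powers M q S s :: ('i \<Rightarrow> 'a) set) * card ?K"
    using fiber by simp
  finally show ?thesis by (simp add: card_torus_torsion[OF S M])
qed

section \<open>Torus points with a repeated coordinate\<close>

lemma torus_order_ratio:
  assumes "k > 0"
  shows "real q * (real q ^ (k - 1) + 1) \<le> 4 * real (torus_order q k)"
proof -
  \<comment> \<open>The constant 4 arises as 2 times 2: q^k + q is at most 2 q^k, and q^k is at most
    2 (q^k - 1) because q is at least 2.\<close>
  have "q ^ 1 \<le> q ^ k" using assms q_ge_2 by (intro power_increasing) auto
  then have "real q \<le> real q ^ k" by (metis of_nat_le_iff of_nat_power power_one_right)
  moreover have "real (q ^ k - 1) \<le> real (torus_order q k)"
    using torus_order_ge[OF assms] of_nat_le_iff by blast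
  moreover have "real (q ^ k - 1) = real q ^ k - 1" using q_ge_2 by (simp add: of_nat_diff)
  moreover have "real q * (real q ^ (k - 1) + 1) = real q ^ k + real q"
    using assms by (simp add: distrib_left flip: power_Suc)
  moreover have "real q \<ge> 2" using q_ge_2 by simp
  ultimately show ?thesis by linarith
qed

text \<open>If j = s^r i lies on the k-cycle of i, with 0 < r < k, then f i = f j forces f i to be
  fixed by the r-th iterate of the twist, leaving at most q^r + 1 values. If j lies on another
  cycle, f i is determined by the rest of f. Both numbers are at most q^(k-1) + 1, to be compared
  with the torus order of about q^k.\<close>

lemma card_torus_coincidence:
  assumes S: "finite S" "bij_betw s S S" "i \<in> S" "j \<in> S" "i \<noteq> j"
  shows "real q * card {f \<in> (torus q S s :: ('i \<Rightarrow> 'a) set). f i = f j} \<le>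
           4 * card (torus q S s :: ('i \<Rightarrow> 'a) set)"
proof -
  let ?O = "orbit s i" and ?T = "torus q S s :: ('i \<Rightarrow> 'a) set"
  define k where "k = card ?O"
  let ?T' = "torus q (S - ?O) s :: ('i \<Rightarrow> 'a) set"
  let ?C = "{y \<in> - {0::'a}. (twist q ^^ k) y = y}"
  let ?W = "{f \<in> ?T. f i = f j}"
  let ?F = "\<lambda>f :: 'i \<Rightarrow> 'a. (restrict f (S - ?O), f i)"
  have self: "i \<in> ?O" by (rule self_in_orbit[OF S(1-3)])
  have k: "k > 0" using card_orbit_pos[OF self] by (simp add: k_def)
  have split: "bij_betw ?F ?T (?T' \<times> ?C)"
    unfolding torus_def k_def by (rule bij_betw_equivariant_split[OF S(1-3) twist_Pi])
  have cardT: "card ?T = card ?T' * torus_order q k"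
    using bij_betw_same_card[OF split] card_twist_fixed[OF k] by (simp add: card_cartesian_product)
  have finT': "finite ?T'"
    by (rule finite_torus) (use S(1) bij_betw_Diff_orbit(2)[OF S(1-3)] in auto)
  have "card ?W \<le> card ?T' * (q ^ (k - 1) + 1)"
  proof (cases "j \<in> ?O")
    case True
    then obtain r where r: "r < k" "j = (s ^^ r) i"
      using orbit_eq_image[OF self] by (auto simp: k_def)
    have r0: "r > 0" using r S(5) by (cases r) auto
    let ?D = "{y::'a. y ^ torus_order q r = 1}"
    have "?F ` ?W \<subseteq> ?T' \<times> ?D"
    proof
      fix p assume "p \<in> ?F ` ?W"
      then obtain f where f: "f \<in> ?T" "f i = f j" "p = ?F f" by auto
      have "(twist q ^^ r) (f i) = f i"
        using equivariant_funpow[OF f(1)[unfolded torus_def] S(2,3), of r] r f(2) by simp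
      moreover have "f i \<noteq> 0" using f(1) S(3) by (simp add: torus_iff)
      ultimately have "f i \<in> ?D" using twist_funpow_fixed_iff[of "f i" q r] q_ge_2 by simp
      then show "p \<in> ?T' \<times> ?D" using bij_betwE[OF split] f by auto
    qed
    then have "card ?W \<le> card (?T' \<times> ?D)"
      using bij_betw_imp_inj_on[OF split] finT' finite_roots_unity[OF torus_order_pos[OF r0]]
      by (intro card_inj_on_le[of ?F]) (auto intro: inj_on_subset)
    also have "\<dots> = card ?T' * card ?D" by (simp add: card_cartesian_product)
    also have "card ?D \<le> torus_order q r" by (rule card_roots_unity_le[OF torus_order_pos[OF r0]])
    also have "\<dots> \<le> q ^ r + 1" by (rule torus_order_le)
    also have "\<dots> \<le> q ^ (k - 1) + 1" using r q_ge_2 by (simp add: power_increasing)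
    finally show ?thesis by simp
  next
    case False
    have "?F ` ?W \<subseteq> (\<lambda>g. (g, g j)) ` ?T'"
    proof
      fix p assume "p \<in> ?F ` ?W"
      then obtain f where f: "f \<in> ?T" "f i = f j" "p = ?F f" by auto
      have "restrict f (S - ?O) \<in> ?T'" using bij_betwE[OF split] f(1) by auto
      moreover have "p = (\<lambda>g. (g, g j)) (restrict f (S - ?O))" using f False S(4) by simp
      ultimately show "p \<in> (\<lambda>g. (g, g j)) ` ?T'" by (rule rev_image_eqI[where f = "\<lambda>g. (g, g j)"])
    qed
    then have "card ?W \<le> card ((\<lambda>g. (g, g j)) ` ?T')"
      using bij_betw_imp_inj_on[OF split] finT'
      by (intro card_inj_on_le[of ?F]) (auto intro: inj_on_subset)
    also have "\<dots> \<le> card ?T'" by (rule card_image_le[OF finT'])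
    also have "\<dots> \<le> card ?T' * (q ^ (k - 1) + 1)" by simp
    finally show ?thesis .
  qed
  then have "real (card ?W) \<le> real (card ?T' * (q ^ (k - 1) + 1))" by (simp only: of_nat_le_iff)
  then have "real q * card ?W \<le> real q * real (card ?T' * (q ^ (k - 1) + 1))"
    by (rule mult_left_mono) simp
  also have "\<dots> = real (card ?T') * (real q * (real q ^ (k - 1) + 1))" by (simp add: algebra_simps)
  also have "\<dots> \<le> real (card ?T') * (4 * real (torus_order q k))"
    by (rule mult_left_mono[OF torus_order_ratio[OF k]]) simp
  finally show ?thesis by (simp add: cardT)
qed

lemma card_torus_not_inj:
  assumes S: "finite S" "bij_betw s S S"
  shows "real q * card {f \<in> (torus q S s :: ('i \<Rightarrow> 'a) set). \<not> inj_on f S} \<le>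
           4 * real (card S) ^ 2 * card (torus q S s :: ('i \<Rightarrow> 'a) set)"
proof -
  let ?T = "torus q S s :: ('i \<Rightarrow> 'a) set"
  let ?D = "{(i, j). i \<in> S \<and> j \<in> S \<and> i \<noteq> j}"
  let ?W = "\<lambda>(i, j). {f \<in> ?T. f i = f j}"
  have D: "?D \<subseteq> S \<times> S" by auto
  have finD: "finite ?D" by (rule finite_subset[OF D]) (use S(1) in simp)
  have cardD: "card ?D \<le> card S ^ 2"
    using card_mono[OF _ D] S(1) by (simp add: card_cartesian_product power2_eq_square)
  have "{f \<in> ?T. \<not> inj_on f S} = (\<Union>p\<in>?D. ?W p)"
    by (auto simp: inj_on_def)
  then have "real (card {f \<in> ?T. \<not> inj_on f S}) \<le> (\<Sum>p\<in>?D. real (card (?W p)))"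
    using card_UN_le[OF finD, of ?W] by (simp flip: of_nat_sum)
  then have "real q * card {f \<in> ?T. \<not> inj_on f S} \<le> (\<Sum>p\<in>?D. real q * real (card (?W p)))"
    unfolding sum_distrib_left[symmetric] by (rule mult_left_mono) simp
  also have "\<dots> \<le> (\<Sum>p\<in>?D. 4 * real (card ?T))"
    by (rule sum_mono) (use card_torus_coincidence[OF S] in auto)
  also have "\<dots> = real (card ?D) * (4 * real (card ?T))" by simp
  also have "\<dots> \<le> real (card S) ^ 2 * (4 * real (card ?T))"
    using cardD by (intro mult_right_mono) (auto simp flip: of_nat_power)
  finally show ?thesis by simp
qed

end

subsection \<open>Conjugate transposes over a field with a Frobenius map\<close>

text \<open>Over the algebraic closure this is not an involution: applied twice it raises all
  entries to the power q^2.\<close>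

definition star :: "nat \<Rightarrow> 'a::field mat \<Rightarrow> 'a mat" where
  "star q A = transpose_mat (map_mat (\<lambda>a. a ^ q) A)"

text \<open>That the entries lie in the field of q^2 elements is a consequence,
  \<open>unitary_star_star\<close>.\<close>

definition unitary_matrices :: "nat \<Rightarrow> nat \<Rightarrow> 'a::field mat set" where
  "unitary_matrices n q = {A \<in> carrier_mat n n. star q A * A = 1\<^sub>m n}"

lemma star_carrier [simp]: "star q A \<in> carrier_mat n m \<longleftrightarrow> A \<in> carrier_mat m n"
  by (simp add: star_def)

lemma star_index: "A \<in> carrier_mat n m \<Longrightarrow> i < m \<Longrightarrow> j < n \<Longrightarrow> star q A $$ (i, j) = (A $$ (j, i)) ^ q"
  by (simp add: star_def)

lemma star_dim [simp]: "dim_row (star q A) = dim_col A" "dim_col (star q A) = dim_row A"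
  by (simp_all add: star_def)

lemma mult_index:
  "A \<in> carrier_mat n m \<Longrightarrow> B \<in> carrier_mat m l \<Longrightarrow> i < n \<Longrightarrow> j < l \<Longrightarrow>
    (A * B) $$ (i, j) = (\<Sum>k<m. A $$ (i, k) * B $$ (k, j))"
  by (auto simp: scalar_prod_def lessThan_atLeast0 intro!: sum.cong)

lemma left_right_inverse_unique:
  assumes "A \<in> carrier_mat n n" "B \<in> carrier_mat n n" "C \<in> carrier_mat n n"
    and "B * A = 1\<^sub>m n" "A * C = (1\<^sub>m n :: 'a::field mat)"
  shows "B = C"
proof -
  have "B = B * (A * C)" using assms by simp
  also have "\<dots> = (B * A) * C" using assms by (subst assoc_mult_mat[of _ n n _ n _ n]) auto
  finally show ?thesis using assms by simp
qed

lemma mat_diag_eq_iff: "mat_diag n f = mat_diag n g \<longleftrightarrow> (\<forall>i<n. f i = g i)"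
proof
  assume eq: "mat_diag n f = mat_diag n g"
  show "\<forall>i<n. f i = g i"
  proof (intro allI impI)
    fix i assume "i < n"
    then show "f i = g i" using arg_cong[OF eq, of "\<lambda>A. A $$ (i, i)"] by (simp add: mat_diag_def)
  qed
qed (auto simp: mat_diag_def intro!: eq_matI)

lemma cancel_mult_mat:
  assumes A: "A \<in> carrier_mat n n" "B \<in> carrier_mat n n" and L: "L \<in> carrier_mat n n" "L' \<in> carrier_mat n n"
    and R: "R \<in> carrier_mat n n" "R' \<in> carrier_mat n n"
    and inv: "L' * L = 1\<^sub>m n" "R * R' = (1\<^sub>m n :: 'a::field mat)" and eq: "L * A * R = L * B * R"
  shows "A = B"
proof -
  have red: "L' * (L * C * R) * R' = C" if C: "C \<in> carrier_mat n n" for C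
  proof -
    have "L' * (L * C * R) * R' = (L' * L) * C * (R * R')"
      using C L R by (simp add: assoc_mult_mat[of _ n n _ n _ n] mult_carrier_mat[of _ n n _ n])
    then show ?thesis using inv C by simp
  qed
  have "A = L' * (L * A * R) * R'" by (rule red[OF A(1), symmetric])
  also note eq
  also have "L' * (L * B * R) * R' = B" by (rule red[OF A(2)])
  finally show ?thesis .
qed

lemma pow_mat_conj_diag:
  assumes "G \<in> carrier_mat n n" "G' \<in> carrier_mat n n" "G * G' = 1\<^sub>m n" "G' * G = (1\<^sub>m n :: 'a::field mat)"
  shows "(G' * mat_diag n f * G) ^\<^sub>m k = G' * mat_diag n (\<lambda>i. f i ^ k) * G"
proof (induction k)
  case 0
  then show ?case using assms by simp
next
  case (Suc k)
  have "(G' * mat_diag n f * G) ^\<^sub>m Suc k = G' * mat_diag n (\<lambda>i. f i ^ k) * G * (G' * mat_diag n f * G)"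
    using Suc by simp
  also have "\<dots> = G' * mat_diag n (\<lambda>i. f i ^ k) * (G * G') * (mat_diag n f * G)"
    using assms(1,2) by (simp add: assoc_mult_mat[of _ n n _ n _ n] mult_carrier_mat[of _ n n _ n])
  also have "\<dots> = G' * (mat_diag n (\<lambda>i. f i ^ k) * mat_diag n f) * G"
    unfolding assms(3) using assms(1,2)
    by (simp add: assoc_mult_mat[of _ n n _ n _ n] mult_carrier_mat[of _ n n _ n] left_mult_one_mat[of _ n n]
      del: mat_diag_diag)
  also have "mat_diag n (\<lambda>i. f i ^ k) * mat_diag n f = mat_diag n (\<lambda>i. f i ^ Suc k)"
    by (simp add: mult.commute)
  finally show ?case .
qed

lemma pow_mat_carrier: "A \<in> carrier_mat n n \<Longrightarrow> A ^\<^sub>m k \<in> carrier_mat n n"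
  by simp

text \<open>Comparing entries (i, j) gives B_ij (t j - t i) = 0.\<close>

lemma commute_diag:
  assumes B: "B \<in> carrier_mat n n" and t: "inj_on t {..<n}"
    and comm: "B * mat_diag n t = mat_diag n t * (B :: 'a::field mat)"
  shows "B = mat_diag n (\<lambda>i. B $$ (i, i))"
proof (rule eq_matI)
  fix i j assume "i < dim_row (mat_diag n (\<lambda>i. B $$ (i, i)))" "j < dim_col (mat_diag n (\<lambda>i. B $$ (i, i)))"
  then have ij: "i < n" "j < n" by (simp_all add: mat_diag_def)
  have "B $$ (i, j) * t j = t i * B $$ (i, j)"
    using arg_cong[OF comm, of "\<lambda>A. A $$ (i, j)"] ij
    by (simp add: mat_diag_mult_left[OF B] mat_diag_mult_right[OF B])
  then have "B $$ (i, j) * (t j - t i) = 0" by (simp add: algebra_simps)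
  then have "i \<noteq> j \<Longrightarrow> B $$ (i, j) = 0" using t ij by (auto simp: inj_on_def)
  then show "B $$ (i, j) = mat_diag n (\<lambda>i. B $$ (i, i)) $$ (i, j)"
    using ij by (simp add: mat_diag_def)
qed (use B in \<open>auto simp: mat_diag_def\<close>)

text \<open>A kernel vector is the coefficient list of a nonzero polynomial of degree below n that
  vanishes at the n distinct points t i.\<close>

lemma vandermonde_invertible:
  assumes "inj_on t {..<n}"
  shows "det (mat n n (\<lambda>(i, j). t i ^ j)) \<noteq> (0::'a::field)"
proof
  let ?V = "mat n n (\<lambda>(i, j). t i ^ j)"
  assume "det ?V = 0"
  then obtain v where v: "v \<in> carrier_vec n" "v \<noteq> 0\<^sub>v n" "?V *\<^sub>v v = 0\<^sub>v n"
    using det_0_iff_vec_prod_zero[of ?V n] by auto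
  define p where "p = (\<Sum>j<n. Polynomial.monom (v $ j) j)"
  have coeff: "Polynomial.coeff p j = (if j < n then v $ j else 0)" for j
    by (simp add: p_def coeff_sum if_distrib cong: if_cong)
  obtain j where j: "j < n" "v $ j \<noteq> 0" using v(1,2) by (auto simp: vec_eq_iff)
  then have p0: "p \<noteq> 0" using coeff[of j] by auto
  have "poly p (t i) = 0" if "i < n" for i
  proof -
    have "(\<Sum>j<n. t i ^ j * v $ j) = (?V *\<^sub>v v) $ i"
      using that v(1) by (auto simp: scalar_prod_def lessThan_atLeast0 intro!: sum.cong)
    then show ?thesis using v(3) that by (simp add: p_def poly_sum poly_monom mult.commute)
  qed
  then have "t ` {..<n} \<subseteq> {x. poly p x = 0}" by auto
  then have "card (t ` {..<n}) \<le> card {x. poly p x = 0}"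
    by (rule card_mono[OF poly_roots_finite[OF p0]])
  also have "\<dots> \<le> Polynomial.degree p" by (rule card_poly_roots_bound[OF p0])
  also have "\<dots> < n"
  proof -
    have "Polynomial.degree p \<le> n - 1"
      by (rule degree_le) (auto simp: coeff)
    then show ?thesis using j(1) by linarith
  qed
  finally show False using card_image[OF assms] by simp
qed

lemma invertible_det:
  assumes "A \<in> carrier_mat n n" "det A \<noteq> (0::'a::field)"
  obtains B where "B \<in> carrier_mat n n" "B * A = 1\<^sub>m n" "A * B = 1\<^sub>m n"
  using det_non_zero_imp_unit[OF assms, of "()"] by (auto simp: Units_def ring_mat_def)

context frobenius_field
begin

lemma star_mult:
  assumes "A \<in> carrier_mat n m" "B \<in> carrier_mat m l"
  shows "star q (A * B :: 'a mat) = star q B * star q A"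
proof (rule eq_matI)
  fix i j assume "i < dim_row (star q B * star q A)" "j < dim_col (star q B * star q A)"
  then have ij: "i < l" "j < n" using assms by auto
  have "star q (A * B) $$ (i, j) = ((A * B) $$ (j, i)) ^ q"
    using ij assms by (intro star_index[of _ n l]) auto
  also have "\<dots> = (\<Sum>k<m. (A $$ (j, k)) ^ q * (B $$ (k, i)) ^ q)"
    using ij by (simp add: mult_index[OF assms] frob_sum power_mult_distrib)
  also have "\<dots> = (\<Sum>k<m. star q B $$ (i, k) * star q A $$ (k, j))"
    using ij star_index[OF assms(1)] star_index[OF assms(2)] by (simp add: mult.commute)
  also have "\<dots> = (star q B * star q A) $$ (i, j)"
    using ij assms by (intro mult_index[symmetric]) auto
  finally show "star q (A * B) $$ (i, j) = (star q B * star q A) $$ (i, j)" .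
qed (use assms in auto)

lemma star_add:
  assumes "A \<in> carrier_mat n m" "B \<in> carrier_mat n m"
  shows "star q (A + B :: 'a mat) = star q A + star q B"
  using assms by (intro eq_matI) (auto simp: star_index[of _ n m] frob_add)

lemma star_diff:
  assumes "A \<in> carrier_mat n m" "B \<in> carrier_mat n m"
  shows "star q (A - B :: 'a mat) = star q A - star q B"
  using assms by (intro eq_matI) (auto simp: star_index[of _ n m] minus_carrier_mat frob_diff)

lemma star_one [simp]: "star q (1\<^sub>m n :: 'a mat) = 1\<^sub>m n"
  using q_ge_2 by (intro eq_matI) (auto simp: star_index[of _ n n])

lemma star_diag: "star q (mat_diag n f :: 'a mat) = mat_diag n (\<lambda>i. f i ^ q)"
  using q_ge_2 by (intro eq_matI) (auto simp: star_def mat_diag_def)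

subsection \<open>Orthonormal bases for Hermitian forms\<close>

text \<open>An element of nonzero trace from the field of q^2 elements to that of q elements; it has
  to exist in characteristic 2 as well, where 1 has trace 0. If all traces vanished, every nonzero y
  would satisfy y^(q-1) = -1, so all q^2 - 1 of them would be roots of unity of order dividing
  2(q-1), which is less than q^2 - 1.\<close>

lemma ex_trace_nonzero: "\<exists>y::'a. y ^ (q * q) = y \<and> y + y ^ q \<noteq> 0"
proof (rule ccontr)
  assume no: "\<not> ?thesis"
  let ?m = "q * q - 1" and ?l = "2 * (q - 1)"
  have qq: "q * q = Suc ?m" using q_ge_2 by (cases q) auto
  have q: "q = Suc (q - 1)" using q_ge_2 by simp
  have "of_nat (Suc ?m) = (0::'a)" using qq of_nat_q by (metis mult_zero_left of_nat_mult)
  then have m0: "of_nat ?m \<noteq> (0::'a)" by (metis add.right_neutral of_nat_Suc zero_neq_one)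
  have "{y::'a. y ^ ?m = 1} \<subseteq> {y. y ^ ?l = 1}"
  proof
    fix y :: 'a assume "y \<in> {y. y ^ ?m = 1}"
    then have y: "y ^ ?m = 1" by simp
    have y0: "y \<noteq> 0" using y m0 by (auto simp: power_0_left split: if_splits)
    have "y ^ (q * q) = y" using y qq by (metis mult.right_neutral power_Suc)
    then have "y + y ^ q = 0" using no by blast
    then have "y * (1 + y ^ (q - 1)) = 0" using q by (metis distrib_left mult.right_neutral power_Suc)
    then have "y ^ (q - 1) = - 1" using y0 by (simp add: eq_neg_iff_add_eq_0 add.commute)
    then show "y \<in> {y. y ^ ?l = 1}" by (simp add: mult.commute[of 2] power_mult)
  qed
  then have "card {y::'a. y ^ ?m = 1} \<le> card {y::'a. y ^ ?l = 1}"
    using q_ge_2 by (intro card_mono finite_roots_unity) auto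
  also have "\<dots> \<le> ?l" using q_ge_2 by (intro card_roots_unity_le) auto
  finally have "?m \<le> ?l" using card_roots_unity_alg_closed[OF m0] by simp
  moreover have "q * q \<ge> 2 * q" using q_ge_2 by simp
  ultimately show False using q_ge_2 by linarith
qed

lemma star_star_index:
  assumes "A \<in> carrier_mat n m" "star q (star q A) = (A :: 'a mat)" "i < n" "j < m"
  shows "(A $$ (i, j)) ^ (q * q) = A $$ (i, j)"
proof -
  have "(A $$ (i, j)) ^ (q * q) = (star q A $$ (j, i)) ^ q"
    using star_index[OF assms(1), of j i] assms(3,4) by (simp add: power_mult)
  also have "\<dots> = star q (star q A) $$ (i, j)"
    using assms by (intro star_index[symmetric, of _ m n]) auto
  finally show ?thesis using assms(2) by simp
qed

lemma star_starI:
  assumes "A \<in> carrier_mat n m" "\<And>i j. i < n \<Longrightarrow> j < m \<Longrightarrow> (A $$ (i, j)) ^ (q * q) = A $$ (i, j)"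
  shows "star q (star q A) = (A :: 'a mat)"
proof (rule eq_matI)
  fix i j assume "i < dim_row A" "j < dim_col A"
  then have ij: "i < n" "j < m" using assms(1) by auto
  have "star q (star q A) $$ (i, j) = (star q A $$ (j, i)) ^ q"
    using ij assms(1) by (intro star_index[of _ m n]) auto
  also have "\<dots> = A $$ (i, j)"
    using star_index[OF assms(1), of j i] ij assms(2)[OF ij] by (simp add: power_mult)
  finally show "star q (star q A) $$ (i, j) = A $$ (i, j)" .
qed auto

definition form :: "nat \<Rightarrow> 'a mat \<Rightarrow> (nat \<Rightarrow> 'a) \<Rightarrow> 'a" where
  "form n H x = (\<Sum>i<n. \<Sum>j<n. x i ^ q * H $$ (i, j) * x j)"

text \<open>A nonzero diagonal entry is the value at a basis vector. Otherwise take c = H_ij nonzero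
  and x = e_i + (y/c) e_j: the two cross terms are y and its conjugate, so the value is the trace of
  y.\<close>

lemma ex_form_nonzero:
  assumes H: "H \<in> carrier_mat n n" "star q H = H" "H \<noteq> 0\<^sub>m n n"
  shows "\<exists>x. (\<forall>i. x i ^ (q * q) = x i) \<and> form n H x \<noteq> 0"
proof -
  have q0: "q > 0" "q * q > 0" using q_ge_2 by auto
  have hermitian: "(H $$ (i, j)) ^ q = H $$ (j, i)" if "i < n" "j < n" for i j
    using star_index[OF H(1), of j i q] that H(2) by simp
  show ?thesis
  proof (cases "\<exists>i<n. H $$ (i, i) \<noteq> 0")
    case True
    then obtain i where i: "i < n" "H $$ (i, i) \<noteq> 0" by auto
    let ?x = "\<lambda>k. if k = i then 1 else 0 :: 'a"
    have "form n H ?x = (\<Sum>k<n. \<Sum>l<n. if l = i then (if k = i then H $$ (i, i) else 0) else 0)"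
      unfolding form_def using q0 by (intro sum.cong refl) (auto simp: power_0_left)
    also have "\<dots> = H $$ (i, i)" using i(1) by simp
    finally show ?thesis using i(2) q0 by (intro exI[of _ ?x]) auto
  next
    case False
    then have diag: "H $$ (i, i) = 0" if "i < n" for i using that by auto
    obtain i j where ij: "i < n" "j < n" "H $$ (i, j) \<noteq> 0"
      using H(1,3) by (metis carrier_matD eq_matI index_zero_mat)
    have neq: "i \<noteq> j" using ij diag by auto
    define c where "c = H $$ (i, j)"
    obtain y :: 'a where y: "y ^ (q * q) = y" "y + y ^ q \<noteq> 0" using ex_trace_nonzero by blast
    have c: "c \<noteq> 0" "c ^ (q * q) = c"
      using ij star_star_index[OF H(1), of i j] H(2) by (simp_all add: c_def)
    define x where "x k = (if k = i then 1 else if k = j then y / c else 0)" for k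
    have "form n H x = (\<Sum>k\<in>{i, j}. \<Sum>l\<in>{i, j}. x k ^ q * H $$ (k, l) * x l)"
    proof -
      have "(\<Sum>l<n. x k ^ q * H $$ (k, l) * x l) = (\<Sum>l\<in>{i, j}. x k ^ q * H $$ (k, l) * x l)" for k
        by (rule sum.mono_neutral_right) (use ij in \<open>auto simp: x_def\<close>)
      moreover have "(\<Sum>k<n. \<Sum>l\<in>{i, j}. x k ^ q * H $$ (k, l) * x l) =
          (\<Sum>k\<in>{i, j}. \<Sum>l\<in>{i, j}. x k ^ q * H $$ (k, l) * x l)"
        by (rule sum.mono_neutral_right) (use ij q0 in \<open>auto simp: x_def power_0_left\<close>)
      ultimately show ?thesis by (simp add: form_def)
    qed
    also have "\<dots> = c * (y / c) + (y / c) ^ q * c ^ q"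
      using neq ij diag hermitian[OF ij(1,2)] by (simp add: x_def c_def)
    also have "\<dots> = y + y ^ q" using c(1) by (simp add: power_divide)
    finally have "form n H x \<noteq> 0" using y(2) by simp
    moreover have "x k ^ (q * q) = x k" for k
      using y(1) c(2) q0 by (simp add: x_def power_divide power_0_left)
    ultimately show ?thesis by blast
  qed
qed

lemma form_frob:
  assumes H: "H \<in> carrier_mat n n" "star q H = H" and x: "\<And>i. x i ^ (q * q) = x i"
  shows "form n H x ^ q = form n H x"
proof -
  have hermitian: "(H $$ (i, j)) ^ q = H $$ (j, i)" if "i < n" "j < n" for i j
    using star_index[OF H(1), of j i q] that H(2) by simp
  have "form n H x ^ q = (\<Sum>i<n. \<Sum>j<n. x i * H $$ (j, i) * x j ^ q)"
    unfolding form_def frob_sum using hermitian x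
    by (intro sum.cong refl) (auto simp: power_mult_distrib simp flip: power_mult)
  also have "\<dots> = (\<Sum>j<n. \<Sum>i<n. x i * H $$ (j, i) * x j ^ q)" by (rule sum.swap)
  also have "\<dots> = form n H x" by (simp add: form_def mult_ac)
  finally show ?thesis .
qed

text \<open>Scaling x by r multiplies the form by r^(q+1). With c the value to be normalized, a
  solution of r^(q+1) = 1/c exists in the closure, and c^q = c forces r^(q^2) = r; this is the
  surjectivity of the norm.\<close>

lemma ex_form_one:
  assumes H: "H \<in> carrier_mat n n" "star q H = H" "H \<noteq> 0\<^sub>m n n"
  shows "\<exists>x. (\<forall>i. x i ^ (q * q) = x i) \<and> form n H x = 1"
proof -
  obtain x where x: "\<And>i. x i ^ (q * q) = x i" "form n H x \<noteq> 0" using ex_form_nonzero[OF H] by blast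
  define c where "c = form n H x"
  have c: "c \<noteq> 0" "c ^ q = c" using x form_frob[OF H(1,2)] by (simp_all add: c_def)
  obtain r where r: "r ^ (q + 1) = inverse c"
    using nth_root_exists[of "q + 1" "inverse c"] by auto
  have r0: "r \<noteq> 0" using r c(1) by (auto simp: power_0_left)
  have "r ^ (q * q) * r ^ q = (r ^ (q + 1)) ^ q"
    by (simp add: power_mult_distrib power_mult mult.commute)
  also have "\<dots> = inverse c" using r c(2) by (simp add: power_inverse)
  also have "\<dots> = r * r ^ q" using r by simp
  finally have rr: "r ^ (q * q) = r" using r0 by simp
  have "form n H (\<lambda>i. r * x i) = r ^ (q + 1) * c"
    unfolding form_def c_def sum_distrib_left
    by (intro sum.cong refl) (simp add: power_mult_distrib mult_ac)
  then have "form n H (\<lambda>i. r * x i) = 1" using r c(1) by simp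
  moreover have "(r * x i) ^ (q * q) = r * x i" for i using rr x(1) by (simp add: power_mult_distrib)
  ultimately have "(\<forall>i. (r * x i) ^ (q * q) = r * x i) \<and> form n H (\<lambda>i. r * x i) = 1" by blast
  then show ?thesis by (rule exI[of _ "\<lambda>i. r * x i"])
qed

text \<open>A matrix over the subfield of \<open>q\<^sup>2\<close> elements is one that equals its double conjugate
  transpose. Partial orthonormal systems are padded with zero columns, so that all matrices are square.\<close>

lemma ex_orthonormal_system:
  assumes H: "H \<in> carrier_mat n n" "star q H = H" and H': "H' \<in> carrier_mat n n" "H' * H = 1\<^sub>m n"
    and "m \<le> n"
  shows "\<exists>W. W \<in> carrier_mat n n \<and> star q (star q W) = W \<and>
    star q W * H * W = mat_diag n (\<lambda>i. if i < m then 1 else 0) \<and>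
    W * mat_diag n (\<lambda>i. if i < m then 1 else 0) = (W :: 'a mat)"
  using \<open>m \<le> n\<close>
proof (induction m)
  case 0
  have "star q (0\<^sub>m n n) = (0\<^sub>m n n :: 'a mat)"
    using q_ge_2 by (intro eq_matI) (auto simp: star_def power_0_left)
  moreover have "mat_diag n (\<lambda>i. if i < 0 then 1 else 0) = (0\<^sub>m n n :: 'a mat)"
    by (intro eq_matI) (auto simp: mat_diag_def)
  ultimately show ?case using H(1) by (intro exI[of _ "0\<^sub>m n n"]) simp
next
  case (Suc m)
  let ?E = "\<lambda>m. mat_diag n (\<lambda>i. if i < m then 1 else 0) :: 'a mat"
  obtain W where W: "W \<in> carrier_mat n n" "star q (star q W) = W" "star q W * H * W = ?E m" "W * ?E m = W"
    using Suc by auto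
  note assoc = assoc_mult_mat[of _ n n _ n _ n] and mc = mult_carrier_mat[of _ n n _ n]
  \<comment> \<open>R is the orthogonal projection onto the span of the columns found so far, Q the
    complementary projection, and N the Gram matrix of the form pulled back along Q.\<close>
  define R where "R = W * (star q W * H)"
  define Q where "Q = 1\<^sub>m n - R"
  define N where "N = H - H * R"
  have R: "R \<in> carrier_mat n n" using W H by (simp add: R_def mc)
  have Q: "Q \<in> carrier_mat n n" and N: "N \<in> carrier_mat n n" using R H by (simp_all add: Q_def N_def mc minus_carrier_mat)
  have sR: "star q R = H * (W * star q W)"
    using W H by (simp add: R_def star_mult[of _ n n _ n] mc assoc)
  have sRH: "star q R * H = H * R"
    unfolding sR unfolding R_def using W(1) H(1) by (simp add: mc assoc)
  have sQ: "star q Q = 1\<^sub>m n - star q R"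
    unfolding Q_def using R by (simp add: star_diff[of _ n n])
  have sN: "star q N = N"
  proof -
    have "star q N = star q H - star q (H * R)"
      unfolding N_def using H R by (intro star_diff[of _ n n]) (auto simp: mc)
    also have "star q (H * R) = H * R"
      using H R sRH by (simp add: star_mult[of _ n n _ n])
    finally show ?thesis using H(2) by (simp add: N_def)
  qed
  have sWHR: "star q W * H * R = star q W * H"
  proof -
    have "star q W * H * R = star q W * H * W * (star q W * H)"
      unfolding R_def using W(1) H(1) by (simp add: mc assoc)
    also have "\<dots> = ?E m * star q W * H" using W(1,3) H(1) by (simp add: mc assoc)
    also have "?E m * star q W = star q W"
    proof -
      have "star q W = star q (W * ?E m)" using W(4) by simp
      also have "\<dots> = star q (?E m) * star q W" by (rule star_mult[of _ n n _ n]) (use W in auto)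
      also have "star q (?E m) = ?E m" using q_ge_2 by (auto simp: star_diag mat_diag_eq_iff power_0_left)
      finally show ?thesis by simp
    qed
    finally show ?thesis .
  qed
  have WHQ: "star q W * H * Q = 0\<^sub>m n n"
    unfolding Q_def using W(1) H(1) R sWHR
    by (subst mult_minus_distrib_mat[of _ n n _ n]) (auto simp: mc)
  have QHW: "star q Q * H * W = 0\<^sub>m n n"
  proof -
    have "star q Q * H * W = star q (star q W * H * Q)"
      using Q W H by (simp add: star_mult[of _ n n _ n] mc assoc)
    also have "\<dots> = 0\<^sub>m n n"
      unfolding WHQ using q_ge_2 by (intro eq_matI) (auto simp: star_def power_0_left)
    finally show ?thesis .
  qed
  have QHQ: "star q Q * H * Q = N"
  proof -
    have HQ: "H * Q = N" unfolding Q_def N_def using H(1) R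
      by (subst mult_minus_distrib_mat[of _ n n _ n]) auto
    have "star q Q * H * Q = star q Q * N" using Q H(1) HQ by (simp add: assoc)
    also have "\<dots> = N - star q R * N"
      unfolding sQ using R N by (subst minus_mult_distrib_mat[of _ n n _ _ n]) auto
    also have "star q R * N = 0\<^sub>m n n"
    proof -
      have "star q R * N = H * (W * (star q W * H * Q))"
        unfolding sR HQ[symmetric] using H(1) W(1) Q by (simp add: mc assoc)
      then show ?thesis unfolding WHQ using H(1) W(1) by simp
    qed
    also have "N - 0\<^sub>m n n = N" using N by (intro eq_matI) auto
    finally show ?thesis .
  qed
  \<comment> \<open>If N were 0, then H R = H and, H being invertible, R = 1. The m nonzero columns
    would then span the whole space, contradicting m < n.\<close>
  have N0: "N \<noteq> 0\<^sub>m n n"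
  proof
    assume "N = 0\<^sub>m n n"
    have HR: "H * R = H"
    proof (rule eq_matI)
      fix i j assume "i < dim_row H" "j < dim_col H"
      then have "i < n" "j < n" using H(1) by auto
      then show "(H * R) $$ (i, j) = H $$ (i, j)"
        using arg_cong[OF \<open>N = 0\<^sub>m n n\<close>, of "\<lambda>A. A $$ (i, j)"] H(1) R by (simp add: N_def)
    qed (use H(1) R in auto)
    have "R = H' * H * R" using H'(2) R by simp
    also have "\<dots> = H' * (H * R)" using H'(1) H(1) R by (simp add: assoc)
    also have "\<dots> = 1\<^sub>m n" using HR H'(2) by simp
    finally have WV: "W * (star q W * H) = 1\<^sub>m n" by (simp add: R_def)
    have VW: "star q W * H * W = 1\<^sub>m n"
      by (rule mat_mult_left_right_inverse[OF _ _ WV]) (use W(1) H(1) in \<open>auto simp: mc\<close>)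
    have "mat_diag n (\<lambda>i. if i < m then 1 else 0) = (mat_diag n (\<lambda>i. 1) :: 'a mat)"
      using W(3) VW by simp
    then show False using Suc.prems unfolding mat_diag_eq_iff by (metis Suc_le_eq less_irrefl zero_neq_one)
  qed
  obtain x where x: "\<And>i. x i ^ (q * q) = x i" "form n N x = 1"
    using ex_form_one[OF N sN N0] by blast
  \<comment> \<open>The new vector is placed in column m, the first one still zero. Multiplying by Q
    makes it orthogonal to the earlier columns, and its length is N evaluated at x, that is
    1.\<close>
  define Y where "Y = mat n n (\<lambda>(i, j). if j = m then x i else 0)"
  have Y: "Y \<in> carrier_mat n n" by (simp add: Y_def)
  have ssY: "star q (star q Y) = Y"
    by (rule star_starI[OF Y]) (use x(1) q_ge_2 in \<open>auto simp: Y_def\<close>)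
  have YNY: "star q Y * N * Y = mat_diag n (\<lambda>i. if i = m then 1 else 0)"
  proof (rule eq_matI)
    fix i j assume "i < dim_row (mat_diag n (\<lambda>i. if i = m then 1 else 0 :: 'a))"
      "j < dim_col (mat_diag n (\<lambda>i. if i = m then 1 else 0 :: 'a))"
    then have ij: "i < n" "j < n" by (simp_all add: mat_diag_def)
    have "(star q Y * N * Y) $$ (i, j) = (\<Sum>l<n. (star q Y * N) $$ (i, l) * Y $$ (l, j))"
      using ij Y N by (intro mult_index[of _ n n _ n]) (auto simp: mc)
    also have "\<dots> = (\<Sum>l<n. (\<Sum>k<n. star q Y $$ (i, k) * N $$ (k, l)) * Y $$ (l, j))"
      using ij Y N by (intro sum.cong refl, subst mult_index[of _ n n _ n]) auto
    also have "\<dots> = (\<Sum>l<n. \<Sum>k<n. (Y $$ (k, i)) ^ q * N $$ (k, l) * Y $$ (l, j))"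
      using ij Y by (simp add: sum_distrib_right star_index[of _ n n])
    also have "\<dots> = (\<Sum>k<n. \<Sum>l<n. (Y $$ (k, i)) ^ q * N $$ (k, l) * Y $$ (l, j))"
      by (rule sum.swap)
    also have "\<dots> = (if i = m \<and> j = m then form n N x else 0)"
      using ij q_ge_2 by (auto simp: Y_def form_def power_0_left)
    finally show "(star q Y * N * Y) $$ (i, j) = mat_diag n (\<lambda>i. if i = m then 1 else 0) $$ (i, j)"
      using ij x(2) by (simp add: mat_diag_def)
  qed (use Y N in \<open>auto simp: mat_diag_def\<close>)
  define W' where "W' = W + Q * Y"
  have QY: "Q * Y \<in> carrier_mat n n" using Q Y by (simp add: mc)
  have W': "W' \<in> carrier_mat n n" using W(1) QY by (simp add: W'_def)
  have sQY: "star q (Q * Y) = star q Y * star q Q" by (rule star_mult[OF Q Y])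
  have ssQ: "star q (star q Q) = Q"
  proof -
    have "star q (star q R) = R"
      unfolding sR using W H by (simp add: star_mult[of _ n n _ n] mc assoc R_def)
    then show ?thesis unfolding sQ using R by (simp add: star_diff[of _ n n] Q_def)
  qed
  have "star q (star q W') = W'"
    unfolding W'_def using W(1,2) QY Q Y ssQ ssY
    by (simp add: star_add[of _ n n] star_mult[of _ n n _ n] mc)
  moreover have "star q W' * H * W' = ?E (Suc m)"
  proof -
    have "star q W' * H * W' = (star q W + star q (Q * Y)) * H * (W + Q * Y)"
      unfolding W'_def using W(1) QY by (simp add: star_add[of _ n n])
    also have "\<dots> = (star q W * H + star q (Q * Y) * H) * (W + Q * Y)"
      using W(1) QY H(1) by (subst add_mult_distrib_mat[of _ n n _ _ n]) auto
    also have "\<dots> = (star q W * H * W + star q (Q * Y) * H * W) + (star q W * H * (Q * Y) + star q (Q * Y) * H * (Q * Y))"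
      using W(1) QY H(1) by (simp add: mult_add_distrib_mat[of _ n n _ n] add_mult_distrib_mat[of _ n n _ _ n] mc)
    also have "star q (Q * Y) * H * W = star q Y * (star q Q * H * W)"
      unfolding sQY using W(1) Q Y H(1) by (simp add: mc assoc)
    also have "\<dots> = 0\<^sub>m n n" unfolding QHW using Y by simp
    also have "star q W * H * (Q * Y) = star q W * H * Q * Y"
      using W(1) Q Y H(1) by (simp add: mc assoc)
    also have "\<dots> = 0\<^sub>m n n" unfolding WHQ using Y by simp
    also have "star q (Q * Y) * H * (Q * Y) = star q Y * (star q Q * H * Q) * Y"
      unfolding sQY using Q Y H(1) by (simp add: mc assoc)
    also have "\<dots> = mat_diag n (\<lambda>i. if i = m then 1 else 0)" unfolding QHQ YNY ..
    also have "(star q W * H * W + 0\<^sub>m n n) + (0\<^sub>m n n + mat_diag n (\<lambda>i. if i = m then 1 else 0)) = ?E (Suc m)"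
      unfolding W(3) by (intro eq_matI) (auto simp: mat_diag_def)
    finally show ?thesis .
  qed
  moreover have "W' * ?E (Suc m) = W'"
  proof (rule eq_matI)
    fix i j assume "i < dim_row W'" "j < dim_col W'"
    then have ij: "i < n" "j < n" using W' by auto
    have "W' $$ (i, j) = 0" if "\<not> j < Suc m"
    proof -
      have "W $$ (i, j) = (W * ?E m) $$ (i, j)" using W(4) by simp
      also have "\<dots> = 0" using that ij by (simp add: mat_diag_mult_right[OF W(1)])
      finally have "W $$ (i, j) = 0" .
      moreover have "(Q * Y) $$ (i, j) = 0"
        unfolding mult_index[OF Q Y ij] by (rule sum.neutral) (use that ij in \<open>auto simp: Y_def\<close>)
      ultimately show ?thesis using ij W(1) QY Q Y by (simp add: W'_def)
    qed
    then show "(W' * ?E (Suc m)) $$ (i, j) = W' $$ (i, j)"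
      using ij by (simp add: mat_diag_mult_right[OF W'])
  qed (use W' in \<open>auto simp: mat_diag_def\<close>)
  ultimately show ?case using W' by blast
qed

lemma ex_orthonormal_basis:
  assumes "H \<in> carrier_mat n n" "star q H = H" "H' \<in> carrier_mat n n" "H' * H = 1\<^sub>m n"
  shows "\<exists>C. C \<in> carrier_mat n n \<and> star q C * H * C = (1\<^sub>m n :: 'a mat)"
proof -
  have "mat_diag n (\<lambda>i. if i < n then 1 else 0) = (mat_diag n (\<lambda>i. 1) :: 'a mat)"
    unfolding mat_diag_eq_iff by simp
  then show ?thesis using ex_orthonormal_system[OF assms order_refl] by (auto intro: exI)
qed

end

context frobenius_field
begin

subsection \<open>Unitary matrices with prescribed distinct eigenvalues\<close>

lemma unitary_carrier: "A \<in> unitary_matrices n q \<Longrightarrow> A \<in> carrier_mat n n"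
  by (simp add: unitary_matrices_def)

lemma unitary_right_inverse:
  assumes "A \<in> unitary_matrices n q"
  shows "A * star q A = (1\<^sub>m n :: 'a mat)"
  using assms mat_mult_left_right_inverse[of "star q A" n A] by (auto simp: unitary_matrices_def)

text \<open>Both A and its double conjugate transpose are inverse to
  \<open>star q A\<close>.\<close>

lemma unitary_star_star:
  assumes "A \<in> unitary_matrices n q"
  shows "star q (star q A) = (A :: 'a mat)"
proof -
  have A: "A \<in> carrier_mat n n" "star q A * A = 1\<^sub>m n" using assms by (auto simp: unitary_matrices_def)
  have "star q A * star q (star q A) = star q (star q A * A)"
    using A(1) by (intro star_mult[of _ n n _ n, symmetric]) auto
  then have "star q A * star q (star q A) = 1\<^sub>m n" using A(2) by simp
  then have "A = star q (star q A)"
    by (rule left_right_inverse_unique[of "star q A" n A, rotated 4]) (use A(1) unitary_right_inverse[OF assms] in auto)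
  then show ?thesis ..
qed

lemma unitary_star:
  assumes "A \<in> unitary_matrices n q"
  shows "star q A \<in> (unitary_matrices n q :: 'a mat set)"
  using assms unitary_star_star[OF assms] unitary_right_inverse[OF assms] by (simp add: unitary_matrices_def)

lemma unitary_mult:
  assumes "A \<in> unitary_matrices n q" "B \<in> unitary_matrices n q"
  shows "A * B \<in> (unitary_matrices n q :: 'a mat set)"
proof -
  have AB: "A \<in> carrier_mat n n" "B \<in> carrier_mat n n" using assms by (auto simp: unitary_matrices_def)
  have "star q (A * B) * (A * B) = star q B * (star q A * A) * B"
    using AB by (simp add: star_mult[of _ n n _ n] assoc_mult_mat[of _ n n _ n _ n] mult_carrier_mat[of _ n n _ n])
  also have "\<dots> = 1\<^sub>m n" using assms AB by (simp add: unitary_matrices_def right_mult_one_mat[of _ n n])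
  finally show ?thesis using AB by (simp add: unitary_matrices_def)
qed

lemma unitary_one: "1\<^sub>m n \<in> (unitary_matrices n q :: 'a mat set)"
  by (simp add: unitary_matrices_def)

text \<open>By \<open>unitary_star_star\<close> every entry satisfies x^(q^2) = x, so finitely many
  values are possible.\<close>

lemma finite_unitary: "finite (unitary_matrices n q :: 'a mat set)"
proof -
  let ?F = "{x::'a. x ^ (q * q) = x}"
  obtain m where m: "q * q = Suc m" "m > 0"
  proof
    have "2 * 2 \<le> q * q" using q_ge_2 by (intro mult_le_mono)
    then show "q * q = Suc (q * q - 1)" "q * q - 1 > 0" by simp_all
  qed
  have "?F \<subseteq> insert 0 {x. x ^ m = 1}" by (auto simp: m(1))
  then have F: "finite ?F" by (rule finite_subset) (use finite_roots_unity[OF m(2)] in simp)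
  let ?h = "\<lambda>A::'a mat. restrict (\<lambda>p. A $$ p) ({..<n} \<times> {..<n})"
  show ?thesis
  proof (rule inj_on_finite)
    show "inj_on ?h (unitary_matrices n q)"
    proof (rule inj_onI)
      fix A B :: "'a mat"
      assume AB: "A \<in> unitary_matrices n q" "B \<in> unitary_matrices n q" and eq: "?h A = ?h B"
      show "A = B"
      proof (rule eq_matI)
        fix i j assume "i < dim_row B" "j < dim_col B"
        then show "A $$ (i, j) = B $$ (i, j)"
          using fun_cong[OF eq, of "(i, j)"] unitary_carrier[OF AB(2)] by simp
      qed (use unitary_carrier[OF AB(1)] unitary_carrier[OF AB(2)] in auto)
    qed
    have "?h A \<in> PiE ({..<n} \<times> {..<n}) (\<lambda>_. ?F)" if "A \<in> unitary_matrices n q" for A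
      using star_star_index[OF unitary_carrier[OF that] unitary_star_star[OF that]] by auto
    then show "?h ` unitary_matrices n q \<subseteq> PiE ({..<n} \<times> {..<n}) (\<lambda>_. ?F)" by blast
    show "finite (PiE ({..<n} \<times> {..<n}) (\<lambda>_. ?F))" using F by (intro finite_PiE) auto
  qed
qed

lemma card_unitary_pos: "card (unitary_matrices n q :: 'a mat set) > 0"
  using finite_unitary unitary_one by (auto simp: card_gt_0_iff)

lemma unitary_pow:
  assumes "A \<in> unitary_matrices n q"
  shows "A ^\<^sub>m k \<in> (unitary_matrices n q :: 'a mat set)"
proof (induction k)
  case 0
  then show ?case using unitary_one[of n] unitary_carrier[OF assms] by simp
next
  case (Suc k)
  then show ?case using unitary_mult assms by simp
qed

context
  fixes n :: nat and s :: "nat \<Rightarrow> nat" and t :: "nat \<Rightarrow> 'a"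
  assumes s: "s permutes {..<n}" and t: "t \<in> torus q {..<n} s" and t_inj: "inj_on t {..<n}"
begin

text \<open>The Gram matrix of the invariant form in the eigenbasis: the eigenvectors for t i and t
  (s i) are paired with each other, as t i ^ q * t (s i) = 1.\<close>

definition "perm_mat = mat n n (\<lambda>(i, j). if j = s i then 1 else 0 :: 'a)"

lemma perm_mat_carrier [simp]: "perm_mat \<in> carrier_mat n n"
  by (simp add: perm_mat_def)

lemma s_less: "i < n \<Longrightarrow> s i < n"
  using permutes_in_image[OF s] by auto

lemma perm_mat_mult:
  assumes "A \<in> carrier_mat n m"
  shows "perm_mat * A = mat n m (\<lambda>(i, j). A $$ (s i, j))"
proof (rule eq_matI)
  fix i j assume "i < dim_row (mat n m (\<lambda>(i, j). A $$ (s i, j)))" "j < dim_col (mat n m (\<lambda>(i, j). A $$ (s i, j)))"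
  then have ij: "i < n" "j < m" by auto
  have "(perm_mat * A) $$ (i, j) = (\<Sum>k<n. (if k = s i then A $$ (k, j) else 0))"
    unfolding mult_index[OF perm_mat_carrier assms ij]
    by (intro sum.cong refl) (use ij in \<open>auto simp: perm_mat_def\<close>)
  then show "(perm_mat * A) $$ (i, j) = mat n m (\<lambda>(i, j). A $$ (s i, j)) $$ (i, j)"
    using ij s_less by simp
qed (use assms in \<open>auto simp: perm_mat_def\<close>)

lemma star_perm_mat_mult: "star q perm_mat * perm_mat = 1\<^sub>m n"
proof -
  have "perm_mat * star q perm_mat = 1\<^sub>m n"
  proof (subst perm_mat_mult[of _ n])
    show "mat n n (\<lambda>(i, j). star q perm_mat $$ (s i, j)) = 1\<^sub>m n"
      using permutes_inj[OF s] s_less q_ge_2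
      by (intro eq_matI) (auto simp: star_index[of _ n n] perm_mat_def inj_eq power_0_left)
  qed simp
  then show ?thesis
    by (rule mat_mult_left_right_inverse[rotated 2]) auto
qed

text \<open>The form with Gram matrix \<^term>\<open>perm_mat\<close> is not Hermitian over the algebraic closure, but in the
  basis given by the columns of the Vandermonde matrix of \<^term>\<open>t\<close> it is, with values in the field of \<open>q\<^sup>2\<close>
  elements.\<close>

lemma ex_twisted_basis:
  "\<exists>G. G \<in> carrier_mat n n \<and> star q G * perm_mat * G = (1\<^sub>m n :: 'a mat)"
proof -
  note assoc = assoc_mult_mat[of _ n n _ n _ n] and mc = mult_carrier_mat[of _ n n _ n]
  define V where "V = mat n n (\<lambda>(i, j). t i ^ j)"
  have V: "V \<in> carrier_mat n n" by (simp add: V_def)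
  obtain V' where V': "V' \<in> carrier_mat n n" "V' * V = 1\<^sub>m n" "V * V' = 1\<^sub>m n"
    using invertible_det[OF V] vandermonde_invertible[OF t_inj] by (auto simp: V_def)
  define H where "H = star q V * perm_mat * V"
  have H: "H \<in> carrier_mat n n" using V by (simp add: H_def mc)
  \<comment> \<open>Taking q^2-th powers of entries permutes the rows of V by s^2, because t (s (s
    i)) = t i ^ (q^2).\<close>
  have ssV: "star q (star q V) = perm_mat * (perm_mat * V)"
  proof (rule eq_matI)
    fix i j assume "i < dim_row (perm_mat * (perm_mat * V))" "j < dim_col (perm_mat * (perm_mat * V))"
    then have ij: "i < n" "j < n" using V by (auto simp: perm_mat_def)
    have "t (s (s i)) = (t i ^ q) ^ q"
      using t ij s_less by (simp add: torus_iff power_inverse)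
    moreover have "star q (star q V) $$ (i, j) = (V $$ (i, j) ^ q) ^ q"
      using ij V star_index[OF V, of j i q] star_index[of "star q V" n n i j q] by simp
    moreover have "(perm_mat * (perm_mat * V)) $$ (i, j) = V $$ (s (s i), j)"
      using ij V s_less by (simp add: perm_mat_mult[of _ n] mc)
    ultimately show "star q (star q V) $$ (i, j) = (perm_mat * (perm_mat * V)) $$ (i, j)"
      using ij s_less by (simp add: V_def power_mult[symmetric] mult_ac)
  qed (use V in \<open>auto simp: perm_mat_def\<close>)
  \<comment> \<open>Conjugating H turns the permutation matrix P into its inverse and V into P P V,
    so one factor P survives.\<close>
  have sH: "star q H = H"
  proof -
    have "star q H = star q V * star q perm_mat * (perm_mat * (perm_mat * V))"
      unfolding H_def using V by (simp add: star_mult[of _ n n _ n] mc assoc ssV)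
    also have "\<dots> = star q V * (star q perm_mat * perm_mat) * (perm_mat * V)"
      using V by (simp add: mc assoc)
    also have "\<dots> = H"
      unfolding star_perm_mat_mult H_def using V by (simp add: mc assoc right_mult_one_mat[of _ n n])
    finally show ?thesis .
  qed
  define H' where "H' = V' * star q perm_mat * star q V'"
  have "star q V' * star q V = 1\<^sub>m n"
    using star_mult[OF V V'(1)] V'(3) by simp
  moreover have "H' * H = V' * star q perm_mat * (star q V' * star q V) * (perm_mat * V)"
    using V V'(1) unfolding H_def H'_def by (simp add: mc assoc)
  ultimately have "H' * H = V' * (star q perm_mat * perm_mat) * V"
    using V V'(1) by (simp add: mc assoc left_mult_one_mat[of _ n n])
  also have "\<dots> = 1\<^sub>m n"
    unfolding star_perm_mat_mult using V' by (simp add: right_mult_one_mat[of _ n n])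
  finally have "H' * H = 1\<^sub>m n" .
  moreover have "H' \<in> carrier_mat n n" using V'(1) by (simp add: H'_def mc)
  ultimately obtain C where C: "C \<in> carrier_mat n n" "star q C * H * C = 1\<^sub>m n"
    using ex_orthonormal_basis[OF H sH] by blast
  have "star q (V * C) * perm_mat * (V * C) = star q C * H * C"
    unfolding H_def using V C(1) by (simp add: star_mult[of _ n n _ n] mc assoc)
  then show ?thesis using C V by (intro exI[of _ "V * C"]) (simp add: mc)
qed

text \<open>This is how the torus T_s enters: it consists of the diagonal isometries of the form
  with Gram matrix \<open>perm_mat\<close>.\<close>

lemma diag_perm_mat_diag:
  "mat_diag n (\<lambda>i. f i ^ q) * perm_mat * mat_diag n f = perm_mat \<longleftrightarrow> (\<forall>i<n. f i ^ q * f (s i) = 1)"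
proof -
  have entry: "(mat_diag n (\<lambda>i. f i ^ q) * perm_mat * mat_diag n f) $$ (i, j) =
      (if j = s i then f i ^ q * f (s i) else 0)" if "i < n" "j < n" for i j
    using that unfolding mat_diag_mult_left[OF perm_mat_carrier]
    by (subst mat_diag_mult_right[of _ n n]) (auto simp: perm_mat_def)
  show ?thesis
  proof
    assume eq: "mat_diag n (\<lambda>i. f i ^ q) * perm_mat * mat_diag n f = perm_mat"
    show "\<forall>i<n. f i ^ q * f (s i) = 1"
    proof (intro allI impI)
      fix i assume i: "i < n"
      then show "f i ^ q * f (s i) = 1"
        using entry[OF i s_less[OF i]] s_less[OF i] unfolding eq by (simp add: perm_mat_def)
    qed
  next
    assume f: "\<forall>i<n. f i ^ q * f (s i) = 1"
    show "mat_diag n (\<lambda>i. f i ^ q) * perm_mat * mat_diag n f = perm_mat"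
    proof (rule eq_matI)
      fix i j assume "i < dim_row perm_mat" "j < dim_col perm_mat"
      then have ij: "i < n" "j < n" by (simp_all add: perm_mat_def)
      show "(mat_diag n (\<lambda>i. f i ^ q) * perm_mat * mat_diag n f) $$ (i, j) = perm_mat $$ (i, j)"
        unfolding entry[OF ij] using ij f by (simp add: perm_mat_def)
    qed (auto simp: perm_mat_def mat_diag_def)
  qed
qed

lemma torus_extensional_iff:
  assumes "f \<in> extensional {..<n}"
  shows "f \<in> torus q {..<n} s \<longleftrightarrow> (\<forall>i<n. f i ^ q * f (s i) = 1)"
proof -
  have "f i \<noteq> 0 \<and> f (s i) = inverse (f i ^ q) \<longleftrightarrow> f i ^ q * f (s i) = 1" for i
    using q_ge_2 by (cases "f i = 0") (auto simp: power_0_left field_simps)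
  then show ?thesis using assms by (auto simp: torus_iff)
qed

text \<open>G is an isometry from the standard form to the twisted one, so f -> G^-1 diag(f) G
  embeds T_s into the unitary group. The image A of t has distinct eigenvalues, hence its unitary
  centralizer is the image of T_s. An M-th root of A commutes with A, thus comes from T_s, where
  M-th powers are taken coordinatewise.\<close>

lemma ex_regular_unitary:
  "\<exists>A\<in>unitary_matrices n q. similar_mat A (mat_diag n t) \<and>
     card {B \<in> unitary_matrices n q. B * A = A * B} \<le> card (torus q {..<n} s :: (nat \<Rightarrow> 'a) set) \<and>
     ((\<exists>B\<in>unitary_matrices n q. B ^\<^sub>m M = A) \<longleftrightarrow> t \<in> torus_powers M q {..<n} s)"
proof -
  note assoc = assoc_mult_mat[of _ n n _ n _ n] and mc = mult_carrier_mat[of _ n n _ n]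
  obtain G where G: "G \<in> carrier_mat n n" "star q G * perm_mat * G = 1\<^sub>m n"
    using ex_twisted_basis by blast
  define G' where "G' = star q G * perm_mat"
  have G': "G' \<in> carrier_mat n n" "G' * G = 1\<^sub>m n" using G by (simp_all add: G'_def mc)
  have GG': "G * G' = 1\<^sub>m n" by (rule mat_mult_left_right_inverse[OF G'(1) G(1) G'(2)])
  define E where "E f = G' * mat_diag n f * G" for f :: "nat \<Rightarrow> 'a"
  have E: "E f \<in> carrier_mat n n" for f using G(1) G'(1) by (simp add: E_def mc)
  \<comment> \<open>Both sides are inverse to \<open>star q G\<close>. Expanding the left side would
    produce \<open>star q (star q G)\<close>, which need not be G, as G is a matrix over the
    closure.\<close>
  have sG': "star q G' = perm_mat * G"
  proof (rule left_right_inverse_unique[symmetric])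
    have "star q G * star q G' = star q (G' * G)" using G(1) G'(1) by (simp add: star_mult[of _ n n _ n])
    then show "star q G * star q G' = 1\<^sub>m n" using G'(2) by simp
    have "star q G * (perm_mat * G) = 1\<^sub>m n" using G by (simp add: assoc)
    then show "perm_mat * G * star q G = 1\<^sub>m n"
      by (rule mat_mult_left_right_inverse[rotated 2]) (use G(1) in \<open>auto simp: mc\<close>)
  qed (use G(1) G'(1) in \<open>auto simp: mc\<close>)
  have EE: "star q (E f) * E f = star q G * (mat_diag n (\<lambda>i. f i ^ q) * perm_mat * mat_diag n f) * G" for f
  proof -
    have "star q (E f) = star q G * mat_diag n (\<lambda>i. f i ^ q) * (perm_mat * G)"
      unfolding E_def using G(1) G'(1) by (simp add: star_mult[of _ n n _ n] mc assoc star_diag sG')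
    then have "star q (E f) * E f =
        star q G * mat_diag n (\<lambda>i. f i ^ q) * perm_mat * (G * G') * (mat_diag n f * G)"
      unfolding E_def using G(1) G'(1) by (simp add: mc assoc)
    also have "\<dots> = star q G * (mat_diag n (\<lambda>i. f i ^ q) * perm_mat * mat_diag n f) * G"
      unfolding GG' using G(1) by (simp add: mc assoc left_mult_one_mat[of _ n n])
    finally show ?thesis .
  qed
  have unit_G: "\<exists>L. L \<in> carrier_mat n n \<and> L * star q G = 1\<^sub>m n"
  proof -
    have "star q G * star q G' = 1\<^sub>m n" using star_mult[OF G'(1) G(1)] G'(2) by simp
    then have "star q G' * star q G = 1\<^sub>m n"
      by (rule mat_mult_left_right_inverse[rotated 2]) (use G(1) G'(1) in auto)
    then show ?thesis using G'(1) by (intro exI[of _ "star q G'"]) simp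
  qed
  have E_unitary: "E f \<in> unitary_matrices n q \<longleftrightarrow> (\<forall>i<n. f i ^ q * f (s i) = 1)" for f
  proof -
    have "star q (E f) * E f = 1\<^sub>m n \<longleftrightarrow> mat_diag n (\<lambda>i. f i ^ q) * perm_mat * mat_diag n f = perm_mat"
    proof
      assume "star q (E f) * E f = 1\<^sub>m n"
      then have eq: "star q G * (mat_diag n (\<lambda>i. f i ^ q) * perm_mat * mat_diag n f) * G = star q G * perm_mat * G"
        unfolding EE using G(2) by simp
      obtain L where L: "L \<in> carrier_mat n n" "L * star q G = 1\<^sub>m n" using unit_G by blast
      show "mat_diag n (\<lambda>i. f i ^ q) * perm_mat * mat_diag n f = perm_mat"
        by (rule cancel_mult_mat[OF _ _ _ L(1) G(1) G'(1) L(2) GG' eq]) (use G(1) in \<open>auto simp: mc\<close>)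
    qed (simp add: EE G(2))
    then show ?thesis using E diag_perm_mat_diag by (simp add: unitary_matrices_def)
  qed
  have E_inj: "E f = E g \<longleftrightarrow> (\<forall>i<n. f i = g i)" for f g
  proof
    assume eq: "E f = E g"
    have "mat_diag n f = mat_diag n g"
      by (rule cancel_mult_mat[OF _ _ G'(1) G(1) G(1) G'(1) GG' GG' eq[unfolded E_def]]) auto
    then show "\<forall>i<n. f i = g i" by (simp add: mat_diag_eq_iff)
  next
    assume "\<forall>i<n. f i = g i"
    then show "E f = E g" unfolding E_def by (metis mat_diag_eq_iff)
  qed
  have E_pow: "E f ^\<^sub>m k = E (\<lambda>i. f i ^ k)" for f k
    unfolding E_def by (rule pow_mat_conj_diag[OF G(1) G'(1) GG' G'(2)])
  have t_prod: "\<forall>i<n. t i ^ q * t (s i) = 1"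
    using t torus_extensional_iff[of t] by (auto simp: torus_iff)
  have comm: "\<exists>f\<in>torus q {..<n} s. B = E f" if B: "B \<in> unitary_matrices n q" "B * E t = E t * B" for B
  proof -
    have Bc: "B \<in> carrier_mat n n" by (rule unitary_carrier[OF B(1)])
    define D where "D = G * B * G'"
    have D: "D \<in> carrier_mat n n" using Bc G(1) G'(1) by (simp add: D_def mc)
    have BD: "B = G' * D * G"
    proof -
      have "G' * D * G = (G' * G) * B * (G' * G)"
        unfolding D_def using Bc G(1) G'(1) by (simp add: mc assoc)
      then show ?thesis using Bc G'(2) by simp
    qed
    have prod: "(G' * A * G) * (G' * C * G) = G' * (A * C) * G"
      if "A \<in> carrier_mat n n" "C \<in> carrier_mat n n" for A C
    proof -
      have "(G' * A * G) * (G' * C * G) = G' * A * (G * G') * C * G"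
        using that G(1) G'(1) by (simp add: mc assoc)
      also have "\<dots> = G' * (A * C) * G"
        unfolding GG' using that G(1) G'(1) by (simp add: mc assoc left_mult_one_mat[of _ n n])
      finally show ?thesis .
    qed
    have "G' * (D * mat_diag n t) * G = G' * (mat_diag n t * D) * G"
      using B(2) prod[OF D mat_diag_dim] prod[OF mat_diag_dim D] by (simp add: E_def BD)
    then have "D * mat_diag n t = mat_diag n t * D"
      by (rule cancel_mult_mat[OF _ _ G'(1) G(1) G(1) G'(1) GG' GG', rotated 2]) (use D in \<open>auto simp: mc\<close>)
    from commute_diag[OF D t_inj this] have D_diag: "D = mat_diag n (\<lambda>i. D $$ (i, i))" .
    define f where "f = restrict (\<lambda>i. D $$ (i, i)) {..<n}"
    have "mat_diag n f = mat_diag n (\<lambda>i. D $$ (i, i))" by (simp add: mat_diag_eq_iff f_def)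
    then have Bf: "B = E f" using BD D_diag by (simp add: E_def)
    have "f \<in> torus q {..<n} s"
      using B(1) torus_extensional_iff[of f] unfolding Bf E_unitary by (simp add: f_def)
    then show ?thesis using Bf by blast
  qed
  show ?thesis
  proof (intro bexI[of _ "E t"] conjI)
    show "E t \<in> unitary_matrices n q" using E_unitary t_prod by blast
    show "similar_mat (E t) (mat_diag n t)"
      using G(1) G' GG' E by (intro similar_matI[of _ _ G' G n]) (auto simp: E_def)
    have bij: "bij_betw s {..<n} {..<n}" by (rule permutes_imp_bij[OF s])
    have "{B \<in> unitary_matrices n q. B * E t = E t * B} \<subseteq> E ` torus q {..<n} s"
      using comm by blast
    then have "card {B \<in> unitary_matrices n q. B * E t = E t * B} \<le> card (E ` torus q {..<n} s)"
      by (intro card_mono finite_imageI finite_torus bij) simp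
    also have "\<dots> \<le> card (torus q {..<n} s :: (nat \<Rightarrow> 'a) set)"
      by (intro card_image_le finite_torus bij) simp
    finally show "card {B \<in> unitary_matrices n q. B * E t = E t * B} \<le> card (torus q {..<n} s :: (nat \<Rightarrow> 'a) set)" .
    show "(\<exists>B\<in>unitary_matrices n q. B ^\<^sub>m M = E t) \<longleftrightarrow> t \<in> torus_powers M q {..<n} s"
    proof
      assume "\<exists>B\<in>unitary_matrices n q. B ^\<^sub>m M = E t"
      then obtain B where B: "B \<in> unitary_matrices n q" "B ^\<^sub>m M = E t" by blast
      \<comment> \<open>A root of E t commutes with E t, so \<open>comm\<close> applies to
        it.\<close>
      have "B * B ^\<^sub>m M = B ^\<^sub>m M * B"
      proof (induction M)
        case 0
        then show ?case using unitary_carrier[OF B(1)] by simp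
      next
        case (Suc k)
        have "B * B ^\<^sub>m Suc k = B * B ^\<^sub>m k * B"
          using unitary_carrier[OF B(1)] pow_mat_carrier[OF unitary_carrier[OF B(1)]] by (simp add: assoc)
        then show ?case using Suc by simp
      qed
      then obtain f where f: "f \<in> torus q {..<n} s" "B = E f"
        using comm[OF B(1)] B(2) by auto
      then have "E (\<lambda>i. f i ^ M) = E t" using B(2) E_pow by simp
      then have "t = restrict (\<lambda>i. f i ^ M) {..<n}"
        using t by (auto simp: E_inj torus_iff extensional_def restrict_def fun_eq_iff)
      then show "t \<in> torus_powers M q {..<n} s" using f(1) by (auto simp: torus_powers_def)
    next
      assume "t \<in> torus_powers M q {..<n} s"
      then obtain f where f: "f \<in> torus q {..<n} s" "t = restrict (\<lambda>i. f i ^ M) {..<n}"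
        by (auto simp: torus_powers_def)
      have "E f \<in> unitary_matrices n q"
        using f(1) torus_extensional_iff[of f] E_unitary by (auto simp: torus_iff)
      moreover have "E f ^\<^sub>m M = E t" unfolding E_pow E_inj by (simp add: f(2))
      ultimately show "\<exists>B\<in>unitary_matrices n q. B ^\<^sub>m M = E t" by blast
    qed
  qed
qed

end

end

subsection \<open>Counting conjugacy classes of unitary matrices with distinct eigenvalues\<close>

lemma similar_mat_diag_eigenvalues:
  fixes t :: "nat \<Rightarrow> 'a::field"
  assumes "similar_mat (mat_diag n t) (mat_diag n u)"
  shows "t ` {..<n} = u ` {..<n}"
proof -
  have roots: "poly (char_poly (mat_diag n v)) x = 0 \<longleftrightarrow> x \<in> v ` {..<n}" for v and x :: 'a
  proof -
    have "upper_triangular (mat_diag n v)" by (auto simp: upper_triangular_def mat_diag_def)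
    then have "char_poly (mat_diag n v) = (\<Prod>a\<leftarrow>diag_mat (mat_diag n v). [:- a, 1:])"
      by (rule char_poly_upper_triangular[OF mat_diag_dim])
    moreover have "diag_mat (mat_diag n v) = map v [0..<n]"
      by (simp add: diag_mat_def mat_diag_def)
    ultimately show ?thesis by (auto simp: poly_prod_list prod_list_zero_iff o_def)
  qed
  show ?thesis
    by (intro Set.set_eqI) (simp only: roots[symmetric] char_poly_similar[OF assms])
qed

context frobenius_field
begin

definition unitary_powers :: "nat \<Rightarrow> nat \<Rightarrow> 'a mat set" where
  "unitary_powers n M = (\<lambda>A. A ^\<^sub>m M) ` unitary_matrices n q"

lemma unitary_powers_subset: "unitary_powers n M \<subseteq> unitary_matrices n q"
  using unitary_pow by (auto simp: unitary_powers_def)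

lemma unitary_conj_pow:
  assumes g: "g \<in> unitary_matrices n q" and B: "B \<in> carrier_mat n n"
  shows "(g * B * star q g) ^\<^sub>m k = g * B ^\<^sub>m k * star q (g :: 'a mat)"
proof (induction k)
  case 0
  have "g * 1\<^sub>m n * star q g = 1\<^sub>m n"
    using unitary_right_inverse[OF g] right_mult_one_mat[OF unitary_carrier[OF g]] by simp
  then show ?case using B unitary_carrier[OF g] by simp
next
  case (Suc k)
  note gc = unitary_carrier[OF g]
  note assoc = assoc_mult_mat[of _ n n _ n _ n] and mc = mult_carrier_mat[of _ n n _ n]
  have Bk: "B ^\<^sub>m k \<in> carrier_mat n n" by (rule pow_mat_carrier[OF B])
  have "(g * B * star q g) ^\<^sub>m Suc k = g * B ^\<^sub>m k * star q g * (g * B * star q g)" using Suc by simp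
  also have "\<dots> = g * B ^\<^sub>m k * (star q g * g) * (B * star q g)"
    using gc B Bk by (simp add: mc assoc)
  also have "star q g * g = 1\<^sub>m n" using g by (simp add: unitary_matrices_def)
  also have "g * B ^\<^sub>m k * 1\<^sub>m n * (B * star q g) = g * B ^\<^sub>m Suc k * star q g"
    using gc B Bk by (simp add: mc assoc left_mult_one_mat[of _ n n])
  finally show ?case .
qed

text \<open>Z is the conjugacy class under U of the matrix A from \<open>ex_regular_unitary\<close>.
  Two elements g, h with the same conjugate of A differ by the element \<open>star q h * g\<close>
  of the centralizer, so the fibres of g -> g A g^-1 have at most |T_s| elements. Being an M-th
  power is invariant under conjugation.\<close>

lemma ex_class:
  assumes s: "s permutes {..<n}" and t: "t \<in> torus q {..<n} s" "inj_on t {..<n}"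
  shows "\<exists>Z. Z \<subseteq> unitary_matrices n q \<and>
    (\<forall>A\<in>Z. similar_mat A (mat_diag n t) \<and> (A \<in> unitary_powers n M \<longleftrightarrow> t \<in> torus_powers M q {..<n} s)) \<and>
    card (unitary_matrices n q :: 'a mat set) \<le> card Z * card (torus q {..<n} s :: (nat \<Rightarrow> 'a) set)"
proof -
  let ?U = "unitary_matrices n q :: 'a mat set"
  note assoc = assoc_mult_mat[of _ n n _ n _ n] and mc = mult_carrier_mat[of _ n n _ n]
  obtain A where A: "A \<in> ?U" "similar_mat A (mat_diag n t)"
    "card {B \<in> ?U. B * A = A * B} \<le> card (torus q {..<n} s :: (nat \<Rightarrow> 'a) set)"
    "(\<exists>B\<in>?U. B ^\<^sub>m M = A) \<longleftrightarrow> t \<in> torus_powers M q {..<n} s"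
    using ex_regular_unitary[OF s t, of M] by blast
  have Ac: "A \<in> carrier_mat n n" by (rule unitary_carrier[OF A(1)])
  define c where "c g = g * A * star q g" for g :: "'a mat"
  have U: "g \<in> carrier_mat n n" "star q g \<in> carrier_mat n n" "star q g * g = 1\<^sub>m n" "g * star q g = 1\<^sub>m n"
    "star q g \<in> ?U" if "g \<in> ?U" for g
    using that unitary_carrier[OF that] unitary_right_inverse[OF that] unitary_star[OF that]
    by (auto simp: unitary_matrices_def)
  have cancel: "star q g * (g * C) = C" "g * (star q g * C) = C" if "g \<in> ?U" "C \<in> carrier_mat n n" for g C
    using U[OF that(1)] that(2) by (simp_all add: assoc[symmetric] left_mult_one_mat[of _ n n])
  have cU: "c g \<in> ?U" if "g \<in> ?U" for g
    unfolding c_def using that A(1) U(5)[OF that] by (intro unitary_mult)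
  show ?thesis
  proof (intro exI[of _ "c ` ?U"] conjI ballI)
    show "c ` ?U \<subseteq> ?U" using cU by blast
    fix B assume "B \<in> c ` ?U"
    then obtain g where g: "g \<in> ?U" "B = c g" by blast
    have "similar_mat B A"
      by (rule similar_matI[of _ _ g "star q g" n])
        (use U[OF g(1)] Ac cU[OF g(1), THEN unitary_carrier] in \<open>auto simp: g(2) c_def\<close>)
    then show "similar_mat B (mat_diag n t)" using A(2) by (rule similar_mat_trans)
    have "B \<in> unitary_powers n M \<longleftrightarrow> (\<exists>D\<in>?U. D ^\<^sub>m M = A)"
    proof
      assume "B \<in> unitary_powers n M"
      then obtain D where D: "D \<in> ?U" "B = D ^\<^sub>m M" by (auto simp: unitary_powers_def)
      have "star q g * D * star q (star q g) \<in> ?U"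
        using U(5)[OF g(1)] D(1) unitary_star_star[OF g(1)] g(1) by (auto intro!: unitary_mult)
      moreover have "(star q g * D * star q (star q g)) ^\<^sub>m M = A"
      proof -
        have "(star q g * D * star q (star q g)) ^\<^sub>m M = star q g * B * g"
          using unitary_conj_pow[OF U(5)[OF g(1)] unitary_carrier[OF D(1)]] unitary_star_star[OF g(1)] D(2) by simp
        also have "\<dots> = A"
          unfolding g(2) c_def using U[OF g(1)] Ac cancel[OF g(1)]
          by (simp add: mc assoc right_mult_one_mat[of _ n n])
        finally show ?thesis .
      qed
      ultimately show "\<exists>D\<in>?U. D ^\<^sub>m M = A" by blast
    next
      assume "\<exists>D\<in>?U. D ^\<^sub>m M = A"
      then obtain D where D: "D \<in> ?U" "D ^\<^sub>m M = A" by blast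
      have "g * D * star q g \<in> ?U" using g(1) D(1) U(5)[OF g(1)] by (intro unitary_mult)
      moreover have "(g * D * star q g) ^\<^sub>m M = B"
        using unitary_conj_pow[OF g(1) unitary_carrier[OF D(1)]] D(2) by (simp add: g(2) c_def)
      ultimately show "B \<in> unitary_powers n M" by (auto simp: unitary_powers_def)
    qed
    then show "B \<in> unitary_powers n M \<longleftrightarrow> t \<in> torus_powers M q {..<n} s" using A(4) by simp
  next
    have fiber: "card {g \<in> ?U. c g = B} \<le> card (torus q {..<n} s :: (nat \<Rightarrow> 'a) set)" if "B \<in> c ` ?U" for B
    proof -
      obtain h where h: "h \<in> ?U" "B = c h" using \<open>B \<in> c ` ?U\<close> by blast
      have "card {g \<in> ?U. c g = B} \<le> card {D \<in> ?U. D * A = A * D}"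
      proof (rule card_inj_on_le[where f = "\<lambda>g. star q h * g"])
        show "inj_on (\<lambda>g. star q h * g) {g \<in> ?U. c g = B}"
        proof (rule inj_onI)
          fix g k assume gk: "g \<in> {g \<in> ?U. c g = B}" "k \<in> {g \<in> ?U. c g = B}" "star q h * g = star q h * k"
          have "g = h * (star q h * g)" using cancel(2)[OF h(1) U(1)] gk(1) by simp
          also have "\<dots> = h * (star q h * k)" using gk(3) by simp
          also have "\<dots> = k" using cancel(2)[OF h(1) U(1)] gk(2) by simp
          finally show "g = k" .
        qed
        show "(\<lambda>g. star q h * g) ` {g \<in> ?U. c g = B} \<subseteq> {D \<in> ?U. D * A = A * D}"
        proof
          fix D assume "D \<in> (\<lambda>g. star q h * g) ` {g \<in> ?U. c g = B}"
          then obtain g where g: "g \<in> ?U" "c g = c h" "D = star q h * g" using h(2) by auto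
          have "star q h * (c g * g) = star q h * (c h * g)" using g(2) by simp
          moreover have "star q h * (c g * g) = D * A"
            unfolding g(3) c_def using U[OF g(1)] U[OF h(1)] Ac
            by (simp add: mc assoc right_mult_one_mat[of _ n n])
          moreover have "star q h * (c h * g) = A * D"
            unfolding g(3) c_def using U[OF g(1)] U[OF h(1)] Ac cancel[OF h(1)]
            by (simp add: mc assoc)
          ultimately show "D \<in> {D \<in> ?U. D * A = A * D}"
            using unitary_mult[OF U(5)[OF h(1)] g(1)] g(3) by simp
        qed
        show "finite {D \<in> ?U. D * A = A * D}" using finite_unitary by simp
      qed
      then show ?thesis using A(3) by linarith
    qed
    have "card ?U = (\<Sum>B\<in>c ` ?U. card {g \<in> ?U. c g = B})"
      using sum.group[of ?U "c ` ?U" c "\<lambda>_. 1::nat"] finite_unitary by simp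
    also have "\<dots> \<le> (\<Sum>B\<in>c ` ?U. card (torus q {..<n} s :: (nat \<Rightarrow> 'a) set))"
      by (rule sum_mono[OF fiber])
    also have "\<dots> = card (c ` ?U) * card (torus q {..<n} s :: (nat \<Rightarrow> 'a) set)" by simp
    finally show "card ?U \<le> card (c ` ?U) * card (torus q {..<n} s :: (nat \<Rightarrow> 'a) set)" .
  qed
qed

text \<open>The tuple \<open>t\<close> is an ordering of the eigenvalues of \<open>A\<close>, and it determines \<open>s\<close>.\<close>

lemma card_ordered_eigenvalues:
  "finite {(s, t). s permutes {..<n} \<and> t \<in> torus q {..<n} s \<and> inj_on t {..<n} \<and> similar_mat A (mat_diag n (t :: nat \<Rightarrow> 'a))} \<and>
   card {(s, t). s permutes {..<n} \<and> t \<in> torus q {..<n} s \<and> inj_on t {..<n} \<and> similar_mat A (mat_diag n (t :: nat \<Rightarrow> 'a))}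
     \<le> fact n" (is "finite ?P \<and> card ?P \<le> _")
proof (cases "?P = {}")
  case True
  show ?thesis unfolding True by simp
next
  case False
  then obtain s0 t0 where st0: "s0 permutes {..<n}" "t0 \<in> torus q {..<n} s0" "inj_on t0 {..<n}"
    "similar_mat A (mat_diag n (t0 :: nat \<Rightarrow> 'a))" by auto
  let ?Q = "{p. p permutes {..<n}}"
  \<comment> \<open>F expresses t as a rearrangement of the fixed ordering t0 and extends this by
    the identity to a permutation.\<close>
  define F where "F = (\<lambda>(s :: nat \<Rightarrow> nat, t). \<lambda>i. if i < n then inv_into {..<n} t0 (t i) else i)"
  have img: "t ` {..<n} = t0 ` {..<n}" if "(s, t) \<in> ?P" for s t
  proof (rule similar_mat_diag_eigenvalues)
    show "similar_mat (mat_diag n t) (mat_diag n t0)"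
      using that st0(4) by (auto intro: similar_mat_trans similar_mat_sym)
  qed
  have F: "t0 (F (s, t) i) = t i" if "(s, t) \<in> ?P" "i < n" for s t i
  proof -
    have "t i \<in> t0 ` {..<n}" using img[OF that(1)] that(2) by blast
    then show ?thesis using that(2) by (simp add: F_def f_inv_into_f)
  qed
  have "inj_on F ?P"
  proof (rule inj_onI)
    fix p p' assume pp': "p \<in> ?P" "p' \<in> ?P" "F p = F p'"
    obtain s t s' t' where st: "p = (s, t)" "p' = (s', t')" by (cases p, cases p') auto
    note P = pp'(1)[unfolded st(1)] and P' = pp'(2)[unfolded st(2)]
    have tt: "t i = t' i" if "i < n" for i
      using F[OF P that] F[OF P' that] pp'(3) st by simp
    have t_eq: "t = t'"
    proof
      fix i show "t i = t' i"
        using tt P P' by (cases "i < n") (auto simp: torus_iff extensional_def)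
    qed
    have "s = s'"
    proof
      fix i
      show "s i = s' i"
      proof (cases "i < n")
        case True
        then have "t (s i) = t (s' i)" using P P' t_eq by (auto simp: torus_iff)
        moreover have "s i < n" "s' i < n"
          using P P' True permutes_in_image[of s "{..<n}" i] permutes_in_image[of s' "{..<n}" i] by auto
        ultimately show ?thesis using P by (auto simp: inj_on_def)
      next
        case False
        then show ?thesis using P P' permutes_not_in[of s "{..<n}" i] permutes_not_in[of s' "{..<n}" i] by auto
      qed
    qed
    then show "p = p'" using st t_eq by simp
  qed
  moreover have "F ` ?P \<subseteq> ?Q"
  proof
    fix f assume "f \<in> F ` ?P"
    then obtain s t where P: "(s, t) \<in> ?P" "f = F (s, t)" by auto
    have "bij_betw t {..<n} (t0 ` {..<n})" using P(1) img[OF P(1)] by (auto simp: bij_betw_def)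
    moreover have "bij_betw (inv_into {..<n} t0) (t0 ` {..<n}) {..<n}"
      using st0(3) by (simp add: bij_betw_imageI bij_betw_inv_into)
    ultimately have "bij_betw (inv_into {..<n} t0 \<circ> t) {..<n} {..<n}" by (rule bij_betw_trans)
    then have "bij_betw f {..<n} {..<n}"
      by (subst bij_betw_cong[where g = "inv_into {..<n} t0 \<circ> t"]) (auto simp: P(2) F_def)
    then have "f permutes {..<n}" by (rule bij_imp_permutes) (simp add: P(2) F_def)
    then show "f \<in> ?Q" by simp
  qed
  moreover have "finite ?Q" by (rule finite_permutations) simp
  moreover have "card ?Q = fact n" using card_permutations[of "{..<n}" n] by simp
  ultimately show ?thesis using card_inj_on_le[of F ?P ?Q] inj_on_finite[of F ?P ?Q] by simp
qed

text \<open>Double counting of pairs ((s, t), A) with A in the class chosen for (s, t): each pair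
  (s, t) has at least |U|/|T_s| such A, and each A occurs for at most n! pairs. The sets R and Y
  stay general because the lemma is used for the powers and for their complement.\<close>

lemma sum_class_weights_le:
  fixes R :: "(nat \<Rightarrow> nat) \<Rightarrow> (nat \<Rightarrow> 'a) set"
  assumes R: "\<And>s. s permutes {..<n} \<Longrightarrow> R s \<subseteq> {t \<in> torus q {..<n} s. inj_on t {..<n}}"
    and Y: "Y \<subseteq> unitary_matrices n q"
    and Z: "\<And>s t. s permutes {..<n} \<Longrightarrow> t \<in> R s \<Longrightarrow> \<exists>Z. Z \<subseteq> Y \<and> (\<forall>A\<in>Z. similar_mat A (mat_diag n t)) \<and>
      card (unitary_matrices n q :: 'a mat set) \<le> card Z * card (torus q {..<n} s :: (nat \<Rightarrow> 'a) set)"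
  shows "(\<Sum>s | s permutes {..<n}. real (card (R s)) / real (card (torus q {..<n} s :: (nat \<Rightarrow> 'a) set))) *
    real (card (unitary_matrices n q :: 'a mat set)) \<le> fact n * real (card Y)"
proof -
  let ?U = "unitary_matrices n q :: 'a mat set"
  let ?T = "\<lambda>s. torus q {..<n} s :: (nat \<Rightarrow> 'a) set"
  let ?Q = "{s. s permutes {..<n}}"
  define P where "P = Sigma ?Q R"
  have finQ: "finite ?Q" by (rule finite_permutations) simp
  have finT: "finite (?T s)" "card (?T s) > 0" if "s \<in> ?Q" for s
    using that finite_torus[of "{..<n}" s] card_torus_pos[of "{..<n}" s] permutes_imp_bij by auto
  have finR: "finite (R s)" if "s \<in> ?Q" for s
    using finite_subset[of "R s" "?T s"] R[of s] finT(1)[OF that] that by auto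
  have finP: "finite P" using finQ finR by (auto simp: P_def)
  have finY: "finite Y" by (rule finite_subset[OF Y finite_unitary])
  have "\<forall>p\<in>P. \<exists>Z. Z \<subseteq> Y \<and> (\<forall>A\<in>Z. similar_mat A (mat_diag n (snd p))) \<and> card ?U \<le> card Z * card (?T (fst p))"
    using Z by (auto simp: P_def)
  then obtain C where C: "\<And>p. p \<in> P \<Longrightarrow> C p \<subseteq> Y" "\<And>p A. p \<in> P \<Longrightarrow> A \<in> C p \<Longrightarrow> similar_mat A (mat_diag n (snd p))"
    "\<And>p. p \<in> P \<Longrightarrow> card ?U \<le> card (C p) * card (?T (fst p))"
    by metis
  have count: "card {p \<in> P. A \<in> C p} \<le> fact n" for A
  proof -
    have "{p \<in> P. A \<in> C p} \<subseteq> {(s, t). s permutes {..<n} \<and> t \<in> ?T s \<and> inj_on t {..<n} \<and> similar_mat A (mat_diag n t)}"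
      using C(2) R by (fastforce simp: P_def)
    then show ?thesis using card_ordered_eigenvalues[of n A] card_mono le_trans by blast
  qed
  have "(\<Sum>s\<in>?Q. real (card (R s)) / real (card (?T s))) * real (card ?U) =
      (\<Sum>s\<in>?Q. \<Sum>t\<in>R s. real (card ?U) / real (card (?T s)))"
    by (simp add: sum_distrib_right)
  also have "\<dots> = (\<Sum>p\<in>P. real (card ?U) / real (card (?T (fst p))))"
    unfolding P_def using finQ finR by (subst sum.Sigma) (auto simp: split_beta)
  also have "\<dots> \<le> (\<Sum>p\<in>P. real (card (C p)))"
  proof (rule sum_mono)
    fix p assume p: "p \<in> P"
    have "real (card ?U) \<le> real (card (C p) * card (?T (fst p)))" using C(3)[OF p] of_nat_le_iff by blast
    moreover have "card (?T (fst p)) > 0" using finT(2)[of "fst p"] p by (auto simp: P_def)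
    ultimately show "real (card ?U) / real (card (?T (fst p))) \<le> real (card (C p))"
      by (simp add: divide_le_eq)
  qed
  also have "\<dots> = (\<Sum>p\<in>P. \<Sum>A\<in>Y. if A \<in> C p then 1 else 0)"
  proof (rule sum.cong[OF refl])
    fix p assume "p \<in> P"
    then have "Y \<inter> C p = C p" using C(1) by blast
    then show "real (card (C p)) = (\<Sum>A\<in>Y. if A \<in> C p then 1 else 0)"
      using finY by (simp add: sum.If_cases)
  qed
  also have "\<dots> = (\<Sum>A\<in>Y. \<Sum>p\<in>P. if A \<in> C p then 1 else 0)" by (rule sum.swap)
  also have "\<dots> = (\<Sum>A\<in>Y. real (card {p \<in> P. A \<in> C p}))"
    using finP by (simp add: sum.If_cases Int_def)
  also have "\<dots> \<le> (\<Sum>A\<in>Y. fact n)"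
  proof (rule sum_mono)
    fix A show "real (card {p \<in> P. A \<in> C p}) \<le> fact n"
      using count[of A] by (metis of_nat_fact of_nat_le_iff)
  qed
  finally show ?thesis by (simp add: mult.commute)
qed

lemma unitary_power_proportion:
  assumes M: "Factorial_Ring.prime M" "M > 2" "coprime M q"
  shows "\<bar>real (card (unitary_powers n M)) / real (card (unitary_matrices n q :: 'a mat set)) -
     (\<Sum>s | s permutes {..<n}. 1 / real M ^ pi' (Pocklington.ord M q) (orbit_type {..<n} s)) / fact n\<bar>
     \<le> 4 * real n ^ 2 / real q"
proof -
  let ?U = "unitary_matrices n q :: 'a mat set"
  let ?T = "\<lambda>s. torus q {..<n} s :: (nat \<Rightarrow> 'a) set"
  let ?TM = "\<lambda>s. torus_powers M q {..<n} s :: (nat \<Rightarrow> 'a) set"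
  let ?Q = "{s. s permutes {..<n}}"
  let ?w = "\<lambda>s. 1 / real M ^ pi' (Pocklington.ord M q) (orbit_type {..<n} s)"
  let ?I = "\<lambda>s. {t \<in> ?T s. inj_on t {..<n}}" and ?N = "\<lambda>s. {t \<in> ?T s. \<not> inj_on t {..<n}}"
  let ?e = "4 * real n ^ 2 / real q"
  have cardQ: "real (card ?Q) = fact n" using card_permutations[of "{..<n}" n] by simp
  have U0: "real (card ?U) > 0" using card_unitary_pos by simp
  \<comment> \<open>Discarding the non-injective points, a fraction of at most ?e of the torus,
    costs each of the two proportions at most ?e.\<close>
  have basic: "real (card (?I s \<inter> ?TM s)) / card (?T s) \<ge> ?w s - ?e"
      "real (card (?I s - ?TM s)) / card (?T s) \<ge> 1 - ?w s - ?e" if "s \<in> ?Q" for s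
  proof -
    have bij: "bij_betw s {..<n} {..<n}" using that by (simp add: permutes_imp_bij)
    have fin: "finite (?T s)" and pos: "real (card (?T s)) > 0"
      using finite_torus[OF _ bij] card_torus_pos[OF _ bij] by auto
    have TM: "?TM s \<subseteq> ?T s"
    proof
      fix g assume "g \<in> ?TM s"
      then obtain f where f: "f \<in> ?T s" "g = restrict (\<lambda>i. f i ^ M) {..<n}" by (auto simp: torus_powers_def)
      have "s i < n" if "i < n" for i using bij that by (auto simp: bij_betw_def)
      then show "g \<in> ?T s" using f by (auto simp: torus_iff power_inverse simp flip: power_mult) (simp add: mult.commute)
    qed
    have "card (?T s) = card (?TM s) * M ^ pi' (Pocklington.ord M q) (orbit_type {..<n} s)"
      by (rule card_torus_powers[OF _ bij M]) simp
    then have w: "real (card (?TM s)) = ?w s * card (?T s)"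
      using M(2) by (simp add: field_simps)
    have "real q * card (?N s) \<le> 4 * real n ^ 2 * card (?T s)"
      using card_torus_not_inj[OF _ bij] by simp
    then have e: "real (card (?N s)) \<le> ?e * card (?T s)"
      using q_ge_2 by (simp add: field_simps)
    have "card (?TM s) \<le> card ((?I s \<inter> ?TM s) \<union> ?N s)"
      by (rule card_mono) (use TM fin in auto)
    also have "\<dots> \<le> card (?I s \<inter> ?TM s) + card (?N s)" by (rule card_Un_le)
    finally have "?w s * card (?T s) - ?e * card (?T s) \<le> real (card (?I s \<inter> ?TM s))"
      using w e by linarith
    then show "real (card (?I s \<inter> ?TM s)) / card (?T s) \<ge> ?w s - ?e"
      using pos by (simp add: le_divide_eq left_diff_distrib)
    have "card (?T s) \<le> card ((?I s - ?TM s) \<union> (?N s \<union> ?TM s))"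
      by (rule card_mono) (use TM fin finite_subset[OF TM fin] in auto)
    also have "\<dots> \<le> card (?I s - ?TM s) + (card (?N s) + card (?TM s))"
      using card_Un_le[of "?I s - ?TM s" "?N s \<union> ?TM s"] card_Un_le[of "?N s" "?TM s"] by linarith
    finally have "card (?T s) - ?w s * card (?T s) - ?e * card (?T s) \<le> real (card (?I s - ?TM s))"
      using w e by linarith
    then show "real (card (?I s - ?TM s)) / card (?T s) \<ge> 1 - ?w s - ?e"
      using pos by (simp add: le_divide_eq left_diff_distrib)
  qed
  have "(\<Sum>s\<in>?Q. real (card (?I s \<inter> ?TM s)) / card (?T s)) * real (card ?U) \<le> fact n * real (card (unitary_powers n M))"
  proof (rule sum_class_weights_le)
    fix s t assume st: "s permutes {..<n}" "t \<in> ?I s \<inter> ?TM s"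
    from ex_class[OF st(1), of t M] st(2)
    show "\<exists>Z\<subseteq>unitary_powers n M. (\<forall>A\<in>Z. similar_mat A (mat_diag n t)) \<and> card ?U \<le> card Z * card (?T s)"
      by blast
  qed (use unitary_powers_subset in auto)
  moreover have "(\<Sum>s\<in>?Q. ?w s - ?e) \<le> (\<Sum>s\<in>?Q. real (card (?I s \<inter> ?TM s)) / card (?T s))"
    by (rule sum_mono[OF basic(1)])
  ultimately have 1: "(\<Sum>s\<in>?Q. ?w s - ?e) * card ?U \<le> fact n * real (card (unitary_powers n M))"
    using U0 by (meson mult_right_mono less_imp_le order_trans)
  have "(\<Sum>s\<in>?Q. real (card (?I s - ?TM s)) / card (?T s)) * real (card ?U) \<le> fact n * real (card (?U - unitary_powers n M))"
  proof (rule sum_class_weights_le)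
    fix s t assume st: "s permutes {..<n}" "t \<in> ?I s - ?TM s"
    from ex_class[OF st(1), of t M] st(2)
    show "\<exists>Z\<subseteq>?U - unitary_powers n M. (\<forall>A\<in>Z. similar_mat A (mat_diag n t)) \<and> card ?U \<le> card Z * card (?T s)"
      by blast
  qed auto
  moreover have "(\<Sum>s\<in>?Q. 1 - ?w s - ?e) \<le> (\<Sum>s\<in>?Q. real (card (?I s - ?TM s)) / card (?T s))"
    by (rule sum_mono[OF basic(2)])
  ultimately have 2: "(\<Sum>s\<in>?Q. 1 - ?w s - ?e) * card ?U \<le> fact n * real (card (?U - unitary_powers n M))"
    using U0 by (meson mult_right_mono less_imp_le order_trans)
  \<comment> \<open>The lower bound for the non-powers is turned into the missing upper bound for
    the powers.\<close>
  have compl: "real (card (?U - unitary_powers n M)) = card ?U - real (card (unitary_powers n M))"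
    using card_Diff_subset[OF finite_subset[OF unitary_powers_subset finite_unitary] unitary_powers_subset]
      card_mono[OF finite_unitary unitary_powers_subset] by (simp add: of_nat_diff)
  define a u f W where "a = real (card (unitary_powers n M))" and "u = real (card ?U)"
    and "f = (fact n :: real)" and "W = (\<Sum>s\<in>?Q. ?w s)"
  have f: "f > 0" by (simp add: f_def)
  have u: "u > 0" using U0 by (simp add: u_def)
  have 1: "(W - f * ?e) * u \<le> f * a"
    using 1 cardQ by (simp add: sum_subtractf W_def f_def u_def a_def)
  have 2: "(f - W - f * ?e) * u \<le> f * (u - a)"
    using 2 cardQ unfolding compl by (simp add: sum_subtractf W_def f_def u_def a_def)
  have "W / f - ?e \<le> a / u"
    using 1 f u by (simp add: field_simps)
  moreover have "1 - W / f - ?e \<le> 1 - a / u"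
    using 2 f u by (simp add: field_simps)
  ultimately show ?thesis
    unfolding a_def[symmetric] u_def[symmetric] f_def[symmetric] W_def[symmetric] by linarith
qed

end

subsection \<open>Transfer to the algebraic closure of the prime field\<close>

text \<open>A statement about a single prime p, with an explicit error. The limit in the theorem
  runs over all characteristics at once and could not fail at one prime, whereas this bound can,
  which is what the choice of a prime below relies on.\<close>

definition proportion_bound :: "nat \<Rightarrow> bool" where
  "proportion_bound p \<longleftrightarrow> (\<forall>n M e. e > 0 \<longrightarrow> Factorial_Ring.prime M \<longrightarrow> M > 2 \<longrightarrow> coprime M (p ^ e) \<longrightarrow>
     \<bar>real (card (power_image (unitary_group n (p ^ e)) M)) / real (card (carrier (unitary_group n (p ^ e)))) -
      (\<Sum>s | s permutes {..<n}. 1 / real M ^ pi' (Pocklington.ord M (p ^ e)) (orbit_type {..<n} s)) / fact n\<bar>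
     \<le> 4 * real n ^ 2 / real (p ^ e))"

text \<open>The type class machinery of matrices needs a type for the ground field, which depends on the
  characteristic. A type cannot depend on a variable, so it is defined for one prime only, chosen
  to violate the bound if some prime does.\<close>

definition chosen_prime :: nat where
  "chosen_prime = (if \<exists>p. Factorial_Ring.prime p \<and> \<not> proportion_bound p
     then SOME p. Factorial_Ring.prime p \<and> \<not> proportion_bound p else 2)"

lemma prime_chosen_prime: "Factorial_Ring.prime chosen_prime"
proof (cases "\<exists>p. Factorial_Ring.prime p \<and> \<not> proportion_bound p")
  case True
  then show ?thesis using someI_ex[OF True] by (simp add: chosen_prime_def)
qed (auto simp: chosen_prime_def)

lemma proportion_bound_if_chosen_prime:
  assumes "proportion_bound chosen_prime" "Factorial_Ring.prime p"
  shows "proportion_bound p"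
proof (rule ccontr)
  assume "\<not> proportion_bound p"
  then have ex: "\<exists>p. Factorial_Ring.prime p \<and> \<not> proportion_bound p" using assms(2) by blast
  then have "\<not> proportion_bound chosen_prime"
    using someI_ex[OF ex] by (simp add: chosen_prime_def)
  then show False using assms(1) by simp
qed

section \<open>The algebraic closure as a field type\<close>

definition closure_ring :: "fpbar ring" where
  "closure_ring = fq_closure chosen_prime"

lemma prime_field: "field (residue_ring (int chosen_prime))"
  using prime_chosen_prime prime_gt_1_nat[OF prime_chosen_prime]
  by (intro residues_prime.is_field) (simp add: residues_prime_def)

lemma closure_ring_eq: "closure_ring = field.alg_closure (residue_ring (int chosen_prime))"
  by (simp add: closure_ring_def fq_closure_def aprimedivisor_of_prime prime_chosen_prime)

lemma algebraically_closed_closure_ring: "algebraically_closed closure_ring"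
proof -
  interpret algebraic_closure closure_ring
    "ring.indexed_const (residue_ring (int chosen_prime)) ` carrier (residue_ring (int chosen_prime))"
    unfolding closure_ring_eq by (rule field.alg_closureE(1)[OF prime_field])
  show ?thesis by (rule algebraically_closed_axioms)
qed

lemmas field_closure_ring = algebraically_closed.axioms(1)[OF algebraically_closed_closure_ring]

interpretation closure: cring closure_ring
  using field_closure_ring by (simp add: domain.axioms(1) field.axioms(1))

typedef closure_elt = "carrier closure_ring"
  using closure.zero_closed by blast

setup_lifting type_definition_closure_elt

instantiation closure_elt :: field
begin

lift_definition zero_closure_elt :: closure_elt is "ring.zero closure_ring" by (rule closure.zero_closed)
lift_definition one_closure_elt :: closure_elt is "monoid.one closure_ring" by (rule closure.one_closed)
lift_definition plus_closure_elt :: "closure_elt \<Rightarrow> closure_elt \<Rightarrow> closure_elt" is "ring.add closure_ring"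
  by (rule closure.a_closed)
lift_definition minus_closure_elt :: "closure_elt \<Rightarrow> closure_elt \<Rightarrow> closure_elt" is "a_minus closure_ring"
  by (rule closure.minus_closed)
lift_definition times_closure_elt :: "closure_elt \<Rightarrow> closure_elt \<Rightarrow> closure_elt" is "monoid.mult closure_ring"
  by (rule closure.m_closed)
lift_definition uminus_closure_elt :: "closure_elt \<Rightarrow> closure_elt" is "a_inv closure_ring"
  by (rule closure.a_inv_closed)
text \<open>The class of fields requires 0 to have inverse 0, so the value at 0 is set by
  hand.\<close>

lift_definition inverse_closure_elt :: "closure_elt \<Rightarrow> closure_elt"
  is "\<lambda>x. if x = ring.zero closure_ring then ring.zero closure_ring else m_inv closure_ring x"
  by (auto simp: field.field_Units[OF field_closure_ring])

definition divide_closure_elt :: "closure_elt \<Rightarrow> closure_elt \<Rightarrow> closure_elt" where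
  "divide_closure_elt x y = x * inverse y"

instance
proof
  fix a b c :: closure_elt
  show "a * b * c = a * (b * c)" by transfer (rule closure.m_assoc)
  show "a * b = b * a" by transfer (rule closure.m_comm)
  show "1 * a = a" by transfer (rule closure.l_one)
  show "a + b + c = a + (b + c)" by transfer (rule closure.a_assoc)
  show "a + b = b + a" by transfer (rule closure.a_comm)
  show "0 + a = a" by transfer (rule closure.l_zero)
  show "- a + a = 0" by transfer (rule closure.l_neg)
  show "a - b = a + - b" by transfer (simp add: a_minus_def)
  show "(a + b) * c = a * c + b * c" by transfer (rule closure.l_distr)
  show "(0 :: closure_elt) \<noteq> 1" by transfer (metis field.axioms(1)[OF field_closure_ring] domain.zero_not_one)
  show "a \<noteq> 0 \<Longrightarrow> inverse a * a = 1" by transfer (simp add: field.field_Units[OF field_closure_ring])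
  show "a div b = a * inverse b" by (simp add: divide_closure_elt_def)
  show "inverse (0 :: closure_elt) = 0" by transfer simp
qed

end

lemma Rep_in_carrier [simp]: "Rep_closure_elt x \<in> carrier closure_ring"
  by (rule Rep_closure_elt)

lemma Rep_power: "Rep_closure_elt (x ^ k) = Rep_closure_elt x [^]\<^bsub>closure_ring\<^esub> k"
  by (induction k) (simp_all add: one_closure_elt.rep_eq times_closure_elt.rep_eq closure.m_comm)

lemma Rep_sum:
  assumes "finite A"
  shows "Rep_closure_elt (sum f A) = (\<Oplus>\<^bsub>closure_ring\<^esub>i\<in>A. Rep_closure_elt (f i))"
  using assms by (induction A rule: finite_induct) (simp_all add: zero_closure_elt.rep_eq plus_closure_elt.rep_eq)

text \<open>Polynomials as lists in the explicit ring begin with the leading coefficient,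
  \<open>Poly\<close> with the constant one, hence the reversal.\<close>

lemma eval_Rep:
  "closure.eval (map Rep_closure_elt cs) (Rep_closure_elt x) = Rep_closure_elt (poly (Poly (rev cs)) x)"
proof (induction cs)
  case Nil
  then show ?case by (simp add: zero_closure_elt.rep_eq)
next
  case (Cons c cs)
  have "poly (Poly (rev (c # cs))) x = c * x ^ length cs + poly (Poly (rev cs)) x"
    by (simp add: Poly_append poly_monom)
  then show ?case
    using Cons by (simp add: plus_closure_elt.rep_eq times_closure_elt.rep_eq Rep_power)
qed

instance closure_elt :: alg_closed_field
proof
  fix p :: "closure_elt poly"
  assume p: "Polynomial.degree p > 0"
  interpret L: algebraically_closed closure_ring by (rule algebraically_closed_closure_ring)
  let ?P = "map Rep_closure_elt (rev (coeffs p))"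
  have p0: "p \<noteq> 0" using p by auto
  have len: "length ?P = Suc (Polynomial.degree p)"
    using p0 by (simp add: length_coeffs_degree)
  have "hd ?P \<noteq> ring.zero closure_ring"
  proof -
    have "hd (rev (coeffs p)) \<noteq> 0" using p0 by (simp add: hd_rev last_coeffs_eq_coeff_degree)
    then have "Rep_closure_elt (hd (rev (coeffs p))) \<noteq> Rep_closure_elt 0" by (simp add: Rep_closure_elt_inject)
    then show ?thesis using p0 by (simp add: hd_map zero_closure_elt.rep_eq)
  qed
  then have P: "?P \<in> carrier (poly_ring closure_ring)"
    by (auto simp: univ_poly_def polynomial_def)
  \<comment> \<open>\<open>splitted\<close> makes the number of roots equal to the degree, which is
    positive.\<close>
  then have "closure.splitted ?P" by (rule L.roots_over_carrier)
  then have "size (closure.roots ?P) > 0"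
    using p len by (simp add: closure.splitted_def)
  then obtain x where "x \<in># closure.roots ?P" 
    by (auto simp flip: nonempty_has_size)
  then have x: "x \<in> carrier closure_ring" "closure.eval ?P x = ring.zero closure_ring"
    using L.roots_mem_iff_is_root[OF P] by (auto simp: closure.is_root_def)
  obtain y where y: "x = Rep_closure_elt y" using x(1) by (metis Abs_closure_elt_inverse)
  have "Rep_closure_elt (poly p y) = Rep_closure_elt 0"
    using x(2) eval_Rep[of "rev (coeffs p)" y] y by (simp add: zero_closure_elt.rep_eq)
  then show "\<exists>y. poly p y = 0" by (auto simp: Rep_closure_elt_inject)
qed

text \<open>The embedding of the prime field sends k modulo p to the k-fold sum of 1, so p is 0 in
  the closure; the characteristic then divides the prime p and is not 1.\<close>

lemma CHAR_closure_elt: "CHAR(closure_elt) = chosen_prime"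
proof -
  let ?R = "residue_ring (int chosen_prime)"
  define h :: "int \<Rightarrow> (int list \<times> nat) multiset \<Rightarrow> int" where "h = ring.indexed_const ?R"
  interpret R: field ?R by (rule prime_field)
  have h: "h \<in> Ring.ring_hom ?R closure_ring"
    unfolding h_def closure_ring_eq by (rule field.alg_closureE(2)[OF prime_field])
  have p: "chosen_prime > 1" by (rule prime_gt_1_nat[OF prime_chosen_prime])
  have "Rep_closure_elt (of_nat k) = h (int k mod int chosen_prime)" for k
  proof (induction k)
    case 0
    have "h (ring.zero ?R) = ring.zero closure_ring"
      by (rule Ring.ring_hom_zero[OF h R.ring_axioms closure.ring_axioms])
    then show ?case by (simp add: zero_closure_elt.rep_eq residue_ring_def)
  next
    case (Suc k)
    have "h (int k mod int chosen_prime \<oplus>\<^bsub>?R\<^esub> \<one>\<^bsub>?R\<^esub>) = h (int k mod int chosen_prime) \<oplus>\<^bsub>closure_ring\<^esub> h \<one>\<^bsub>?R\<^esub>"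
      by (rule Ring.ring_hom_add[OF h]) (use p in \<open>auto simp: residue_ring_def\<close>)
    also have "int k mod int chosen_prime \<oplus>\<^bsub>?R\<^esub> \<one>\<^bsub>?R\<^esub> = int (Suc k) mod int chosen_prime"
      by (simp add: residue_ring_def mod_add_left_eq mod_add_right_eq add.commute)
    also have "h \<one>\<^bsub>?R\<^esub> = \<one>\<^bsub>closure_ring\<^esub>" by (rule Ring.ring_hom_one[OF h])
    finally show ?case using Suc[symmetric]
      by (simp add: plus_closure_elt.rep_eq one_closure_elt.rep_eq closure.a_comm)
  qed
  from this[of chosen_prime] this[of 0] have "of_nat chosen_prime = (0 :: closure_elt)"
    by (simp flip: Rep_closure_elt_inject)
  then have dvd: "CHAR(closure_elt) dvd chosen_prime" by (simp add: of_nat_eq_0_iff_char_dvd)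
  show ?thesis
    using dvd prime_chosen_prime CHAR_not_1'[where 'a = closure_elt] by (auto simp: prime_nat_iff)
qed

section \<open>Matrices over the type and over the explicit ring\<close>

abbreviation Rep_mat :: "closure_elt mat \<Rightarrow> fpbar mat" where
  "Rep_mat \<equiv> map_mat Rep_closure_elt"

lemma Rep_mat_inject: "Rep_mat A = Rep_mat B \<longleftrightarrow> A = B"
proof
  assume eq: "Rep_mat A = Rep_mat B"
  have dims: "dim_row A = dim_row B" "dim_col A = dim_col B"
    using arg_cong[OF eq, of dim_row] arg_cong[OF eq, of dim_col] by simp_all
  show "A = B"
  proof (rule eq_matI[OF _ dims])
    fix i j assume ij: "i < dim_row B" "j < dim_col B"
    then have "Rep_closure_elt (A $$ (i, j)) = Rep_closure_elt (B $$ (i, j))"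
      using arg_cong[OF eq, of "\<lambda>A. A $$ (i, j)"] dims by simp
    then show "A $$ (i, j) = B $$ (i, j)" by (simp add: Rep_closure_elt_inject)
  qed
qed simp

lemma carrier_matrix_monoid: "carrier (matrix_monoid n closure_ring) = Rep_mat ` carrier_mat n n"
proof (intro equalityI subsetI)
  fix B assume "B \<in> carrier (matrix_monoid n closure_ring)"
  then have B: "B \<in> carrier_mat n n" "elements_mat B \<subseteq> carrier closure_ring" by (auto simp: matrix_monoid_def)
  have "B = Rep_mat (map_mat Abs_closure_elt B)"
  proof (rule eq_matI)
    fix i j assume "i < dim_row (Rep_mat (map_mat Abs_closure_elt B))" "j < dim_col (Rep_mat (map_mat Abs_closure_elt B))"
    then have ij: "i < dim_row B" "j < dim_col B" by simp_all
    then have "B $$ (i, j) \<in> carrier closure_ring" using B by (intro subsetD[OF B(2)]) (auto intro: elements_matI)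
    then show "B $$ (i, j) = Rep_mat (map_mat Abs_closure_elt B) $$ (i, j)"
      using ij by (simp add: Abs_closure_elt_inverse)
  qed auto
  moreover have "map_mat Abs_closure_elt B \<in> carrier_mat n n" using B(1) by simp
  ultimately show "B \<in> Rep_mat ` carrier_mat n n" by (rule image_eqI)
next
  fix B assume "B \<in> Rep_mat ` carrier_mat n n"
  then show "B \<in> carrier (matrix_monoid n closure_ring)"
    by (auto simp: matrix_monoid_def elements_mat_def)
qed

lemma mult_matrix_monoid:
  assumes "A \<in> carrier_mat n n" "B \<in> carrier_mat n n"
  shows "Rep_mat A \<otimes>\<^bsub>matrix_monoid n closure_ring\<^esub> Rep_mat B = Rep_mat (A * B)"
proof (rule eq_matI)
  fix i j assume "i < dim_row (Rep_mat (A * B))" "j < dim_col (Rep_mat (A * B))"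
  then have ij: "i < n" "j < n" using assms by auto
  have "Rep_mat (A * B) $$ (i, j) = Rep_closure_elt (\<Sum>k<n. A $$ (i, k) * B $$ (k, j))"
    using ij assms mult_index[OF assms ij] by (simp del: index_mult_mat(1))
  also have "\<dots> = (\<Oplus>\<^bsub>closure_ring\<^esub>k\<in>{..<n}. Rep_closure_elt (A $$ (i, k)) \<otimes>\<^bsub>closure_ring\<^esub> Rep_closure_elt (B $$ (k, j)))"
    by (simp add: Rep_sum times_closure_elt.rep_eq)
  also have "\<dots> = (\<Oplus>\<^bsub>closure_ring\<^esub>k\<in>{..<n}. Rep_mat A $$ (i, k) \<otimes>\<^bsub>closure_ring\<^esub> Rep_mat B $$ (k, j))"
    by (rule closure.finsum_cong') (use ij assms in auto)
  finally show "(Rep_mat A \<otimes>\<^bsub>matrix_monoid n closure_ring\<^esub> Rep_mat B) $$ (i, j) = Rep_mat (A * B) $$ (i, j)"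
    using ij by (simp add: matrix_monoid_def)
qed (use assms in \<open>auto simp: matrix_monoid_def\<close>)

lemma one_matrix_monoid: "\<one>\<^bsub>matrix_monoid n closure_ring\<^esub> = Rep_mat (1\<^sub>m n)"
  by (rule eq_matI) (auto simp: matrix_monoid_def zero_closure_elt.rep_eq one_closure_elt.rep_eq)

lemma Units_matrix_monoid:
  "Units (matrix_monoid n closure_ring) =
     Rep_mat ` {A \<in> carrier_mat n n. \<exists>B\<in>carrier_mat n n. B * A = 1\<^sub>m n \<and> A * B = 1\<^sub>m n}"
proof -
  have "Rep_mat A \<in> Units (matrix_monoid n closure_ring) \<longleftrightarrow>
      (\<exists>B\<in>carrier_mat n n. B * A = 1\<^sub>m n \<and> A * B = 1\<^sub>m n)" if "A \<in> carrier_mat n n" for A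
    using that by (auto simp: Units_def carrier_matrix_monoid mult_matrix_monoid one_matrix_monoid Rep_mat_inject)
  moreover have "Units (matrix_monoid n closure_ring) \<subseteq> Rep_mat ` carrier_mat n n"
    by (auto simp: Units_def carrier_matrix_monoid)
  ultimately show ?thesis by (intro equalityI subsetI) (auto dest!: subsetD)
qed

lemma m_inv_general_linear_group:
  assumes C: "C \<in> carrier_mat n n" "D \<in> carrier_mat n n" "D * C = 1\<^sub>m n" "C * D = 1\<^sub>m n"
  shows "m_inv (general_linear_group n closure_ring) (Rep_mat C) = Rep_mat D"
  unfolding m_inv_def
proof (rule the_equality)
  show "Rep_mat D \<in> carrier (general_linear_group n closure_ring) \<and>
    Rep_mat C \<otimes>\<^bsub>general_linear_group n closure_ring\<^esub> Rep_mat D = \<one>\<^bsub>general_linear_group n closure_ring\<^esub> \<and>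
    Rep_mat D \<otimes>\<^bsub>general_linear_group n closure_ring\<^esub> Rep_mat C = \<one>\<^bsub>general_linear_group n closure_ring\<^esub>"
    using C by (auto simp: general_linear_group_def units_of_def Units_matrix_monoid mult_matrix_monoid one_matrix_monoid)
next
  fix Y assume Y: "Y \<in> carrier (general_linear_group n closure_ring) \<and>
    Rep_mat C \<otimes>\<^bsub>general_linear_group n closure_ring\<^esub> Y = \<one>\<^bsub>general_linear_group n closure_ring\<^esub> \<and>
    Y \<otimes>\<^bsub>general_linear_group n closure_ring\<^esub> Rep_mat C = \<one>\<^bsub>general_linear_group n closure_ring\<^esub>"
  then obtain E where E: "E \<in> carrier_mat n n" "Y = Rep_mat E"
    by (auto simp: general_linear_group_def units_of_def Units_matrix_monoid)
  have "E * C = 1\<^sub>m n"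
    using Y C(1) E by (simp add: general_linear_group_def units_of_def mult_matrix_monoid one_matrix_monoid Rep_mat_inject)
  then have "E = D" by (rule left_right_inverse_unique[OF C(1) E(1) C(2) _ C(4)])
  then show "Y = Rep_mat D" by (simp add: E(2))
qed

lemma transpose_frobenius_Rep_mat:
  "transpose_mat (map_mat (\<lambda>a. a [^]\<^bsub>closure_ring\<^esub> q) (Rep_mat A)) = Rep_mat (star q A)" for q :: nat
  by (rule eq_matI) (auto simp: star_def Rep_power)

context
  fixes e :: nat
  assumes e: "e > 0"
begin

interpretation frobenius_field "chosen_prime ^ e" "TYPE(closure_elt)"
  by unfold_locales (use e prime_chosen_prime CHAR_closure_elt in auto)

lemma fq_closure_prime_power: "fq_closure (chosen_prime ^ e) = closure_ring"
  using e by (simp add: fq_closure_def closure_ring_eq aprimedivisor_prime_power prime_chosen_prime)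

text \<open>For A with inverse B, F(A) is \<open>star q B\<close>. If this equals A, then
  \<open>star q A * A\<close> is the conjugate transpose of B A = 1. Conversely B is
  \<open>star q A\<close> for a unitary A, and \<open>unitary_star_star\<close> gives F(A) =
  A.\<close>

lemma carrier_unitary_group:
  "carrier (unitary_group n (chosen_prime ^ e)) = Rep_mat ` unitary_matrices n (chosen_prime ^ e)"
proof -
  let ?q = "chosen_prime ^ e"
  have frob: "unitary_frobenius n ?q (Rep_mat A) = Rep_mat (star ?q B)"
    if "A \<in> carrier_mat n n" "B \<in> carrier_mat n n" "B * A = 1\<^sub>m n" "A * B = 1\<^sub>m n" for A B
    unfolding unitary_frobenius_def fq_closure_prime_power transpose_frobenius_Rep_mat
  proof (rule m_inv_general_linear_group)
    show "star ?q B * star ?q A = 1\<^sub>m n" using star_mult[OF that(1,2), symmetric] that(4) by simp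
    show "star ?q A * star ?q B = 1\<^sub>m n" using star_mult[OF that(2,1), symmetric] that(3) by simp
  qed (use that(1,2) in auto)
  have carrier: "carrier (unitary_group n ?q) =
      {Y \<in> Units (matrix_monoid n closure_ring). unitary_frobenius n ?q Y = Y}"
    by (simp add: unitary_group_def general_linear_group_def units_of_def fq_closure_prime_power)
  show ?thesis
  proof (intro equalityI subsetI)
    fix Y assume "Y \<in> carrier (unitary_group n ?q)"
    then obtain A B where A: "Y = Rep_mat A" "A \<in> carrier_mat n n" "B \<in> carrier_mat n n"
      "B * A = 1\<^sub>m n" "A * B = 1\<^sub>m n" "unitary_frobenius n ?q Y = Y"
      unfolding carrier Units_matrix_monoid by blast
    have "star ?q B = A" using frob[OF A(2-5)] A(1,6) by (simp add: Rep_mat_inject)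
    then have "star ?q A * A = star ?q A * star ?q B" by simp
    also have "\<dots> = star ?q (B * A)" by (rule star_mult[symmetric, OF A(3,2)])
    finally have "A \<in> unitary_matrices n ?q" using A(2,4) by (simp add: unitary_matrices_def)
    then show "Y \<in> Rep_mat ` unitary_matrices n ?q" using A(1) by blast
  next
    fix Y assume "Y \<in> Rep_mat ` unitary_matrices n ?q"
    then obtain A where A: "A \<in> unitary_matrices n ?q" "Y = Rep_mat A" by blast
    have B: "star ?q A \<in> carrier_mat n n" "star ?q A * A = 1\<^sub>m n" "A * star ?q A = 1\<^sub>m n"
      using A(1) unitary_right_inverse[OF A(1)] by (auto simp: unitary_matrices_def)
    have "unitary_frobenius n ?q Y = Y"
      using frob[OF unitary_carrier[OF A(1)] B] unitary_star_star[OF A(1)] A(2) by simp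
    moreover have "Y \<in> Units (matrix_monoid n closure_ring)"
      unfolding Units_matrix_monoid using A B unitary_carrier[OF A(1)] by blast
    ultimately show "Y \<in> carrier (unitary_group n ?q)" unfolding carrier by blast
  qed
qed

lemma pow_unitary_group:
  assumes "A \<in> carrier_mat n n"
  shows "Rep_mat A [^]\<^bsub>unitary_group n (chosen_prime ^ e)\<^esub> (k::nat) = Rep_mat (A ^\<^sub>m k)"
proof (induction k)
  case 0
  then show ?case using assms
    by (simp add: nat_pow_def unitary_group_def general_linear_group_def units_of_def fq_closure_prime_power one_matrix_monoid)
next
  case (Suc k)
  then show ?case using mult_matrix_monoid[OF pow_mat_carrier[OF assms] assms]
    by (simp add: nat_pow_def unitary_group_def general_linear_group_def units_of_def fq_closure_prime_power)
qed

lemma power_image_unitary_group: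
  "power_image (unitary_group n (chosen_prime ^ e)) M = Rep_mat ` unitary_powers n M"
  unfolding power_image_def carrier_unitary_group unitary_powers_def image_image
  by (intro image_cong refl pow_unitary_group unitary_carrier)

lemma chosen_prime_proportion:
  assumes "Factorial_Ring.prime M" "M > 2" "coprime M (chosen_prime ^ e)"
  shows "\<bar>real (card (power_image (unitary_group n (chosen_prime ^ e)) M)) /
      real (card (carrier (unitary_group n (chosen_prime ^ e)))) -
      (\<Sum>s | s permutes {..<n}. 1 / real M ^ pi' (Pocklington.ord M (chosen_prime ^ e)) (orbit_type {..<n} s)) / fact n\<bar>
     \<le> 4 * real n ^ 2 / real (chosen_prime ^ e)"
proof -
  have "inj_on Rep_mat B" for B by (simp add: inj_on_def Rep_mat_inject)
  then show ?thesis
    using unitary_power_proportion[OF assms, of n]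
    by (simp add: carrier_unitary_group power_image_unitary_group card_image)
qed

end

section \<open>From the average over permutations to the sum over partitions\<close>

lemma unitary_group_proportion:
  assumes "primepow q" "Factorial_Ring.prime M" "M > 2" "coprime M q"
  shows "\<bar>real (card (power_image (unitary_group n q) M)) / real (card (carrier (unitary_group n q))) -
      (\<Sum>\<mu>\<in>partitions n. 1 / real M ^ pi' (Pocklington.ord M q) \<mu>
             * (\<Prod>i=1..n. 1 / (fact (count \<mu> i) * real i ^ count \<mu> i)))\<bar>
     \<le> 4 * real n ^ 2 / real q"
proof -
  obtain p e where p: "Factorial_Ring.prime p" "e > 0" "q = p ^ e"
    using assms(1) by (auto simp: primepow_def)
  have "proportion_bound chosen_prime"
    unfolding proportion_bound_def using chosen_prime_proportion by blast
  then have "proportion_bound p" using p(1) by (rule proportion_bound_if_chosen_prime)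
  then have "\<bar>real (card (power_image (unitary_group n q) M)) / real (card (carrier (unitary_group n q))) -
      (\<Sum>s | s permutes {..<n}. 1 / real M ^ pi' (Pocklington.ord M q) (orbit_type {..<n} s)) / fact n\<bar>
      \<le> 4 * real n ^ 2 / real q"
    using p assms unfolding proportion_bound_def by blast
  also have "(\<Sum>s | s permutes {..<n}. 1 / real M ^ pi' (Pocklington.ord M q) (orbit_type {..<n} s)) / fact n =
      (\<Sum>\<mu>\<in>partitions n. 1 / real M ^ pi' (Pocklington.ord M q) \<mu> / real (centralizer_order \<mu>))"
    using sum_permutations_orbit_type[of "{..<n}" "\<lambda>\<mu>. 1 / real M ^ pi' (Pocklington.ord M q) \<mu>"] by simp
  also have "\<dots> = (\<Sum>\<mu>\<in>partitions n. 1 / real M ^ pi' (Pocklington.ord M q) \<mu>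
             * (\<Prod>i=1..n. 1 / (fact (count \<mu> i) * real i ^ count \<mu> i)))"
    by (intro sum.cong refl) (simp only: prod_inverse_eq_centralizer_order times_divide_eq_right mult_1_right)
  finally show ?thesis .
qed

theorem proposition5p2:
  fixes n M :: nat
  assumes "n \<ge> 1" and "Factorial_Ring.prime M" and "M > 2"
  shows
    "((\<lambda>q::nat.
        real (card (power_image (unitary_group n q) M)) / real (card (carrier (unitary_group n q)))
        - (\<Sum>\<mu>\<in>partitions n. 1 / real M ^ pi' (Pocklington.ord M q) \<mu>
             * (\<Prod>i=1..n. 1 / (fact (count \<mu> i) * real i ^ count \<mu> i))))
       \<longlongrightarrow> 0) (inf at_top (principal {q. primepow q \<and> coprime M q}))
     \<and> (\<forall>q::nat. \<forall>\<sigma>::nat multiset \<Rightarrow> nat \<Rightarrow> nat.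
          primepow q \<longrightarrow> coprime M q \<longrightarrow>
          (\<forall>\<mu>\<in>partitions n. \<sigma> \<mu> \<in> carrier (sym_group n) \<and> cycle_type n (\<sigma> \<mu>) = \<mu>) \<longrightarrow>
          (\<Sum>\<mu>\<in>partitions n. 1 / real M ^ pi' (Pocklington.ord M q) \<mu>
             * (\<Prod>i=1..n. 1 / (fact (count \<mu> i) * real i ^ count \<mu> i)))
          = (\<Sum>\<mu>\<in>partitions n. 1 / (real M ^ pi' (Pocklington.ord M q) \<mu>
               * real (card (centralizer (sym_group n) (\<sigma> \<mu>))))))"
proof (intro conjI allI impI)
  let ?F = "inf at_top (principal {q. primepow q \<and> coprime M q})"
  let ?f = "\<lambda>q. real (card (power_image (unitary_group n q) M)) / real (card (carrier (unitary_group n q)))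
        - (\<Sum>\<mu>\<in>partitions n. 1 / real M ^ pi' (Pocklington.ord M q) \<mu>
             * (\<Prod>i=1..n. 1 / (fact (count \<mu> i) * real i ^ count \<mu> i)))"
  have "((\<lambda>q. 4 * real n ^ 2 / real q) \<longlongrightarrow> 0) ?F"
    by (rule tendsto_mono[OF inf_le1 lim_const_over_n])
  moreover have "\<forall>\<^sub>F q in ?F. norm (?f q) \<le> norm (4 * real n ^ 2 / real q) * 1"
    unfolding eventually_inf_principal
    using unitary_group_proportion[OF _ assms(2,3)] by (intro always_eventually) simp
  ultimately show "(?f \<longlongrightarrow> 0) ?F" by (rule tendsto_0_le)
next
  fix q :: nat and \<sigma> :: "nat multiset \<Rightarrow> nat \<Rightarrow> nat"
  assume \<sigma>: "\<forall>\<mu>\<in>partitions n. \<sigma> \<mu> \<in> carrier (sym_group n) \<and> cycle_type n (\<sigma> \<mu>) = \<mu>"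
  show "(\<Sum>\<mu>\<in>partitions n. 1 / real M ^ pi' (Pocklington.ord M q) \<mu>
             * (\<Prod>i=1..n. 1 / (fact (count \<mu> i) * real i ^ count \<mu> i)))
          = (\<Sum>\<mu>\<in>partitions n. 1 / (real M ^ pi' (Pocklington.ord M q) \<mu>
               * real (card (centralizer (sym_group n) (\<sigma> \<mu>)))))"
  proof (rule sum.cong[OF refl])
    fix \<mu> assume \<mu>: "\<mu> \<in> partitions n"
    then have "card (centralizer (sym_group n) (\<sigma> \<mu>)) = centralizer_order \<mu>"
      using \<sigma> by (simp add: card_centralizer_sym_group)
    then show "1 / real M ^ pi' (Pocklington.ord M q) \<mu>
             * (\<Prod>i=1..n. 1 / (fact (count \<mu> i) * real i ^ count \<mu> i)) =
          1 / (real M ^ pi' (Pocklington.ord M q) \<mu> * real (card (centralizer (sym_group n) (\<sigma> \<mu>))))"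
      unfolding prod_inverse_eq_centralizer_order[OF \<mu>] by simp
  qed
qed

end
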